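(* For $d>2$ let $f(d)=\max_{C}\max_{T}|T|$, where $C$ ranges over all combinatorial $d$-cubes, $T$ ranges over all triangulations of $C$, and $|T|$ is the number of $d$-simplices in $T$. Then there is a constant $c\ge 1.031$ such that $f(d)\ge c^d\, d!$ for every $d>2$.
   Context: A combinatorial $d$-cube is a convex $d$-polytope whose face lattice is isomorphic to that of the cube $[0,1]^d$. A triangulation of a convex $d$-polytope $C$ is a set of $d$-simplices whose vertices are among the vertices of $C$, with union $C$, such that no two of them share an interior point and any two of them intersect in a common face (possibly empty). *)

theory Defs
  imports "HOL-Analysis.Analysis" "HOL-Analysis.Finite_Function_Topology"
begin

text \<open>
  The dimension is quantified inside the statement, so it cannot be the index of a type. All
  polytopes live in the normed space \<^typ>\<open>nat \<Rightarrow>\<^sub>0 real\<close> of finitely supported real sequences, the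
  increasing union of the spaces of sequences supported in \<open>{..<n}\<close>, which are copies of
  n-dimensional real space. Dimension and interior are taken relative to the affine hull.
  The library's \<^const>\<open>aff_dim\<close> and \<^const>\<open>simplex\<close> are restricted to Euclidean spaces (of fixed
  finite dimension); the two definitions below repeat them for an arbitrary real vector space.
\<close>

definition has_aff_dim :: "nat \<Rightarrow> 'a::real_vector set \<Rightarrow> bool" where
  "has_aff_dim d S \<longleftrightarrow>
     (\<exists>B. affine hull B = affine hull S \<and> \<not> affine_dependent B \<and> card B = d + 1)"

definition d_simplex :: "nat \<Rightarrow> 'a::real_vector set \<Rightarrow> bool" where
  "d_simplex d S \<longleftrightarrow> (\<exists>V. \<not> affine_dependent V \<and> card V = d + 1 \<and> S = convex hull V)"

definition vertices :: "'a::real_vector set \<Rightarrow> 'a set" where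
  "vertices P = {v. v extreme_point_of P}"

text \<open>The faces include the empty face and the polytope itself.\<close>

definition faces :: "'a::real_vector set \<Rightarrow> 'a set set" where
  "faces P = {F. F face_of P}"

definition face_lattice_isomorphic :: "'a::real_vector set \<Rightarrow> 'b::real_vector set \<Rightarrow> bool" where
  "face_lattice_isomorphic P Q \<longleftrightarrow>
     (\<exists>\<phi>. bij_betw \<phi> (faces P) (faces Q) \<and>
          (\<forall>F\<in>faces P. \<forall>G\<in>faces P. F \<subseteq> G \<longleftrightarrow> \<phi> F \<subseteq> \<phi> G))"

definition standard_cube :: "nat \<Rightarrow> (nat \<Rightarrow>\<^sub>0 real) set" where
  "standard_cube d =
     {x. (\<forall>i<d. 0 \<le> Poly_Mapping.lookup x i \<and> Poly_Mapping.lookup x i \<le> 1) \<and>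
         (\<forall>i\<ge>d. Poly_Mapping.lookup x i = 0)}"

definition combinatorial_cube :: "nat \<Rightarrow> (nat \<Rightarrow>\<^sub>0 real) set \<Rightarrow> bool" where
  "combinatorial_cube d C \<longleftrightarrow>
     polytope C \<and> has_aff_dim d C \<and> face_lattice_isomorphic C (standard_cube d)"

definition triangulation ::
    "nat \<Rightarrow> 'a::real_normed_vector set \<Rightarrow> 'a set set \<Rightarrow> bool" where
  "triangulation d C T \<longleftrightarrow>
     (\<forall>S\<in>T. d_simplex d S \<and> vertices S \<subseteq> vertices C) \<and>
     \<Union>T = C \<and>
     (\<forall>S\<in>T. \<forall>S'\<in>T. S \<noteq> S' \<longrightarrow> rel_interior S \<inter> rel_interior S' = {}) \<and>
     (\<forall>S\<in>T. \<forall>S'\<in>T. (S \<inter> S') face_of S \<and> (S \<inter> S') face_of S')"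

text \<open>
  Both maxima are over nonempty finite sets of numbers: a combinatorial d-cube has \<open>2 ^ d\<close>
  vertices, so every triangulation is finite with at most \<open>2 ^ d choose (d + 1)\<close> simplices, and
  every polytope has a triangulation.
\<close>

definition max_cube_triangulation :: "nat \<Rightarrow> nat" where
  "max_cube_triangulation d =
     Max ((\<lambda>C. Max (card ` {T. triangulation d C T})) ` {C. combinatorial_cube d C})"

end

theory Submission
  imports Defs
begin

text \<open>
  The product of a combinatorial d-cube with a combinatorial e-cube is a combinatorial
  (d + e)-cube, and the staircase refinement of the product of two triangulations has
  \<open>(d + e) choose d\<close> simplices in each product of two simplices. Hence \<open>f d / fact d\<close> is
  supermultiplicative. The prism over a trapezoid is a combinatorial 3-cube with a triangulation
  into 7 simplices, one more than the unit cube admits, so \<open>f d / fact d \<ge> (7 / 6) ^ (d div 3)\<close>;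
  the constant comes from the worst case d = 5, as \<open>1.031 ^ 5 < 7 / 6\<close>.

  A triangulation is handled as a labelled family of vertex sets in which every point has a unique
  convex weight function supported on a member of the family. For a product, the uniqueness and
  existence of such weights is the uniqueness and existence of the monotone coupling of two
  finitely supported probability distributions.
\<close>

section \<open>Triangulations as families of weight functions\<close>

text \<open>A d-simplex spanned by vertices of the unit d-cube has volume at least 1/d!, so no
  triangulation of the unit cube has more than d! simplices. A ratio above 1 needs a combinatorial
  cube that is not affinely a cube, and products carry the gain of one good example into every
  multiple of its dimension. Weight functions are the bookkeeping because they are defined on all
  labels and vanish off the simplex, so weights on different simplices can be compared as functions:
  uniqueness of the weights of a point expresses at once that each simplex is affinely independent
  and that any two meet in a common face. For products the labels are natural numbers; their order,
  the same for all simplices, makes the staircases in neighbouring products agree on common faces.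
  Since \<open>max_cube_triangulation\<close> is built from \<open>Max\<close>, a lower bound also
  requires a uniform finite bound on the sizes of all triangulations. The value 1.031 is the fifth
  root of 7/6, about 1.0313, rounded down.\<close>

definition weights :: "'l set \<Rightarrow> ('l \<Rightarrow> real) set" where
  "weights \<sigma> = {u. (\<forall>i. 0 \<le> u i) \<and> (\<forall>i. i \<notin> \<sigma> \<longrightarrow> u i = 0) \<and> sum u \<sigma> = 1}"

lemma weightsI:
  assumes "\<And>i. 0 \<le> u i" "\<And>i. i \<notin> \<sigma> \<Longrightarrow> u i = 0" "sum u \<sigma> = 1"
  shows "u \<in> weights \<sigma>"
  using assms by (auto simp: weights_def)

lemma weightsD:
  assumes "u \<in> weights \<sigma>"
  shows "0 \<le> u i" "i \<notin> \<sigma> \<Longrightarrow> u i = 0" "sum u \<sigma> = 1"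
  using assms by (auto simp: weights_def)

text \<open>A sum over an infinite set is 0 by convention, so total mass 1 rules infinite sets
  out.\<close>

lemma weights_finite: "u \<in> weights \<sigma> \<Longrightarrow> finite \<sigma>"
  by (rule ccontr) (auto simp: weights_def)

lemma sum_weights:
  fixes g :: "'l \<Rightarrow> 'a::real_vector"
  assumes "u \<in> weights \<sigma>" "finite S" "\<sigma> \<subseteq> S"
  shows "(\<Sum>i\<in>S. u i *\<^sub>R g i) = (\<Sum>i\<in>\<sigma>. u i *\<^sub>R g i)"
  using assms by (intro sum.mono_neutral_right) (auto simp: weights_def)

lemma weights_mono:
  assumes "u \<in> weights \<sigma>" "finite \<tau>" "\<sigma> \<subseteq> \<tau>"
  shows "u \<in> weights \<tau>"
proof -
  have "sum u \<tau> = sum u \<sigma>"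
    using assms by (intro sum.mono_neutral_right) (auto simp: weights_def)
  then show ?thesis using assms by (auto simp: weights_def)
qed

lemma weights_restrict:
  assumes "u \<in> weights \<tau>" "\<And>i. i \<notin> \<sigma> \<Longrightarrow> u i = 0"
  shows "u \<in> weights (\<sigma> \<inter> \<tau>)"
proof -
  have "sum u (\<sigma> \<inter> \<tau>) = sum u \<tau>"
    using assms weights_finite[OF assms(1)] by (intro sum.mono_neutral_left) auto
  then show ?thesis using assms by (auto simp: weights_def)
qed

lemma weights_combine:
  assumes "u \<in> weights \<sigma>" "u' \<in> weights \<sigma>" "0 \<le> t" "t \<le> 1"
  shows "(\<lambda>i. (1 - t) * u i + t * u' i) \<in> weights \<sigma>"
  using assms by (auto simp: weights_def sum.distrib simp flip: sum_distrib_left)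

definition independent_labels :: "'l set \<Rightarrow> ('l \<Rightarrow> 'a::real_vector) \<Rightarrow> bool" where
  "independent_labels \<sigma> v \<longleftrightarrow> (\<forall>u\<in>weights \<sigma>. \<forall>u'\<in>weights \<sigma>.
     (\<Sum>i\<in>\<sigma>. u i *\<^sub>R v i) = (\<Sum>i\<in>\<sigma>. u' i *\<^sub>R v i) \<longrightarrow> u = u')"

lemma convex_hull_weights:
  fixes v :: "'l \<Rightarrow> 'a::real_vector"
  assumes "finite \<sigma>"
  shows "convex hull (v ` \<sigma>) = {\<Sum>i\<in>\<sigma>. u i *\<^sub>R v i |u. u \<in> weights \<sigma>}"
proof -
  have 1: "(\<Sum>i\<in>\<sigma>. u i *\<^sub>R v i) \<in> convex hull (v ` \<sigma>)" if "u \<in> weights \<sigma>" for u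
    using assms weightsD[OF that]
    by (intro convex_sum convex_convex_hull) (auto intro: hull_inc)
  moreover have "convex hull (v ` \<sigma>) \<subseteq> {\<Sum>i\<in>\<sigma>. u i *\<^sub>R v i |u. u \<in> weights \<sigma>}"
  proof (rule hull_minimal)
    show "v ` \<sigma> \<subseteq> {\<Sum>i\<in>\<sigma>. u i *\<^sub>R v i |u. u \<in> weights \<sigma>}"
    proof clarify
      fix j assume j: "j \<in> \<sigma>"
      have "(\<lambda>i. if i = j then 1 else 0) \<in> weights \<sigma>"
        using j assms by (auto simp: weights_def)
      moreover have "(\<Sum>i\<in>\<sigma>. (if i = j then 1 else 0) *\<^sub>R v i) = v j"
        using j assms by (simp add: if_distrib[of "\<lambda>c. c *\<^sub>R _"] cong: if_cong)
      ultimately show "\<exists>u. v j = (\<Sum>i\<in>\<sigma>. u i *\<^sub>R v i) \<and> u \<in> weights \<sigma>"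
        by metis
    qed
    show "convex {\<Sum>i\<in>\<sigma>. u i *\<^sub>R v i |u. u \<in> weights \<sigma>}"
      unfolding convex_alt
    proof clarify
      fix t :: real and u u' assume "0 \<le> t" "t \<le> 1" "u \<in> weights \<sigma>" "u' \<in> weights \<sigma>"
      then have "(\<lambda>i. (1 - t) * u i + t * u' i) \<in> weights \<sigma>"
        by (intro weights_combine) auto
      then show "\<exists>w. (1 - t) *\<^sub>R (\<Sum>i\<in>\<sigma>. u i *\<^sub>R v i) + t *\<^sub>R (\<Sum>i\<in>\<sigma>. u' i *\<^sub>R v i) =
          (\<Sum>i\<in>\<sigma>. w i *\<^sub>R v i) \<and> w \<in> weights \<sigma>"
        by (intro exI conjI) (auto simp: scaleR_sum_right scaleR_add_left sum.distrib)
    qed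
  qed
  ultimately show ?thesis by blast
qed

text \<open>Two labels of the same point would give two different point masses with the same
  barycenter.\<close>

lemma independent_labels_inj:
  assumes "independent_labels \<sigma> v" "finite \<sigma>"
  shows "inj_on v \<sigma>"
proof (rule inj_onI)
  fix i j assume ij: "i \<in> \<sigma>" "j \<in> \<sigma>" "v i = v j"
  define e :: "'a \<Rightarrow> 'a \<Rightarrow> real" where "e i = (\<lambda>k. if k = i then 1 else 0)" for i
  have "e k \<in> weights \<sigma>" "(\<Sum>l\<in>\<sigma>. e k l *\<^sub>R v l) = v k" if "k \<in> \<sigma>" for k
    using that assms
    by (auto simp: weights_def e_def if_distrib[of "\<lambda>c. c *\<^sub>R _"] cong: if_cong)
  then have "e i = e j"
    using ij assms(1) unfolding independent_labels_def by metis
  then show "i = j"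
    by (metis e_def zero_neq_one)
qed

text \<open>An affine dependence splits into its positive and its negative part. Its coefficients
  add up to 0, so both parts have the same mass \<open>P\<close> > 0, and scaling by 1 /
  \<open>P\<close> turns them into two weight functions with the same barycenter and disjoint
  supports.\<close>

lemma independent_labels_affine:
  fixes v :: "'l \<Rightarrow> 'a::real_vector"
  assumes "independent_labels \<sigma> v" "finite \<sigma>"
  shows "\<not> affine_dependent (v ` \<sigma>)"
proof
  assume "affine_dependent (v ` \<sigma>)"
  then obtain U where U: "sum U (v ` \<sigma>) = 0" "\<exists>x\<in>v ` \<sigma>. U x \<noteq> 0" "(\<Sum>x\<in>v ` \<sigma>. U x *\<^sub>R x) = 0"
    using assms(2) by (auto simp: affine_dependent_explicit_finite)
  have inj: "inj_on v \<sigma>"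
    using independent_labels_inj assms by blast
  define a where "a i = U (v i)" for i
  have a: "sum a \<sigma> = 0" "(\<Sum>i\<in>\<sigma>. a i *\<^sub>R v i) = 0" "\<exists>i\<in>\<sigma>. a i \<noteq> 0"
    using U inj by (auto simp: a_def sum.reindex)
  define P where "P = (\<Sum>i\<in>\<sigma>. max (a i) 0)"
  have N: "(\<Sum>i\<in>\<sigma>. max (- a i) 0) = P"
  proof -
    have "(\<Sum>i\<in>\<sigma>. max (a i) 0) - (\<Sum>i\<in>\<sigma>. max (- a i) 0) = sum a \<sigma>"
      unfolding sum_subtractf[symmetric] by (intro sum.cong) auto
    then show ?thesis using a by (simp add: P_def)
  qed
  have "P > 0"
  proof -
    from a obtain i where i: "i \<in> \<sigma>" "a i \<noteq> 0" by blast
    have "(\<Sum>i\<in>\<sigma>. max (a i) 0) + (\<Sum>i\<in>\<sigma>. max (- a i) 0) > 0"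
      unfolding sum.distrib[symmetric]
      using i assms(2) by (intro sum_pos2[of _ i]) auto
    then show ?thesis using N P_def by linarith
  qed
  define p n where "p i = (if i \<in> \<sigma> then max (a i) 0 / P else 0)"
    and "n i = (if i \<in> \<sigma> then max (- a i) 0 / P else 0)" for i
  have "p \<in> weights \<sigma>" "n \<in> weights \<sigma>"
    using \<open>P > 0\<close> N by (auto simp: weights_def p_def n_def P_def simp flip: sum_divide_distrib)
  moreover have "(\<Sum>i\<in>\<sigma>. p i *\<^sub>R v i) = (\<Sum>i\<in>\<sigma>. n i *\<^sub>R v i)"
  proof -
    have "(\<Sum>i\<in>\<sigma>. p i *\<^sub>R v i) - (\<Sum>i\<in>\<sigma>. n i *\<^sub>R v i) = (\<Sum>i\<in>\<sigma>. (1 / P) *\<^sub>R (a i *\<^sub>R v i))"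
      unfolding sum_subtractf[symmetric]
      by (intro sum.cong) (auto simp: p_def n_def max_def simp flip: scaleR_diff_left)
    also have "\<dots> = 0"
      by (simp only: scaleR_sum_right[symmetric] a scaleR_zero_right)
    finally show ?thesis by simp
  qed
  ultimately have "p = n"
    using assms(1) unfolding independent_labels_def by blast
  obtain i where i: "i \<in> \<sigma>" "a i \<noteq> 0" using a by blast
  have "p i = n i" using \<open>p = n\<close> by simp
  then show False
    using i \<open>P > 0\<close> by (auto simp: p_def n_def max_def split: if_splits)
qed

text \<open>If a point of the smaller hull lies strictly between a and b, mixing the weights of a
  and b gives its weights on \<open>\<sigma>\<close>, and by uniqueness these vanish off
  \<open>\<tau>\<close>. A vanishing sum of nonnegative terms then makes the weights of a and b
  vanish there too.\<close>

lemma independent_labels_face: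
  fixes v :: "'l \<Rightarrow> 'a::real_vector"
  assumes ind: "independent_labels \<sigma> v" and fin: "finite \<sigma>" and sub: "\<tau> \<subseteq> \<sigma>"
  shows "convex hull (v ` \<tau>) face_of convex hull (v ` \<sigma>)"
  unfolding face_of_def
proof (intro conjI ballI impI convex_convex_hull)
  show "convex hull (v ` \<tau>) \<subseteq> convex hull (v ` \<sigma>)"
    using sub by (intro hull_mono image_mono)
  have fin': "finite \<tau>" using sub fin finite_subset by blast
  fix a b x
  assume "a \<in> convex hull (v ` \<sigma>)" "b \<in> convex hull (v ` \<sigma>)" "x \<in> convex hull (v ` \<tau>)"
    and x: "x \<in> open_segment a b"
  then obtain ua ub ux where u: "ua \<in> weights \<sigma>" "ub \<in> weights \<sigma>" "ux \<in> weights \<tau>"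
    and eq: "a = (\<Sum>i\<in>\<sigma>. ua i *\<^sub>R v i)" "b = (\<Sum>i\<in>\<sigma>. ub i *\<^sub>R v i)" "x = (\<Sum>i\<in>\<tau>. ux i *\<^sub>R v i)"
    unfolding convex_hull_weights[OF fin] convex_hull_weights[OF fin'] by blast
  obtain t where t: "0 < t" "t < 1" "x = (1 - t) *\<^sub>R a + t *\<^sub>R b"
    using x by (auto simp: in_segment)
  define w where "w i = (1 - t) * ua i + t * ub i" for i
  have w: "w \<in> weights \<sigma>"
    unfolding w_def using u t by (intro weights_combine) auto
  have "(\<Sum>i\<in>\<sigma>. w i *\<^sub>R v i) = x"
    by (simp add: t eq w_def scaleR_sum_right scaleR_add_left sum.distrib)
  also have "x = (\<Sum>i\<in>\<sigma>. ux i *\<^sub>R v i)"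
    using sum_weights[OF u(3) fin sub, of v] eq by simp
  finally have "w = ux"
    using ind w weights_mono[OF u(3) fin sub] unfolding independent_labels_def by blast
  have zero: "ua i = 0 \<and> ub i = 0" if "i \<notin> \<tau>" for i
  proof -
    have "(1 - t) * ua i + t * ub i = 0"
      using \<open>w = ux\<close> weightsD(2)[OF u(3) that] by (metis w_def)
    moreover have "0 \<le> (1 - t) * ua i" "0 \<le> t * ub i"
      using t weightsD(1) u by (auto intro!: mult_nonneg_nonneg)
    ultimately have "(1 - t) * ua i = 0" "t * ub i = 0" by linarith+
    then show ?thesis using t by auto
  qed
  have *: "ua \<in> weights \<tau>" "ub \<in> weights \<tau>"
    using weights_restrict[of ua \<sigma> \<tau>] weights_restrict[of ub \<sigma> \<tau>] u zero sub
    by (auto simp: Int_absorb2)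
  then have "a = (\<Sum>i\<in>\<tau>. ua i *\<^sub>R v i)" "b = (\<Sum>i\<in>\<tau>. ub i *\<^sub>R v i)"
    using sum_weights[OF *(1) fin sub, of v] sum_weights[OF *(2) fin sub, of v] eq by simp_all
  then show "a \<in> convex hull (v ` \<tau>)" "b \<in> convex hull (v ` \<tau>)"
    unfolding convex_hull_weights[OF fin'] using * by blast+
qed

text \<open>The difference of two weight functions with equal barycenter would be an affine
  dependence; here each point is its own label.\<close>

lemma affine_independent_labels:
  fixes V :: "'a::real_vector set"
  assumes "\<not> affine_dependent V" "finite V"
  shows "independent_labels V (\<lambda>x. x)"
  unfolding independent_labels_def
proof (intro ballI impI)
  fix u u' assume u: "u \<in> weights V" "u' \<in> weights V" "(\<Sum>x\<in>V. u x *\<^sub>R x) = (\<Sum>x\<in>V. u' x *\<^sub>R x)"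
  define U where "U x = u x - u' x" for x
  have "sum U V = 0" "(\<Sum>x\<in>V. U x *\<^sub>R x) = 0"
    using u by (auto simp: U_def sum_subtractf weightsD scaleR_diff_left)
  then have "U x = 0" if "x \<in> V" for x
    using assms that unfolding affine_dependent_explicit_finite[OF assms(2)] by blast
  then show "u = u'"
    using weightsD(2)[OF u(1)] weightsD(2)[OF u(2)] by (intro ext) (metis U_def eq_iff_diff_eq_0)
qed

lemma vertices_simplex:
  fixes V :: "'a::real_vector set"
  assumes "\<not> affine_dependent V" "finite V"
  shows "vertices (convex hull V) = V"
proof
  show "vertices (convex hull V) \<subseteq> V"
    using extreme_point_of_convex_hull by (auto simp: vertices_def)
  show "V \<subseteq> vertices (convex hull V)"
  proof
    fix x assume x: "x \<in> V"
    then have "convex hull {x} face_of convex hull V"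
      using independent_labels_face[OF affine_independent_labels[OF assms] assms(2), of "{x}"] by simp
    then show "x \<in> vertices (convex hull V)"
      by (simp add: vertices_def face_of_singleton)
  qed
qed

text \<open>In the last clause the case \<open>\<sigma> = \<tau>\<close> makes each simplex affinely
  independent, and the mixed case makes two simplices meet only in the hull of their common labels.
  The label type is left open so that pairs can label the vertices of a product.\<close>

definition simplicial ::
    "nat \<Rightarrow> 'a::real_vector set \<Rightarrow> ('l \<Rightarrow> 'a) \<Rightarrow> 'l set set \<Rightarrow> bool" where
  "simplicial d C v \<F> \<longleftrightarrow> finite \<F> \<and>
     (\<forall>\<sigma>\<in>\<F>. finite \<sigma> \<and> card \<sigma> = d + 1 \<and> v ` \<sigma> \<subseteq> vertices C) \<and>
     C = (\<Union>\<sigma>\<in>\<F>. convex hull (v ` \<sigma>)) \<and>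
     (\<forall>\<sigma>\<in>\<F>. \<forall>\<tau>\<in>\<F>. \<forall>u\<in>weights \<sigma>. \<forall>u'\<in>weights \<tau>.
        (\<Sum>i\<in>\<sigma>. u i *\<^sub>R v i) = (\<Sum>i\<in>\<tau>. u' i *\<^sub>R v i) \<longrightarrow> u = u')"

text \<open>A point common to two of the simplices has one weight function, supported on both label
  sets and hence on their intersection. So two hulls meet in the hull of the common labels, a face
  of both, and a proper face misses the relative interior.\<close>

lemma simplicial_triangulation:
  fixes C :: "'a::real_normed_vector set"
  assumes S: "simplicial d C v \<F>"
  shows "triangulation d C ((\<lambda>\<sigma>. convex hull (v ` \<sigma>)) ` \<F>)"
    and "inj_on (\<lambda>\<sigma>. convex hull (v ` \<sigma>)) \<F>"
proof -
  have fin: "finite \<sigma>" and card: "card \<sigma> = d + 1" and vert: "v ` \<sigma> \<subseteq> vertices C"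
    and ind: "independent_labels \<sigma> v" if "\<sigma> \<in> \<F>" for \<sigma>
    using S that unfolding simplicial_def independent_labels_def by blast+
  have uniq: "u = u'" if "\<sigma> \<in> \<F>" "\<tau> \<in> \<F>" "u \<in> weights \<sigma>" "u' \<in> weights \<tau>"
    "(\<Sum>i\<in>\<sigma>. u i *\<^sub>R v i) = (\<Sum>i\<in>\<tau>. u' i *\<^sub>R v i)" for \<sigma> \<tau> u u'
    using S that unfolding simplicial_def by blast
  have aff: "\<not> affine_dependent (v ` \<sigma>)" if "\<sigma> \<in> \<F>" for \<sigma>
    using that by (intro independent_labels_affine ind fin)
  have verts: "vertices (convex hull (v ` \<sigma>)) = v ` \<sigma>" if "\<sigma> \<in> \<F>" for \<sigma>
    using that by (intro vertices_simplex aff finite_imageI fin)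
  have inter: "convex hull (v ` \<sigma>) \<inter> convex hull (v ` \<tau>) = convex hull (v ` (\<sigma> \<inter> \<tau>))"
    if \<sigma>\<tau>: "\<sigma> \<in> \<F>" "\<tau> \<in> \<F>" for \<sigma> \<tau>
  proof
    show "convex hull (v ` (\<sigma> \<inter> \<tau>)) \<subseteq> convex hull (v ` \<sigma>) \<inter> convex hull (v ` \<tau>)"
      by (simp add: hull_mono image_mono)
    show "convex hull (v ` \<sigma>) \<inter> convex hull (v ` \<tau>) \<subseteq> convex hull (v ` (\<sigma> \<inter> \<tau>))"
    proof
      fix x assume "x \<in> convex hull (v ` \<sigma>) \<inter> convex hull (v ` \<tau>)"
      then obtain u u' where u: "u \<in> weights \<sigma>" "u' \<in> weights \<tau>" "x = (\<Sum>i\<in>\<sigma>. u i *\<^sub>R v i)"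
          "x = (\<Sum>i\<in>\<tau>. u' i *\<^sub>R v i)"
        unfolding convex_hull_weights[OF fin[OF \<sigma>\<tau>(1)]] convex_hull_weights[OF fin[OF \<sigma>\<tau>(2)]]
        by blast
      then have "u = u'" using uniq[OF \<sigma>\<tau>] by metis
      then have *: "u \<in> weights (\<sigma> \<inter> \<tau>)"
        using u weightsD(2)[OF u(1)] weights_restrict[OF u(2), of \<sigma>] by auto
      then have "x = (\<Sum>i\<in>\<sigma> \<inter> \<tau>. u i *\<^sub>R v i)"
        using sum_weights[OF *, of \<sigma> v] u fin \<sigma>\<tau> by auto
      then show "x \<in> convex hull (v ` (\<sigma> \<inter> \<tau>))"
        using * fin \<sigma>\<tau> by (subst convex_hull_weights) auto
    qed
  qed
  have face: "convex hull (v ` \<sigma>) \<inter> convex hull (v ` \<tau>) face_of convex hull (v ` \<sigma>)"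
    if "\<sigma> \<in> \<F>" "\<tau> \<in> \<F>" for \<sigma> \<tau>
    unfolding inter[OF that] using that by (intro independent_labels_face ind fin) auto
  have face': "convex hull (v ` \<sigma>) \<inter> convex hull (v ` \<tau>) face_of convex hull (v ` \<tau>)"
    if "\<sigma> \<in> \<F>" "\<tau> \<in> \<F>" for \<sigma> \<tau>
    using face[OF that(2,1)] by (simp add: Int_commute)
  show "triangulation d C ((\<lambda>\<sigma>. convex hull (v ` \<sigma>)) ` \<F>)"
    unfolding triangulation_def
  proof (intro conjI ballI impI; (elim imageE)?)
    fix S \<sigma> assume *: "S = convex hull (v ` \<sigma>)" "\<sigma> \<in> \<F>"
    have "card (v ` \<sigma>) = d + 1"
      using card_image[OF independent_labels_inj[OF ind fin]] card * by simp
    then show "d_simplex d S"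
      unfolding d_simplex_def using aff[OF *(2)] *(1) by blast
    show "vertices S \<subseteq> vertices C"
      using verts vert * by simp
  next
    show "\<Union> ((\<lambda>\<sigma>. convex hull (v ` \<sigma>)) ` \<F>) = C"
      using S unfolding simplicial_def by (elim conjE) (rule sym)
  next
    fix S S' \<sigma> \<tau> assume *: "S = convex hull (v ` \<sigma>)" "\<sigma> \<in> \<F>" "S' = convex hull (v ` \<tau>)" "\<tau> \<in> \<F>"
    show "S \<inter> S' face_of S" "S \<inter> S' face_of S'"
      using face[OF *(2,4)] face'[OF *(2,4)] by (simp_all add: *)
    \<comment> \<open>Different sets cannot both equal their intersection, so the intersection is a
      proper face of at least one of them.\<close>
    assume "S \<noteq> S'"
    then consider "S \<inter> S' \<noteq> S" | "S \<inter> S' \<noteq> S'" by blast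
    then show "rel_interior S \<inter> rel_interior S' = {}"
    proof cases
      case 1
      then have "S \<inter> S' \<inter> rel_interior S = {}"
        using face[OF *(2,4)] by (intro face_of_disjoint_rel_interior) (simp_all add: *)
      then show ?thesis using rel_interior_subset by blast
    next
      case 2
      then have "S \<inter> S' \<inter> rel_interior S' = {}"
        using face'[OF *(2,4)] by (intro face_of_disjoint_rel_interior) (simp_all add: *)
      then show ?thesis using rel_interior_subset by blast
    qed
  qed
  show "inj_on (\<lambda>\<sigma>. convex hull (v ` \<sigma>)) \<F>"
  proof (rule inj_onI)
    fix \<sigma> \<tau> assume *: "\<sigma> \<in> \<F>" "\<tau> \<in> \<F>" and eq: "convex hull (v ` \<sigma>) = convex hull (v ` \<tau>)"
    \<comment> \<open>Both hulls equal the hull of the common labels, and the vertex set can be read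
      off from the hull.\<close>
    have "v ` \<sigma> = v ` (\<sigma> \<inter> \<tau>)"
    proof -
      have "\<not> affine_dependent (v ` (\<sigma> \<inter> \<tau>))"
        using aff[OF *(1)] by (rule affine_independent_subset) auto
      then have "vertices (convex hull (v ` (\<sigma> \<inter> \<tau>))) = v ` (\<sigma> \<inter> \<tau>)"
        using fin[OF *(1)] by (intro vertices_simplex) auto
      then show ?thesis using inter[OF *] verts[OF *(1)] eq by auto
    qed
    then have "\<sigma> \<subseteq> \<tau>"
      using inj_on_image_eq_iff[OF independent_labels_inj[OF ind[OF *(1)] fin[OF *(1)]], of \<sigma> "\<sigma> \<inter> \<tau>"]
      by blast
    then show "\<sigma> = \<tau>"
      using card[OF *(1)] card[OF *(2)] fin[OF *(2)] by (intro card_subset_eq) auto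
  qed
qed

section \<open>Monotone couplings on chains of a grid\<close>

definition grid_chain :: "(nat \<times> nat) set \<Rightarrow> bool" where
  "grid_chain K \<longleftrightarrow> (\<forall>(i, j)\<in>K. \<forall>(i', j')\<in>K. i \<le> i' \<and> j \<le> j' \<or> i' \<le> i \<and> j' \<le> j)"

lemma grid_chainD:
  assumes "grid_chain K" "(i, j) \<in> K" "(i', j') \<in> K" "i < i'"
  shows "j \<le> j'"
  using assms unfolding grid_chain_def by fastforce

text \<open>Cells with the same first coordinate are comparable anyway, so only pairs with different
  first coordinates need checking.\<close>

lemma grid_chainI:
  assumes "\<And>i j i' j'. (i, j) \<in> K \<Longrightarrow> (i', j') \<in> K \<Longrightarrow> i < i' \<Longrightarrow> j \<le> j'"
  shows "grid_chain K"
  unfolding grid_chain_def using assms by (force simp: not_le dest: leI)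

text \<open>\<open>max g (min h g')\<close> is h clamped to the interval from g to g'. The overlap
  of two intervals is the growth of this clamp from h to h', which makes sums over consecutive
  intervals telescope.\<close>

lemma overlap_telescope:
  fixes g g' h h' :: real
  assumes "g \<le> g'" "h \<le> h'"
  shows "max 0 (min g' h' - max g h) = max g (min h' g') - max g (min h g')"
  using assms by (auto simp: max_def min_def)

lemma nat_set_bounded:
  fixes A :: "nat set"
  assumes "finite A"
  obtains N where "A \<subseteq> {..<N}"
  using finite_nat_set_iff_bounded[of A] assms by auto

text \<open>The monotone coupling: the atoms of \<open>\<mu>\<close> and of \<open>\<nu>\<close> are laid out as consecutive
  subintervals of the unit interval, and \<open>u (i, j)\<close> is the length of the overlap of the i-th
  interval for \<open>\<mu>\<close> with the j-th interval for \<open>\<nu>\<close>.\<close>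

lemma monotone_coupling_exists:
  assumes \<mu>: "\<mu> \<in> weights \<sigma>" and \<nu>: "\<nu> \<in> weights \<tau>"
  obtains u K where "grid_chain K" "K \<subseteq> \<sigma> \<times> \<tau>" "u \<in> weights K"
    "\<And>i. (\<Sum>j\<in>\<tau>. u (i, j)) = \<mu> i" "\<And>j. (\<Sum>i\<in>\<sigma>. u (i, j)) = \<nu> j"
proof -
  have fin: "finite \<sigma>" "finite \<tau>" using \<mu> \<nu> weights_finite by blast+
  then obtain N where N: "\<sigma> \<union> \<tau> \<subseteq> {..<N}" using nat_set_bounded[of "\<sigma> \<union> \<tau>"] by blast
  define G where "G i = (\<Sum>k<i. \<mu> k)" for i
  define H where "H j = (\<Sum>k<j. \<nu> k)" for j
  have GS: "G (Suc i) = G i + \<mu> i" and HS: "H (Suc i) = H i + \<nu> i" for i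
    by (simp_all add: G_def H_def)
  have G1: "(\<Sum>k<n. \<mu> k) = 1" and H1: "(\<Sum>k<n. \<nu> k) = 1" if "N \<le> n" for n
  proof -
    have "\<sigma> \<subseteq> {..<n}" "\<tau> \<subseteq> {..<n}" using N that by auto
    then show "(\<Sum>k<n. \<mu> k) = 1" "(\<Sum>k<n. \<nu> k) = 1"
      using weightsD(3)[OF weights_mono[OF \<mu>]] weightsD(3)[OF weights_mono[OF \<nu>]] by simp_all
  qed
  have monoG: "G i \<le> G j" and monoH: "H i \<le> H j" if "i \<le> j" for i j
    unfolding G_def H_def using that weightsD(1)[OF \<mu>] weightsD(1)[OF \<nu>] by (auto intro!: sum_mono2)
  have bound: "0 \<le> G i" "G i \<le> 1" "0 \<le> H i" "H i \<le> 1" for i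
  proof -
    show "0 \<le> G i" "0 \<le> H i" using monoG[of 0 i] monoH[of 0 i] by (simp_all add: G_def H_def)
    show "G i \<le> 1" using monoG[of i "max i N"] G1[of "max i N"] by (simp add: G_def)
    show "H i \<le> 1" using monoH[of i "max i N"] H1[of "max i N"] by (simp add: H_def)
  qed
  define u where "u = (\<lambda>(i, j). max 0 (min (G (Suc i)) (H (Suc j)) - max (G i) (H j)))"
  have u0: "0 \<le> u p" for p by (cases p) (simp add: u_def)
  have row: "(\<Sum>j<N. u (i, j)) = \<mu> i" for i
  proof -
    have "(\<Sum>j<N. u (i, j)) =
        (\<Sum>j<N. max (G i) (min (H (Suc j)) (G (Suc i))) - max (G i) (min (H j) (G (Suc i))))"
    proof (intro sum.cong refl)
      fix j
      show "u (i, j) = max (G i) (min (H (Suc j)) (G (Suc i))) - max (G i) (min (H j) (G (Suc i)))"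
        using overlap_telescope[OF monoG[of i "Suc i"] monoH[of j "Suc j"]] by (simp add: u_def)
    qed
    also have "\<dots> = max (G i) (min (H N) (G (Suc i))) - max (G i) (min (H 0) (G (Suc i)))"
      by (rule sum_lessThan_telescope)
    \<comment> \<open>\<open>H\<close> runs from 0 to 1 and the values of \<open>G\<close> lie
      between, so the clamp runs through the whole i-th interval, whose length is
      \<open>\<mu> i\<close>.\<close>
    also have "\<dots> = \<mu> i"
      using H1[of N] bound[of i] bound[of "Suc i"] GS[of i] weightsD(1)[OF \<mu>, of i]
      by (simp add: H_def max_def min_def)
    finally show ?thesis .
  qed
  have col: "(\<Sum>i<N. u (i, j)) = \<nu> j" for j
  proof -
    have "(\<Sum>i<N. u (i, j)) =
        (\<Sum>i<N. max (H j) (min (G (Suc i)) (H (Suc j))) - max (H j) (min (G i) (H (Suc j))))"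
    proof (intro sum.cong refl)
      fix i
      show "u (i, j) = max (H j) (min (G (Suc i)) (H (Suc j))) - max (H j) (min (G i) (H (Suc j)))"
        using overlap_telescope[OF monoH[of j "Suc j"] monoG[of i "Suc i"]]
        by (simp add: u_def min.commute max.commute)
    qed
    also have "\<dots> = max (H j) (min (G N) (H (Suc j))) - max (H j) (min (G 0) (H (Suc j)))"
      by (rule sum_lessThan_telescope)
    also have "\<dots> = \<nu> j"
      using G1[of N] bound[of j] bound[of "Suc j"] HS[of j] weightsD(1)[OF \<nu>, of j]
      by (simp add: G_def max_def min_def)
    finally show ?thesis .
  qed
  define K where "K = {p. u p \<noteq> 0}"
  have le: "u (i, j) \<le> \<mu> i" "u (i, j) \<le> \<nu> j" for i j
    using GS[of i] HS[of j] weightsD(1)[OF \<mu>, of i] weightsD(1)[OF \<nu>, of j]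
    by (auto simp: u_def max_def min_def)
  have K: "K \<subseteq> \<sigma> \<times> \<tau>"
  proof clarify
    fix i j assume "(i, j) \<in> K"
    then have "u (i, j) > 0" using u0[of "(i, j)"] by (simp add: K_def)
    then have "\<mu> i \<noteq> 0" "\<nu> j \<noteq> 0" using le[of i j] by auto
    then show "i \<in> \<sigma> \<and> j \<in> \<tau>" using weightsD(2)[OF \<mu>] weightsD(2)[OF \<nu>] by blast
  qed
  have "grid_chain K"
  proof (rule grid_chainI, rule ccontr)
    fix i j i' j' assume *: "(i, j) \<in> K" "(i', j') \<in> K" "i < i'" "\<not> j \<le> j'"
    \<comment> \<open>Both cells have positive overlap. With i < i' and j' < j this would close the
      cycle \<open>H j\<close> < \<open>G (Suc i)\<close> \<le> \<open>G i'\<close> <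
      \<open>H (Suc j')\<close> \<le> \<open>H j\<close>.\<close>
    then have "H j < G (Suc i)" "G i' < H (Suc j')"
      by (auto simp: K_def u_def max_def split: if_splits)
    then show False using monoG[of "Suc i" i'] monoH[of "Suc j'" j] * by simp
  qed
  have uz: "u (i, j) = 0" if "i \<notin> \<sigma> \<or> j \<notin> \<tau>" for i j
    using K that by (auto simp: K_def)
  have row': "(\<Sum>j\<in>\<tau>. u (i, j)) = \<mu> i" for i
    unfolding row[symmetric] using N uz by (intro sum.mono_neutral_left) auto
  have col': "(\<Sum>i\<in>\<sigma>. u (i, j)) = \<nu> j" for j
    unfolding col[symmetric] using N uz by (intro sum.mono_neutral_left) auto
  have "sum u K = sum u (\<sigma> \<times> \<tau>)"
    using K fin by (intro sum.mono_neutral_left) (auto simp: K_def)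
  also have "\<dots> = (\<Sum>i\<in>\<sigma>. \<Sum>j\<in>\<tau>. u (i, j))"
    by (simp add: sum.cartesian_product)
  also have "\<dots> = 1" using row' \<mu> by (simp add: weightsD)
  finally have "u \<in> weights K" using u0 by (auto simp: weights_def K_def)
  then show ?thesis using that \<open>grid_chain K\<close> K row' col' by blast
qed

text \<open>A chain cannot contain both a cell with i < a and j \<ge> b and a cell with i \<ge> a
  and j < b. So one of the two strips that extend the rectangle carries no mass outside it. In terms
  of distribution functions this is the Frechet-Hoeffding upper bound: the joint function is the
  minimum of the marginal ones.\<close>

lemma grid_chain_cdf:
  fixes u :: "nat \<times> nat \<Rightarrow> real"
  assumes K: "grid_chain K" and u: "\<And>p. 0 \<le> u p" "\<And>p. p \<notin> K \<Longrightarrow> u p = 0" and ab: "a \<le> N" "b \<le> N"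
  shows "(\<Sum>i<a. \<Sum>j<b. u (i, j)) = min (\<Sum>i<a. \<Sum>j<N. u (i, j)) (\<Sum>i<N. \<Sum>j<b. u (i, j))"
proof -
  have le: "(\<Sum>i<a. \<Sum>j<b. u (i, j)) \<le> (\<Sum>i<a. \<Sum>j<N. u (i, j))"
      "(\<Sum>i<a. \<Sum>j<b. u (i, j)) \<le> (\<Sum>i<N. \<Sum>j<b. u (i, j))"
    using u(1) ab by (auto intro!: sum_mono sum_mono2 sum_nonneg)
  show ?thesis
  proof (cases "\<exists>i<a. \<exists>j\<ge>b. (i, j) \<in> K")
    case True
    then obtain i j where *: "i < a" "b \<le> j" "(i, j) \<in> K" by blast
    have "u (i', j') = 0" if "a \<le> i'" "j' < b" for i' j'
      using grid_chainD[OF K *(3), of i' j'] u(2)[of "(i', j')"] * that by force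
    then have "(\<Sum>i<a. \<Sum>j<b. u (i, j)) = (\<Sum>i<N. \<Sum>j<b. u (i, j))"
      using ab by (intro sum.mono_neutral_left) (auto intro!: sum.neutral)
    then show ?thesis using le by simp
  next
    case False
    then have "(\<Sum>j<b. u (i, j)) = (\<Sum>j<N. u (i, j))" if "i < a" for i
      using u(2) ab that by (intro sum.mono_neutral_left) auto
    then have "(\<Sum>i<a. \<Sum>j<b. u (i, j)) = (\<Sum>i<a. \<Sum>j<N. u (i, j))"
      by (metis (no_types, lifting) lessThan_iff sum.cong)
    then show ?thesis using le by simp
  qed
qed

text \<open>By \<open>grid_chain_cdf\<close> the marginals fix the mass of every rectangle at the
  origin, and differences of rectangles give the single cells. The two couplings may be carried by
  different chains \<open>K\<close> and \<open>K'\<close>.\<close>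

lemma monotone_coupling_unique:
  fixes \<sigma> \<tau> :: "nat set"
  assumes fin: "finite \<sigma>" "finite \<tau>"
    and u: "u \<in> weights K" "grid_chain K" "K \<subseteq> \<sigma> \<times> \<tau>"
    and u': "u' \<in> weights K'" "grid_chain K'" "K' \<subseteq> \<sigma> \<times> \<tau>"
    and row: "\<And>i. (\<Sum>j\<in>\<tau>. u (i, j)) = (\<Sum>j\<in>\<tau>. u' (i, j))"
    and col: "\<And>j. (\<Sum>i\<in>\<sigma>. u (i, j)) = (\<Sum>i\<in>\<sigma>. u' (i, j))"
  shows "u = u'"
proof -
  obtain N where N: "\<sigma> \<union> \<tau> \<subseteq> {..<N}" using nat_set_bounded[of "\<sigma> \<union> \<tau>"] fin by blast
  have zero: "u (i, j) = 0" "u' (i, j) = 0" if "i \<notin> \<sigma> \<or> j \<notin> \<tau>" for i j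
    using weightsD(2)[OF u(1)] weightsD(2)[OF u'(1)] u(3) u'(3) that by blast+
  have rowN: "(\<Sum>j<N. u (i, j)) = (\<Sum>j<N. u' (i, j))" for i
  proof -
    have "(\<Sum>j<N. w (i, j)) = (\<Sum>j\<in>\<tau>. w (i, j))" if "w = u \<or> w = u'" for w
      using N zero that by (intro sum.mono_neutral_right) auto
    then show ?thesis using row by simp
  qed
  have colN: "(\<Sum>i<N. u (i, j)) = (\<Sum>i<N. u' (i, j))" for j
  proof -
    have "(\<Sum>i<N. w (i, j)) = (\<Sum>i\<in>\<sigma>. w (i, j))" if "w = u \<or> w = u'" for w
      using N zero that by (intro sum.mono_neutral_right) auto
    then show ?thesis using col by simp
  qed
  have pos: "\<And>p. 0 \<le> u p" "\<And>p. p \<notin> K \<Longrightarrow> u p = 0" "\<And>p. 0 \<le> u' p" "\<And>p. p \<notin> K' \<Longrightarrow> u' p = 0"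
    using u(1) u'(1) by (auto simp: weightsD)
  have cdf: "(\<Sum>i<a. \<Sum>j<b. u (i, j)) = (\<Sum>i<a. \<Sum>j<b. u' (i, j))" if "a \<le> N" "b \<le> N" for a b
  proof -
    have "(\<Sum>i<N. \<Sum>j<b. u (i, j)) = (\<Sum>i<N. \<Sum>j<b. u' (i, j))"
      using colN by (simp add: sum.swap[of _ "{..<b}"])
    moreover have "(\<Sum>i<a. \<Sum>j<b. w (i, j)) = min (\<Sum>i<a. \<Sum>j<N. w (i, j)) (\<Sum>i<N. \<Sum>j<b. w (i, j))"
      if "w = u \<or> w = u'" for w
      using that pos grid_chain_cdf[OF u(2) _ _ \<open>a \<le> N\<close> \<open>b \<le> N\<close>, of u]
        grid_chain_cdf[OF u'(2) _ _ \<open>a \<le> N\<close> \<open>b \<le> N\<close>, of u'] by blast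
    ultimately show ?thesis using rowN by simp
  qed
  \<comment> \<open>The mass of one cell by inclusion and exclusion over four rectangles.\<close>
  have point: "w (a, b) = (\<Sum>i<Suc a. \<Sum>j<Suc b. w (i, j)) - (\<Sum>i<a. \<Sum>j<Suc b. w (i, j))
      - ((\<Sum>i<Suc a. \<Sum>j<b. w (i, j)) - (\<Sum>i<a. \<Sum>j<b. w (i, j)))" for w :: "nat \<times> nat \<Rightarrow> real" and a b
    by simp
  show ?thesis
  proof
    fix p :: "nat \<times> nat"
    obtain a b where p: "p = (a, b)" by fastforce
    show "u p = u' p"
    proof (cases "a < N \<and> b < N")
      case True
      then have "Suc a \<le> N" "Suc b \<le> N" "a \<le> N" "b \<le> N" by auto
      then show ?thesis unfolding p by (subst (1 2) point) (simp only: cdf)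
    next
      case False
      then have "a \<notin> \<sigma> \<or> b \<notin> \<tau>" using N by auto
      then show ?thesis using zero p by simp
    qed
  qed
qed

text \<open>\<open>f\<close> counts the steps to the right, so cell number k has coordinate sum k.
  The sum tells the cells apart, and \<open>f k \<le> k\<close> keeps the subtraction of natural
  numbers exact.\<close>

lemma staircase:
  fixes f :: "nat \<Rightarrow> nat"
  assumes mono: "\<And>k. f k \<le> f (Suc k)" and lip: "\<And>k. f (Suc k) \<le> Suc (f k)" and 0: "f 0 = 0"
  shows "grid_chain ((\<lambda>k. (f k, k - f k)) ` A)" "inj_on (\<lambda>k. (f k, k - f k)) A" "f k \<le> k"
proof -
  have le: "f k \<le> k" for k
  proof (induction k)
    case (Suc k)
    then show ?case using lip[of k] by linarith
  qed (simp add: 0)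
  have m: "f k \<le> f l" "k - f k \<le> l - f l" if "k \<le> l" for k l
  proof -
    have "k - f k \<le> Suc k - f (Suc k)" for k using lip[of k] le[of k] by linarith
    then show "k - f k \<le> l - f l" using lift_Suc_mono_le[of "\<lambda>k. k - f k" k l] that by blast
    show "f k \<le> f l" using lift_Suc_mono_le[of f k l] mono that by blast
  qed
  show "grid_chain ((\<lambda>k. (f k, k - f k)) ` A)"
  proof (rule grid_chainI)
    fix i j i' j' assume "(i, j) \<in> (\<lambda>k. (f k, k - f k)) ` A" "(i', j') \<in> (\<lambda>k. (f k, k - f k)) ` A" "i < i'"
    then obtain k l where "i = f k" "j = k - f k" "i' = f l" "j' = l - f l" by blast
    then show "j \<le> j'" using m[of k l] m[of l k] \<open>i < i'\<close> by linarith
  qed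
  show "inj_on (\<lambda>k. (f k, k - f k)) A"
  proof (rule inj_onI, simp)
    fix k l assume "f k = f l \<and> k - f k = l - f l"
    then show "k = l" using le[of k] le[of l] by linarith
  qed
  show "f k \<le> k" by (rule le)
qed

text \<open>The path through a chain that is as far right as possible: a monotone path through
  \<open>(a, b)\<close> has first coordinate at most \<open>max a (k - b)\<close> after \<open>k\<close> steps.\<close>

lemma grid_chain_extend:
  assumes K: "grid_chain K" "K \<subseteq> {..d} \<times> {..e}"
  obtains L where "K \<subseteq> L" "grid_chain L" "L \<subseteq> {..d} \<times> {..e}" "card L = d + e + 1"
proof -
  \<comment> \<open>Adding the two corners keeps a chain and makes the path run from (0, 0) to (d,
    e).\<close>
  define M where "M = K \<union> {(0, 0), (d, e)}"
  have M: "M \<subseteq> {..d} \<times> {..e}" using K by (auto simp: M_def)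
  then have finM: "finite M" by (rule finite_subset) auto
  have chainM: "grid_chain M"
  proof (rule grid_chainI)
    fix i j i' j' assume *: "(i, j) \<in> M" "(i', j') \<in> M" "i < i'"
    then have "i \<le> d" "j \<le> e" "i' \<le> d" "j' \<le> e" using M by auto
    with * show "j \<le> j'" using grid_chainD[OF K(1), of i j i' j'] by (auto simp: M_def)
  qed
  define f where "f k = Min ((\<lambda>p. max (fst p) (k - snd p)) ` M)" for k
  have fle: "f k \<le> max a (k - b)" if "(a, b) \<in> M" for a b k
    unfolding f_def using finM that by (intro Min_le) (auto intro: rev_image_eqI)
  have fex: "\<exists>a b. (a, b) \<in> M \<and> f k = max a (k - b)" for k
  proof -
    have "f k \<in> (\<lambda>p. max (fst p) (k - snd p)) ` M"
      unfolding f_def using finM by (intro Min_in) (auto simp: M_def)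
    then obtain p where "p \<in> M" "f k = max (fst p) (k - snd p)" by blast
    then show ?thesis by (intro exI[of _ "fst p"] exI[of _ "snd p"]) simp
  qed
  have mono: "f k \<le> f (Suc k)" for k
  proof -
    obtain a b where ab: "(a, b) \<in> M" "f (Suc k) = max a (Suc k - b)" using fex[of "Suc k"] by blast
    have "f k \<le> max a (k - b)" by (rule fle[OF ab(1)])
    also have "\<dots> \<le> max a (Suc k - b)" by (intro max.mono) auto
    finally show ?thesis using ab by simp
  qed
  have lip: "f (Suc k) \<le> Suc (f k)" for k
  proof -
    obtain a b where ab: "(a, b) \<in> M" "f k = max a (k - b)" using fex[of k] by blast
    have "f (Suc k) \<le> max a (Suc k - b)" by (rule fle[OF ab(1)])
    also have "\<dots> \<le> Suc (max a (k - b))" by auto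
    finally show ?thesis using ab by simp
  qed
  have "f 0 = 0" using fle[of 0 0 0] unfolding M_def by simp
  note stairs = staircase[of f, OF mono lip this]
  define L where "L = (\<lambda>k. (f k, k - f k)) ` {..d + e}"
  show ?thesis
  proof (rule that)
    show "grid_chain L" unfolding L_def by (rule stairs)
    show "card L = d + e + 1" unfolding L_def by (simp add: card_image stairs)
    show "L \<subseteq> {..d} \<times> {..e}"
    proof (unfold L_def, rule image_subsetI)
      fix k assume k: "k \<in> {..d + e}"
      \<comment> \<open>The minimizing cell gives \<open>f k\<close> \<ge> k - b, hence a second
        coordinate of at most b \<le> e; the corner (d, e) gives a first coordinate of at most
        d.\<close>
      obtain a b where ab: "(a, b) \<in> M" "f k = max a (k - b)" using fex[of k] by blast
      have "b \<le> e" using M ab by auto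
      moreover have "f k \<le> max d (k - e)" using fle[of d e k] by (simp add: M_def)
      ultimately show "(f k, k - f k) \<in> {..d} \<times> {..e}" using k ab by auto
    qed
    show "K \<subseteq> L"
    proof clarify
      fix a b assume ab: "(a, b) \<in> K"
      then have abM: "(a, b) \<in> M" by (simp add: M_def)
      have "a \<le> d" "b \<le> e" using abM M by auto
      obtain i j where ij: "(i, j) \<in> M" "f (a + b) = max i (a + b - j)" using fex[of "a + b"] by blast
      \<comment> \<open>The path meets (a, b) after a + b steps. The cell itself gives the upper
        bound a. A minimizing cell with i < a has j \<le> b by the chain property, and then a + b -
        j \<ge> a.\<close>
      have "f (a + b) \<le> a" using fle[OF abM, of "a + b"] by simp
      moreover have "a \<le> f (a + b)"
        using grid_chainD[OF chainM ij(1) abM] ij(2) by (cases "i < a") auto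
      ultimately have "(a, b) = (f (a + b), a + b - f (a + b))" by simp
      then show "(a, b) \<in> L" unfolding L_def using \<open>a \<le> d\<close> \<open>b \<le> e\<close> by (intro image_eqI) auto
    qed
  qed
qed

section \<open>Lattice paths coded by the set of their steps to the right\<close>

definition walk :: "nat set \<Rightarrow> nat \<Rightarrow> nat" where
  "walk A k = card (A \<inter> {..<k})"

lemma walk_Suc: "walk A (Suc k) = walk A k + (if k \<in> A then 1 else 0)"
proof -
  have "A \<inter> {..<Suc k} = (if k \<in> A then insert k (A \<inter> {..<k}) else A \<inter> {..<k})"
    by (auto simp: less_Suc_eq)
  then show ?thesis by (auto simp: walk_def)
qed

lemma walk_staircase:
  shows "grid_chain ((\<lambda>k. (walk A k, k - walk A k)) ` S)" "inj_on (\<lambda>k. (walk A k, k - walk A k)) S"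
    "walk A k \<le> k"
proof -
  have "walk A 0 = 0" by (simp add: walk_def)
  then show "grid_chain ((\<lambda>k. (walk A k, k - walk A k)) ` S)" "inj_on (\<lambda>k. (walk A k, k - walk A k)) S"
    "walk A k \<le> k"
    by (intro staircase[of "walk A"]; simp add: walk_Suc)+
qed

definition walk_cells :: "nat \<Rightarrow> nat set \<Rightarrow> (nat \<times> nat) set" where
  "walk_cells n A = (\<lambda>k. (walk A k, k - walk A k)) ` {..n}"

text \<open>With d steps to the right among d + e the path ends at (d, e). Meeting every column and
  every row is what later recovers both factor simplices from the projections of a product
  simplex.\<close>

lemma walk_cells:
  assumes A: "A \<subseteq> {..<d + e}" "card A = d"
  shows "grid_chain (walk_cells (d + e) A)" "card (walk_cells (d + e) A) = d + e + 1"
    "fst ` walk_cells (d + e) A = {..d}" "snd ` walk_cells (d + e) A = {..e}"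
proof -
  show "grid_chain (walk_cells (d + e) A)"
    unfolding walk_cells_def by (rule walk_staircase)
  show "card (walk_cells (d + e) A) = d + e + 1"
    unfolding walk_cells_def by (simp add: card_image walk_staircase)
  have last: "walk A (d + e) = d"
    using A by (simp add: walk_def Int_absorb2)
  \<comment> \<open>A discrete intermediate value theorem: steps of size 0 or 1 skip no
    value.\<close>
  have image: "g ` {..n} = {..g n}" if g: "g 0 = 0" "\<And>k. g k \<le> g (Suc k)" "\<And>k. g (Suc k) \<le> Suc (g k)"
    for g :: "nat \<Rightarrow> nat" and n
  proof (induction n)
    case (Suc n)
    have "g (Suc n) = g n \<or> g (Suc n) = Suc (g n)" using g(2,3)[of n] by linarith
    then show ?case using Suc by (auto simp: atMost_Suc)
  qed (simp add: g)
  have "fst ` walk_cells (d + e) A = walk A ` {..d + e}"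
    by (simp add: walk_cells_def image_image)
  also have "\<dots> = {..walk A (d + e)}"
    by (rule image) (simp_all add: walk_Suc, simp add: walk_def)
  also have "\<dots> = {..d}" by (simp add: last)
  finally show "fst ` walk_cells (d + e) A = {..d}" .
  have "snd ` walk_cells (d + e) A = (\<lambda>k. k - walk A k) ` {..d + e}"
    by (simp add: walk_cells_def image_image)
  also have "\<dots> = {..d + e - walk A (d + e)}"
    using walk_staircase(3)[of A] by (intro image) (simp_all add: walk_Suc Suc_diff_le)
  also have "\<dots> = {..e}" by (simp add: last)
  finally show "snd ` walk_cells (d + e) A = {..e}" .
qed

text \<open>A cell reveals its step number as the sum of its coordinates, so the set of cells gives
  back \<open>walk A\<close>, whose increments show which steps belong to \<open>A\<close>.\<close>

lemma walk_cells_inj: "inj_on (walk_cells n) (Pow {..<n})"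
proof (rule inj_onI)
  fix A B assume AB: "A \<in> Pow {..<n}" "B \<in> Pow {..<n}" and eq: "walk_cells n A = walk_cells n B"
  have "walk A k = walk B k" if "k \<le> n" for k
  proof -
    have "(walk A k, k - walk A k) \<in> walk_cells n B"
      unfolding eq[symmetric] using that by (auto simp: walk_cells_def)
    then obtain l where "walk A k = walk B l" "k - walk A k = l - walk B l"
      by (auto simp: walk_cells_def)
    moreover from this have "k = l"
      using walk_staircase(3)[of A k] walk_staircase(3)[of B l] by linarith
    ultimately show ?thesis by simp
  qed
  then have "k \<in> A \<longleftrightarrow> k \<in> B" if "k < n" for k
    using walk_Suc[of A k] walk_Suc[of B k] that by (auto split: if_splits)
  then show "A = B" using AB by blast
qed

section \<open>Products of triangulations\<close>

lemma grid_chain_map: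
  assumes K: "grid_chain K" "K \<subseteq> S \<times> T" and p: "strict_mono_on S p" "strict_mono_on T q"
  shows "grid_chain (map_prod p q ` K)"
proof (rule grid_chainI)
  fix i j i' j' assume "(i, j) \<in> map_prod p q ` K" "(i', j') \<in> map_prod p q ` K" "i < i'"
  then obtain a b a' b' where *: "(a, b) \<in> K" "(a', b') \<in> K" "i = p a" "j = q b" "i' = p a'" "j' = q b'"
    by auto
  then have in_ST: "a \<in> S" "a' \<in> S" "b \<in> T" "b' \<in> T" using K by auto
  have "a < a'"
    using strict_mono_on_less[OF p(1)] in_ST * \<open>i < i'\<close> by simp
  then have "b \<le> b'" using grid_chainD[OF K(1)] * by blast
  then show "j \<le> j'"
    using strict_mono_on_leD[OF p(2)] in_ST * by simp
qed

lemma grid_chain_vimage: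
  assumes K: "grid_chain K" and p: "strict_mono_on S p" "strict_mono_on T q"
  shows "grid_chain {(i, j) \<in> S \<times> T. (p i, q j) \<in> K}"
proof (rule grid_chainI, clarsimp)
  fix i j i' j'
  assume *: "i \<in> S" "j \<in> T" "i' \<in> S" "j' \<in> T" "(p i, q j) \<in> K" "(p i', q j') \<in> K" "i < i'"
  then have "p i < p i'" using strict_mono_onD[OF p(1)] by blast
  then have "q j \<le> q j'" using grid_chainD[OF K] * by blast
  then show "j \<le> j'" using strict_mono_onD[OF p(2), of j' j] * by (meson not_le)
qed

lemma enumerate_simplex:
  fixes \<sigma> :: "nat set"
  assumes "finite \<sigma>" "card \<sigma> = d + 1"
  shows "enumerate \<sigma> ` {..d} = \<sigma>" "strict_mono_on {..d} (enumerate \<sigma>)" "inj_on (enumerate \<sigma>) {..d}"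
proof -
  have "{..<card \<sigma>} = {..d}" using assms by auto
  then have "bij_betw (enumerate \<sigma>) {..d} \<sigma>"
    using finite_bij_enumerate[OF assms(1)] by simp
  then show "enumerate \<sigma> ` {..d} = \<sigma>" "inj_on (enumerate \<sigma>) {..d}"
    by (auto simp: bij_betw_def)
  show "strict_mono_on {..d} (enumerate \<sigma>)"
    using assms by (auto simp: strict_mono_on_def intro!: finite_enumerate_mono)
qed

text \<open>The increasing enumerations of \<open>\<sigma>\<close> and \<open>\<tau>\<close>
  identify their product with the standard grid; the chain is pulled back, completed there and
  pushed forward.\<close>

lemma grid_chain_extend_simplices:
  fixes \<sigma> \<tau> :: "nat set"
  assumes \<sigma>: "finite \<sigma>" "card \<sigma> = d + 1" and \<tau>: "finite \<tau>" "card \<tau> = e + 1"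
    and K: "grid_chain K" "K \<subseteq> \<sigma> \<times> \<tau>"
  obtains L where "K \<subseteq> L" "grid_chain L" "L \<subseteq> \<sigma> \<times> \<tau>" "card L = d + e + 1"
proof -
  let ?p = "enumerate \<sigma>" and ?q = "enumerate \<tau>"
  note p = enumerate_simplex[OF \<sigma>] and q = enumerate_simplex[OF \<tau>]
  define K0 where "K0 = {(i, j) \<in> {..d} \<times> {..e}. (?p i, ?q j) \<in> K}"
  have "grid_chain K0" "K0 \<subseteq> {..d} \<times> {..e}"
    using grid_chain_vimage[OF K(1) p(2) q(2)] by (auto simp: K0_def)
  then obtain L0 where L0: "K0 \<subseteq> L0" "grid_chain L0" "L0 \<subseteq> {..d} \<times> {..e}" "card L0 = d + e + 1"
    by (rule grid_chain_extend)
  have inj: "inj_on (map_prod ?p ?q) ({..d} \<times> {..e})"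
    using p(3) q(3) by (intro map_prod_inj_on)
  show ?thesis
  proof (rule that)
    show "grid_chain (map_prod ?p ?q ` L0)"
      by (rule grid_chain_map[OF L0(2,3) p(2) q(2)])
    show "card (map_prod ?p ?q ` L0) = d + e + 1"
      using L0 inj by (simp add: card_image inj_on_subset)
    show "map_prod ?p ?q ` L0 \<subseteq> \<sigma> \<times> \<tau>"
      using L0(3) p(1) q(1) by auto
    show "K \<subseteq> map_prod ?p ?q ` L0"
    proof clarify
      fix a b assume ab: "(a, b) \<in> K"
      then have "a \<in> ?p ` {..d}" "b \<in> ?q ` {..e}" using K(2) p(1) q(1) by auto
      then obtain i j where ij: "i \<le> d" "j \<le> e" "a = ?p i" "b = ?q j" by auto
      then have "(i, j) \<in> L0" using ab L0(1) by (auto simp: K0_def)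
      then show "(a, b) \<in> map_prod ?p ?q ` L0" using ij by (auto intro: rev_image_eqI)
    qed
  qed
qed

text \<open>The pair (i, j) labels the vertex (\<open>v i\<close>, \<open>w j\<close>) of the
  product. A chain in a grid of d + 1 by e + 1 cells has at most d + e + 1 members, so these are the
  maximal chains. Comparing labels as natural numbers gives all products one common order, which
  matches the subdivisions along shared faces.\<close>

definition staircases :: "nat \<Rightarrow> nat \<Rightarrow> nat set set \<Rightarrow> nat set set \<Rightarrow> (nat \<times> nat) set set" where
  "staircases d e \<F> \<G> = {K. grid_chain K \<and> card K = d + e + 1 \<and> (\<exists>\<sigma>\<in>\<F>. \<exists>\<tau>\<in>\<G>. K \<subseteq> \<sigma> \<times> \<tau>)}"

lemma finite_staircases:
  assumes "finite \<F>" "finite \<G>" "\<And>\<sigma>. \<sigma> \<in> \<F> \<Longrightarrow> finite \<sigma>" "\<And>\<tau>. \<tau> \<in> \<G> \<Longrightarrow> finite \<tau>"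
  shows "finite (staircases d e \<F> \<G>)"
proof (rule finite_subset)
  show "staircases d e \<F> \<G> \<subseteq> Pow (\<Union>\<F> \<times> \<Union>\<G>)" by (fastforce simp: staircases_def)
qed (use assms in auto)

text \<open>A lattice path and a pair of simplices can be read back from their staircase: its
  projections are the two simplices, and pulling it back to the standard grid gives the path.
  Injectivity suffices because only a lower bound is wanted.\<close>

lemma card_staircases:
  assumes F: "finite \<F>" "\<And>\<sigma>. \<sigma> \<in> \<F> \<Longrightarrow> finite \<sigma> \<and> card \<sigma> = d + 1"
    and G: "finite \<G>" "\<And>\<tau>. \<tau> \<in> \<G> \<Longrightarrow> finite \<tau> \<and> card \<tau> = e + 1"
  shows "((d + e) choose d) * card \<F> * card \<G> \<le> card (staircases d e \<F> \<G>)"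
proof -
  define \<A> where "\<A> = {A. A \<subseteq> {..<d + e} \<and> card A = d}"
  define \<Phi> where "\<Phi> = (\<lambda>(A, \<sigma> :: nat set, \<tau> :: nat set). map_prod (enumerate \<sigma>) (enumerate \<tau>) ` walk_cells (d + e) A)"
  have cells: "walk_cells (d + e) A \<subseteq> {..d} \<times> {..e}" if "A \<in> \<A>" for A
    using subset_fst_snd[of "walk_cells (d + e) A"] walk_cells(3,4)[of A d e] that by (simp add: \<A>_def)
  have inj: "inj_on (map_prod (enumerate \<sigma>) (enumerate \<tau>)) ({..d} \<times> {..e})" if "\<sigma> \<in> \<F>" "\<tau> \<in> \<G>" for \<sigma> \<tau>
    using F(2)[OF that(1)] G(2)[OF that(2)] by (intro map_prod_inj_on enumerate_simplex) auto
  have proj: "fst ` \<Phi> (A, \<sigma>, \<tau>) = \<sigma>" "snd ` \<Phi> (A, \<sigma>, \<tau>) = \<tau>" if "A \<in> \<A>" "\<sigma> \<in> \<F>" "\<tau> \<in> \<G>" for A \<sigma> \<tau>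
  proof -
    have "fst ` \<Phi> (A, \<sigma>, \<tau>) = enumerate \<sigma> ` fst ` walk_cells (d + e) A"
        "snd ` \<Phi> (A, \<sigma>, \<tau>) = enumerate \<tau> ` snd ` walk_cells (d + e) A"
      by (simp_all add: \<Phi>_def image_image)
    then show "fst ` \<Phi> (A, \<sigma>, \<tau>) = \<sigma>" "snd ` \<Phi> (A, \<sigma>, \<tau>) = \<tau>"
      using that walk_cells(3,4)[of A d e] enumerate_simplex(1)[of \<sigma> d] enumerate_simplex(1)[of \<tau> e] F(2) G(2)
      by (simp_all add: \<A>_def)
  qed
  have "card (\<A> \<times> \<F> \<times> \<G>) \<le> card (staircases d e \<F> \<G>)"
  proof (rule card_inj_on_le)
    show "finite (staircases d e \<F> \<G>)"
      using F G by (intro finite_staircases) auto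
    show "inj_on \<Phi> (\<A> \<times> \<F> \<times> \<G>)"
    proof (rule inj_onI)
      fix x y assume xy: "x \<in> \<A> \<times> \<F> \<times> \<G>" "y \<in> \<A> \<times> \<F> \<times> \<G>" "\<Phi> x = \<Phi> y"
      obtain A \<sigma> \<tau> A' \<sigma>' \<tau>' where x: "x = (A, \<sigma>, \<tau>)" and y: "y = (A', \<sigma>', \<tau>')"
        by (cases x, cases y) auto
      have *: "A \<in> \<A>" "\<sigma> \<in> \<F>" "\<tau> \<in> \<G>" "A' \<in> \<A>" "\<sigma>' \<in> \<F>" "\<tau>' \<in> \<G>"
        and eq: "\<Phi> (A, \<sigma>, \<tau>) = \<Phi> (A', \<sigma>', \<tau>')"
        using xy x y by auto
      have st: "\<sigma> = \<sigma>'" "\<tau> = \<tau>'"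
        using proj[OF *(1-3)] proj[OF *(4-6)] eq by simp_all
      have "walk_cells (d + e) A = walk_cells (d + e) A'"
        using inj_on_image_eq_iff[OF inj[OF *(2,3)] cells[OF *(1)] cells[OF *(4)]] eq st
        by (simp add: \<Phi>_def)
      then have "A = A'"
        using inj_onD[OF walk_cells_inj] * by (auto simp: \<A>_def)
      with st show "x = y" by (simp add: x y)
    qed
    show "\<Phi> ` (\<A> \<times> \<F> \<times> \<G>) \<subseteq> staircases d e \<F> \<G>"
    proof clarify
      fix A \<sigma> \<tau> assume *: "A \<in> \<A>" "\<sigma> \<in> \<F>" "\<tau> \<in> \<G>"
      have w: "grid_chain (walk_cells (d + e) A)" "card (walk_cells (d + e) A) = d + e + 1"
        using walk_cells(1,2)[of A d e] * by (simp_all add: \<A>_def)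
      have "grid_chain (\<Phi> (A, \<sigma>, \<tau>))"
        unfolding \<Phi>_def using w cells[OF *(1)] enumerate_simplex(2) F(2) G(2) *
        by (auto intro!: grid_chain_map)
      moreover have "card (\<Phi> (A, \<sigma>, \<tau>)) = d + e + 1"
        unfolding \<Phi>_def using w(2) inj_on_subset[OF inj[OF *(2,3)] cells[OF *(1)]]
        by (simp add: card_image)
      moreover have "\<Phi> (A, \<sigma>, \<tau>) \<subseteq> \<sigma> \<times> \<tau>"
        using subset_fst_snd[of "\<Phi> (A, \<sigma>, \<tau>)"] proj[OF *] by simp
      ultimately show "\<Phi> (A, \<sigma>, \<tau>) \<in> staircases d e \<F> \<G>"
        using * unfolding staircases_def by blast
    qed
  qed
  moreover have "card \<A> = (d + e) choose d"
    unfolding \<A>_def using n_subsets[of "{..<d + e}" d] by simp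
  ultimately show ?thesis by (simp add: card_cartesian_product mult.assoc)
qed

text \<open>Only the two marginals of the weights enter the barycenter; this is what turns
  statements about points of a product into statements about couplings.\<close>

lemma sum_weights_product:
  fixes v :: "'l \<Rightarrow> 'a::real_vector" and w :: "'m \<Rightarrow> 'b::real_vector"
  assumes u: "u \<in> weights K" and K: "K \<subseteq> \<sigma> \<times> \<tau>" and fin: "finite \<sigma>" "finite \<tau>"
  shows "(\<Sum>p\<in>K. u p *\<^sub>R map_prod v w p) =
    (\<Sum>i\<in>\<sigma>. (\<Sum>j\<in>\<tau>. u (i, j)) *\<^sub>R v i, \<Sum>j\<in>\<tau>. (\<Sum>i\<in>\<sigma>. u (i, j)) *\<^sub>R w j)"
proof -
  have "(\<Sum>p\<in>K. u p *\<^sub>R map_prod v w p) = (\<Sum>p\<in>\<sigma> \<times> \<tau>. u p *\<^sub>R map_prod v w p)"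
    using sum_weights[OF u _ K, of "map_prod v w"] fin by simp
  also have "\<dots> = (\<Sum>i\<in>\<sigma>. \<Sum>j\<in>\<tau>. (u (i, j) *\<^sub>R v i, u (i, j) *\<^sub>R w j))"
    by (simp add: sum.cartesian_product case_prod_unfold map_prod_def)
  also have "\<dots> = (\<Sum>i\<in>\<sigma>. (\<Sum>j\<in>\<tau>. u (i, j)) *\<^sub>R v i, \<Sum>j\<in>\<tau>. (\<Sum>i\<in>\<sigma>. u (i, j)) *\<^sub>R w j)"
  proof (rule prod_eqI)
    show "fst (\<Sum>i\<in>\<sigma>. \<Sum>j\<in>\<tau>. (u (i, j) *\<^sub>R v i, u (i, j) *\<^sub>R w j)) =
        fst (\<Sum>i\<in>\<sigma>. (\<Sum>j\<in>\<tau>. u (i, j)) *\<^sub>R v i, \<Sum>j\<in>\<tau>. (\<Sum>i\<in>\<sigma>. u (i, j)) *\<^sub>R w j)"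
      by (simp add: fst_sum scaleR_sum_left)
    show "snd (\<Sum>i\<in>\<sigma>. \<Sum>j\<in>\<tau>. (u (i, j) *\<^sub>R v i, u (i, j) *\<^sub>R w j)) =
        snd (\<Sum>i\<in>\<sigma>. (\<Sum>j\<in>\<tau>. u (i, j)) *\<^sub>R v i, \<Sum>j\<in>\<tau>. (\<Sum>i\<in>\<sigma>. u (i, j)) *\<^sub>R w j)"
      by (simp add: snd_sum scaleR_sum_left sum.swap[of _ \<tau>])
  qed
  finally show ?thesis .
qed

lemma weights_marginals:
  assumes u: "u \<in> weights K" and K: "K \<subseteq> \<sigma> \<times> \<tau>" and fin: "finite \<sigma>" "finite \<tau>"
  shows "(\<lambda>i. \<Sum>j\<in>\<tau>. u (i, j)) \<in> weights \<sigma>" "(\<lambda>j. \<Sum>i\<in>\<sigma>. u (i, j)) \<in> weights \<tau>"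
proof -
  have z: "u (i, j) = 0" if "i \<notin> \<sigma> \<or> j \<notin> \<tau>" for i j
    using weightsD(2)[OF u, of "(i, j)"] K that by blast
  have "sum u (\<sigma> \<times> \<tau>) = 1"
    using weightsD(3)[OF weights_mono[OF u _ K]] fin by simp
  then have s: "(\<Sum>i\<in>\<sigma>. \<Sum>j\<in>\<tau>. u (i, j)) = 1"
    by (simp add: sum.cartesian_product)
  then have s': "(\<Sum>j\<in>\<tau>. \<Sum>i\<in>\<sigma>. u (i, j)) = 1"
    by (simp add: sum.swap[of _ \<tau>])
  show "(\<lambda>i. \<Sum>j\<in>\<tau>. u (i, j)) \<in> weights \<sigma>"
    using s z weightsD(1)[OF u] by (intro weightsI) (auto intro!: sum_nonneg sum.neutral)
  show "(\<lambda>j. \<Sum>i\<in>\<sigma>. u (i, j)) \<in> weights \<tau>"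
    using s' z weightsD(1)[OF u] by (intro weightsI) (auto intro!: sum_nonneg sum.neutral)
qed

lemma vertices_Times: "vertices C \<times> vertices D \<subseteq> vertices (C \<times> D)"
proof clarify
  fix a b assume "a \<in> vertices C" "b \<in> vertices D"
  then have "{a} \<times> {b} face_of C \<times> D"
    by (intro face_of_Times) (auto simp: vertices_def face_of_singleton)
  then show "(a, b) \<in> vertices (C \<times> D)" by (simp add: vertices_def face_of_singleton)
qed

lemma simplicialD:
  assumes "simplicial d C v \<F>"
  shows "finite \<F>" "\<And>\<sigma>. \<sigma> \<in> \<F> \<Longrightarrow> finite \<sigma> \<and> card \<sigma> = d + 1 \<and> v ` \<sigma> \<subseteq> vertices C"
    "C = (\<Union>\<sigma>\<in>\<F>. convex hull (v ` \<sigma>))"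
    "\<And>\<sigma> \<tau> u u'. \<lbrakk>\<sigma> \<in> \<F>; \<tau> \<in> \<F>; u \<in> weights \<sigma>; u' \<in> weights \<tau>;
       (\<Sum>i\<in>\<sigma>. u i *\<^sub>R v i) = (\<Sum>i\<in>\<tau>. u' i *\<^sub>R v i)\<rbrakk> \<Longrightarrow> u = u'"
proof -
  note S = assms[unfolded simplicial_def]
  show "finite \<F>" using S by (elim conjE)
  show "C = (\<Union>\<sigma>\<in>\<F>. convex hull (v ` \<sigma>))" using S by (elim conjE)
  show "finite \<sigma> \<and> card \<sigma> = d + 1 \<and> v ` \<sigma> \<subseteq> vertices C" if "\<sigma> \<in> \<F>" for \<sigma>
    using S[THEN conjunct2, THEN conjunct1] that by (rule bspec)
  show "u = u'" if "\<sigma> \<in> \<F>" "\<tau> \<in> \<F>" "u \<in> weights \<sigma>" "u' \<in> weights \<tau>"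
    "(\<Sum>i\<in>\<sigma>. u i *\<^sub>R v i) = (\<Sum>i\<in>\<tau>. u' i *\<^sub>R v i)" for \<sigma> \<tau> u u'
    by (rule S[THEN conjunct2, THEN conjunct2, THEN conjunct2, rule_format, OF that])
qed

text \<open>Covering: the weights of the two coordinates of a point are coupled monotonically, and
  the support of the coupling is completed to a full staircase. Uniqueness: the barycenter fixes
  both marginals by uniqueness in the factors, and a coupling carried by a chain is fixed by its
  marginals.\<close>

lemma simplicial_product:
  fixes C :: "'a::real_vector set" and D :: "'b::real_vector set"
  assumes C: "simplicial d C v \<F>" and D: "simplicial e D w \<G>"
  shows "simplicial (d + e) (C \<times> D) (map_prod v w) (staircases d e \<F> \<G>)"
  unfolding simplicial_def
proof (intro conjI ballI impI)
  note c = simplicialD[OF C] and c' = simplicialD[OF D]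
  show "finite (staircases d e \<F> \<G>)"
    using c c' by (intro finite_staircases) blast+
  show cover: "C \<times> D = (\<Union>K\<in>staircases d e \<F> \<G>. convex hull (map_prod v w ` K))"
  proof
    show "(\<Union>K\<in>staircases d e \<F> \<G>. convex hull (map_prod v w ` K)) \<subseteq> C \<times> D"
    proof (rule UN_least)
      fix K assume "K \<in> staircases d e \<F> \<G>"
      then obtain \<sigma> \<tau> where st: "\<sigma> \<in> \<F>" "\<tau> \<in> \<G>" "K \<subseteq> \<sigma> \<times> \<tau>" by (auto simp: staircases_def)
      have "convex hull (map_prod v w ` K) \<subseteq> convex hull ((v ` \<sigma>) \<times> (w ` \<tau>))"
        using st(3) by (intro hull_mono) auto
      also have "\<dots> = (convex hull (v ` \<sigma>)) \<times> (convex hull (w ` \<tau>))"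
        by (rule convex_hull_Times)
      also have "\<dots> \<subseteq> C \<times> D"
        using st c(3) c'(3) by (intro Sigma_mono) blast+
      finally show "convex hull (map_prod v w ` K) \<subseteq> C \<times> D" .
    qed
    show "C \<times> D \<subseteq> (\<Union>K\<in>staircases d e \<F> \<G>. convex hull (map_prod v w ` K))"
    proof clarify
      fix x y assume "x \<in> C" "y \<in> D"
      then obtain \<sigma> \<tau> where st: "\<sigma> \<in> \<F>" "\<tau> \<in> \<G>" "x \<in> convex hull (v ` \<sigma>)" "y \<in> convex hull (w ` \<tau>)"
        using c(3) c'(3) by blast
      have fin: "finite \<sigma>" "finite \<tau>" and card: "card \<sigma> = d + 1" "card \<tau> = e + 1"
        using c(2)[OF st(1)] c'(2)[OF st(2)] by auto
      obtain \<mu> \<nu> where mn: "\<mu> \<in> weights \<sigma>" "\<nu> \<in> weights \<tau>"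
          "x = (\<Sum>i\<in>\<sigma>. \<mu> i *\<^sub>R v i)" "y = (\<Sum>j\<in>\<tau>. \<nu> j *\<^sub>R w j)"
        using st(3,4) unfolding convex_hull_weights[OF fin(1)] convex_hull_weights[OF fin(2)] by blast
      obtain u K where K: "grid_chain K" "K \<subseteq> \<sigma> \<times> \<tau>" and u: "u \<in> weights K"
          "\<And>i. (\<Sum>j\<in>\<tau>. u (i, j)) = \<mu> i" "\<And>j. (\<Sum>i\<in>\<sigma>. u (i, j)) = \<nu> j"
        using monotone_coupling_exists[OF mn(1,2)] by metis
      obtain L where L: "K \<subseteq> L" "grid_chain L" "L \<subseteq> \<sigma> \<times> \<tau>" "card L = d + e + 1"
        using grid_chain_extend_simplices[OF fin(1) card(1) fin(2) card(2) K] by blast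
      have finL: "finite L" using L(3) fin finite_subset by blast
      have uL: "u \<in> weights L" using weights_mono[OF u(1) finL L(1)] .
      have "(x, y) = (\<Sum>p\<in>L. u p *\<^sub>R map_prod v w p)"
        using sum_weights_product[OF uL L(3) fin, of v w] by (simp add: u mn)
      then have "(x, y) \<in> convex hull (map_prod v w ` L)"
        unfolding convex_hull_weights[OF finL] using uL by blast
      moreover have "L \<in> staircases d e \<F> \<G>"
        using L st by (auto simp: staircases_def)
      ultimately show "(x, y) \<in> (\<Union>K\<in>staircases d e \<F> \<G>. convex hull (map_prod v w ` K))" by blast
    qed
  qed
  fix K assume "K \<in> staircases d e \<F> \<G>"
  then obtain \<sigma> \<tau> where st: "\<sigma> \<in> \<F>" "\<tau> \<in> \<G>" "K \<subseteq> \<sigma> \<times> \<tau>"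
    and K: "grid_chain K" "card K = d + e + 1" by (auto simp: staircases_def)
  have fin: "finite \<sigma>" "finite \<tau>" using c(2) c'(2) st by blast+
  show "finite K" "card K = d + e + 1"
    using K fin st finite_subset[OF st(3)] by simp_all
  show "map_prod v w ` K \<subseteq> vertices (C \<times> D)"
  proof -
    have "map_prod v w ` K \<subseteq> (v ` \<sigma>) \<times> (w ` \<tau>)" using st(3) by auto
    also have "\<dots> \<subseteq> vertices C \<times> vertices D" using c(2)[OF st(1)] c'(2)[OF st(2)] by auto
    finally show ?thesis using vertices_Times by blast
  qed
  fix K' u u' assume "K' \<in> staircases d e \<F> \<G>"
  then obtain \<sigma>' \<tau>' where st': "\<sigma>' \<in> \<F>" "\<tau>' \<in> \<G>" "K' \<subseteq> \<sigma>' \<times> \<tau>'" and K': "grid_chain K'"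
    by (auto simp: staircases_def)
  have fin': "finite \<sigma>'" "finite \<tau>'" using c(2) c'(2) st' by blast+
  assume u: "u \<in> weights K" and u': "u' \<in> weights K'"
    and eq: "(\<Sum>p\<in>K. u p *\<^sub>R map_prod v w p) = (\<Sum>p\<in>K'. u' p *\<^sub>R map_prod v w p)"
  have eqs: "(\<Sum>i\<in>\<sigma>. (\<Sum>j\<in>\<tau>. u (i, j)) *\<^sub>R v i) = (\<Sum>i\<in>\<sigma>'. (\<Sum>j\<in>\<tau>'. u' (i, j)) *\<^sub>R v i)"
      "(\<Sum>j\<in>\<tau>. (\<Sum>i\<in>\<sigma>. u (i, j)) *\<^sub>R w j) = (\<Sum>j\<in>\<tau>'. (\<Sum>i\<in>\<sigma>'. u' (i, j)) *\<^sub>R w j)"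
    using eq unfolding sum_weights_product[OF u st(3) fin] sum_weights_product[OF u' st'(3) fin'] by auto
  have row: "(\<Sum>j\<in>\<tau>. u (i, j)) = (\<Sum>j\<in>\<tau>'. u' (i, j))" for i
    using c(4)[OF st(1) st'(1) weights_marginals(1)[OF u st(3) fin] weights_marginals(1)[OF u' st'(3) fin'] eqs(1)]
    by meson
  have col: "(\<Sum>i\<in>\<sigma>. u (i, j)) = (\<Sum>i\<in>\<sigma>'. u' (i, j))" for j
    using c'(4)[OF st(2) st'(2) weights_marginals(2)[OF u st(3) fin] weights_marginals(2)[OF u' st'(3) fin'] eqs(2)]
    by meson
  have z: "u (i, j) = 0" if "i \<notin> \<sigma> \<or> j \<notin> \<tau>" for i j
    using weightsD(2)[OF u, of "(i, j)"] st(3) that by blast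
  have z': "u' (i, j) = 0" if "i \<notin> \<sigma>' \<or> j \<notin> \<tau>'" for i j
    using weightsD(2)[OF u', of "(i, j)"] st'(3) that by blast
  show "u = u'"
  \<comment> \<open>The staircases may come from different pairs of simplices, so the couplings are
    compared on the grid of the unions; the added cells have weight 0.\<close>
  proof (rule monotone_coupling_unique[of "\<sigma> \<union> \<sigma>'" "\<tau> \<union> \<tau>'" u K u' K'])
    show "(\<Sum>j\<in>\<tau> \<union> \<tau>'. u (i, j)) = (\<Sum>j\<in>\<tau> \<union> \<tau>'. u' (i, j))" for i
    proof -
      have "(\<Sum>j\<in>\<tau> \<union> \<tau>'. u (i, j)) = (\<Sum>j\<in>\<tau>. u (i, j))"
        using fin fin' z by (intro sum.mono_neutral_right) auto
      also have "\<dots> = (\<Sum>j\<in>\<tau> \<union> \<tau>'. u' (i, j))"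
        unfolding row using fin fin' z' by (intro sum.mono_neutral_left) auto
      finally show ?thesis .
    qed
    show "(\<Sum>i\<in>\<sigma> \<union> \<sigma>'. u (i, j)) = (\<Sum>i\<in>\<sigma> \<union> \<sigma>'. u' (i, j))" for j
    proof -
      have "(\<Sum>i\<in>\<sigma> \<union> \<sigma>'. u (i, j)) = (\<Sum>i\<in>\<sigma>. u (i, j))"
        using fin fin' z by (intro sum.mono_neutral_right) auto
      also have "\<dots> = (\<Sum>i\<in>\<sigma> \<union> \<sigma>'. u' (i, j))"
        unfolding col using fin fin' z' by (intro sum.mono_neutral_left) auto
      finally show ?thesis .
    qed
  qed (use u u' K K' fin fin' st(3) st'(3) in auto)
qed

section \<open>Relabelling and injective linear images\<close>

lemma weights_relabel:
  assumes "inj f" "u \<in> weights (f ` \<sigma>)"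
  shows "u \<circ> f \<in> weights \<sigma>" "(\<Sum>k\<in>f ` \<sigma>. u k *\<^sub>R g k) = (\<Sum>i\<in>\<sigma>. (u \<circ> f) i *\<^sub>R g (f i))"
proof -
  have inj: "inj_on f \<sigma>" using assms(1) inj_on_subset by blast
  show "(\<Sum>k\<in>f ` \<sigma>. u k *\<^sub>R g k) = (\<Sum>i\<in>\<sigma>. (u \<circ> f) i *\<^sub>R g (f i))"
    by (simp add: sum.reindex[OF inj])
  have "sum (u \<circ> f) \<sigma> = 1"
    using weightsD(3)[OF assms(2)] by (simp add: sum.reindex[OF inj])
  then show "u \<circ> f \<in> weights \<sigma>"
    using weightsD(1,2)[OF assms(2)] assms(1) by (intro weightsI) (auto simp: inj_image_mem_iff)
qed

text \<open>Products have pairs as labels, while the staircase construction needs natural numbers; a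
  bijection brings them back so that products can be iterated. The order it induces on the old
  labels is arbitrary.\<close>

lemma simplicial_relabel:
  fixes f :: "'l \<Rightarrow> 'm"
  assumes S: "simplicial d C v \<F>" and f: "bij f"
  shows "simplicial d C (v \<circ> inv f) ((`) f ` \<F>)" "card ((`) f ` \<F>) = card \<F>"
proof -
  note c = simplicialD[OF S]
  have inj: "inj f" and f_inv: "inv f (f i) = i" "f (inv f k) = k" for i k
    using f by (auto simp: bij_def surj_f_inv_f)
  have im: "(v \<circ> inv f) ` f ` \<sigma> = v ` \<sigma>" for \<sigma>
    by (simp add: image_comp comp_assoc f_inv comp_def)
  show "card ((`) f ` \<F>) = card \<F>"
    using inj by (intro card_image) (auto simp: inj_on_def inj_image_eq_iff)
  show "simplicial d C (v \<circ> inv f) ((`) f ` \<F>)"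
    unfolding simplicial_def
  proof (intro conjI ballI impI; (elim imageE)?)
    show "finite ((`) f ` \<F>)" using c by blast
    show "C = (\<Union>\<sigma>\<in>(`) f ` \<F>. convex hull ((v \<circ> inv f) ` \<sigma>))"
    proof -
      have "(\<Union>\<sigma>\<in>(`) f ` \<F>. convex hull ((v \<circ> inv f) ` \<sigma>)) = (\<Union>\<sigma>\<in>\<F>. convex hull ((v \<circ> inv f) ` f ` \<sigma>))"
        by blast
      also have "\<dots> = C" unfolding im by (rule c(3)[symmetric])
      finally show ?thesis ..
    qed
    fix \<sigma>' \<sigma> assume \<sigma>: "\<sigma>' = f ` \<sigma>" "\<sigma> \<in> \<F>"
    show "finite \<sigma>'" "card \<sigma>' = d + 1" "(v \<circ> inv f) ` \<sigma>' \<subseteq> vertices C"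
      using c(2)[OF \<sigma>(2)] inj unfolding \<sigma> im by (simp_all add: card_image inj_on_subset[OF inj])
    fix \<tau>' \<tau> u u' assume \<tau>: "\<tau>' = f ` \<tau>" "\<tau> \<in> \<F>"
      and u: "u \<in> weights \<sigma>'" "u' \<in> weights \<tau>'"
      and eq: "(\<Sum>i\<in>\<sigma>'. u i *\<^sub>R (v \<circ> inv f) i) = (\<Sum>i\<in>\<tau>'. u' i *\<^sub>R (v \<circ> inv f) i)"
    have "u \<circ> f = u' \<circ> f"
    proof (rule c(4)[OF \<sigma>(2) \<tau>(2)])
      show "u \<circ> f \<in> weights \<sigma>" "u' \<circ> f \<in> weights \<tau>"
        using weights_relabel(1)[OF inj] u \<sigma> \<tau> by blast+
      show "(\<Sum>i\<in>\<sigma>. (u \<circ> f) i *\<^sub>R v i) = (\<Sum>i\<in>\<tau>. (u' \<circ> f) i *\<^sub>R v i)"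
        using eq weights_relabel(2)[OF inj u(1)[unfolded \<sigma>], of "v \<circ> inv f"]
          weights_relabel(2)[OF inj u(2)[unfolded \<tau>], of "v \<circ> inv f"]
        by (simp add: \<sigma> \<tau> f_inv)
    qed
    then show "u = u'"
      using f by (metis bij_def comp_assoc surj_iff comp_id)
  qed
qed

lemma simplicial_linear_image:
  fixes C :: "'a::real_vector set" and h :: "'a \<Rightarrow> 'b::real_vector"
  assumes S: "simplicial d C v \<F>" and h: "linear h" "inj h"
  shows "simplicial d (h ` C) (h \<circ> v) \<F>"
  unfolding simplicial_def
proof (intro conjI ballI impI)
  note c = simplicialD[OF S]
  show "finite \<F>" by (rule c)
  have hull: "convex hull ((h \<circ> v) ` \<sigma>) = h ` (convex hull (v ` \<sigma>))" for \<sigma>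
    by (simp add: convex_hull_linear_image[OF h(1)] image_comp)
  show "h ` C = (\<Union>\<sigma>\<in>\<F>. convex hull ((h \<circ> v) ` \<sigma>))"
    unfolding hull by (subst c(3)) (rule image_UN)
  have sum: "(\<Sum>i\<in>\<sigma>. u i *\<^sub>R (h \<circ> v) i) = h (\<Sum>i\<in>\<sigma>. u i *\<^sub>R v i)" for u :: "'c \<Rightarrow> real" and \<sigma>
    by (simp add: linear_sum[OF h(1)] linear_scale[OF h(1)])
  fix \<sigma> assume \<sigma>: "\<sigma> \<in> \<F>"
  show "finite \<sigma>" "card \<sigma> = d + 1" using c(2)[OF \<sigma>] by auto
  show "(h \<circ> v) ` \<sigma> \<subseteq> vertices (h ` C)"
  proof (rule image_subsetI)
    fix i assume "i \<in> \<sigma>"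
    then have "{v i} face_of C"
      using c(2)[OF \<sigma>] by (auto simp: vertices_def face_of_singleton)
    then have "h ` {v i} face_of h ` C" using face_of_linear_image[OF h] by blast
    then show "(h \<circ> v) i \<in> vertices (h ` C)" by (simp add: vertices_def face_of_singleton)
  qed
  fix \<tau> u u' assume "\<tau> \<in> \<F>" "u \<in> weights \<sigma>" "u' \<in> weights \<tau>"
    "(\<Sum>i\<in>\<sigma>. u i *\<^sub>R (h \<circ> v) i) = (\<Sum>i\<in>\<tau>. u' i *\<^sub>R (h \<circ> v) i)"
  then show "u = u'"
    using c(4)[OF \<sigma>] h(2) unfolding sum by (simp add: inj_eq)
qed

section \<open>Faces and dimension of products\<close>

text \<open>The points (x, y') and (x', y) of a face have the same midpoint as (x, y) and (x', y'),
  so the latter lie in the face too, and the face is the full product of its projections. A segment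
  in one coordinate, with the other held fixed, shows that each projection is a face.\<close>

lemma face_of_Times_decompose:
  fixes S :: "'a::real_vector set" and T :: "'b::real_vector set"
  assumes C: "C face_of S \<times> T"
  shows "fst ` C face_of S" "snd ` C face_of T" "C = fst ` C \<times> snd ` C"
proof -
  have sub: "C \<subseteq> S \<times> T" and cv: "convex C"
    using C by (auto simp: face_of_def)
  show *: "C = fst ` C \<times> snd ` C"
  proof
    show "fst ` C \<times> snd ` C \<subseteq> C"
    proof clarsimp
      fix x y' x' y assume xy: "(x, y') \<in> C" "(x', y) \<in> C"
      define m where "m = midpoint (x, y') (x', y)"
      have m: "m \<in> C" unfolding m_def midpoint_def
        using convexD[OF cv xy, of "1/2" "1/2"] by (simp add: algebra_simps)
      have meq: "m = midpoint (x, y) (x', y')"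
        by (simp add: m_def midpoint_def)
      show "(x, y) \<in> C"
      \<comment> \<open>Coinciding endpoints are treated apart because their open segment is
        empty.\<close>
      proof (cases "(x, y) = (x', y')")
        case True then show ?thesis using xy by simp
      next
        case False
        then have "m \<in> open_segment (x, y) (x', y')" using meq midpoint_in_open_segment by metis
        then show ?thesis using face_ofD[OF C _ _ _ m, of "(x, y)" "(x', y')"] sub xy by blast
      qed
    qed
  qed (rule subset_fst_snd)
  have lin: "convex (fst ` C)" "convex (snd ` C)"
    using cv by (auto intro: convex_linear_image linear_fst linear_snd)
  show "fst ` C face_of S"
    unfolding face_of_def
  proof (intro conjI ballI impI)
    show "fst ` C \<subseteq> S" using sub by auto
    fix a b x assume ab: "a \<in> S" "b \<in> S" "x \<in> fst ` C" "x \<in> open_segment a b"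
    then obtain y where y: "(x, y) \<in> C" by force
    have "(x, y) \<in> open_segment (a, y) (b, y)" using ab(4) by (auto simp: in_segment)
    then have "(a, y) \<in> C \<and> (b, y) \<in> C"
      using face_ofD[OF C _ _ _ y] ab sub y by blast
    then show "a \<in> fst ` C" "b \<in> fst ` C" by force+
  qed (rule lin)
  show "snd ` C face_of T"
    unfolding face_of_def
  proof (intro conjI ballI impI)
    show "snd ` C \<subseteq> T" using sub by auto
    fix a b y assume ab: "a \<in> T" "b \<in> T" "y \<in> snd ` C" "y \<in> open_segment a b"
    then obtain x where x: "(x, y) \<in> C" by force
    have "(x, y) \<in> open_segment (x, a) (x, b)" using ab(4) by (auto simp: in_segment)
    then have "(x, a) \<in> C \<and> (x, b) \<in> C"
      using face_ofD[OF C _ _ _ x] ab sub x by blast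
    then show "a \<in> snd ` C" "b \<in> snd ` C" by force+
  qed (rule lin)
qed

lemma face_lattice_isomorphic_refl: "face_lattice_isomorphic P P"
  unfolding face_lattice_isomorphic_def by (intro exI[of _ "\<lambda>F. F"]) (auto simp: bij_betw_def)

lemma face_lattice_isomorphic_trans:
  assumes "face_lattice_isomorphic P Q" "face_lattice_isomorphic Q R"
  shows "face_lattice_isomorphic P R"
proof -
  obtain \<phi> where \<phi>: "bij_betw \<phi> (faces P) (faces Q)" "\<forall>F\<in>faces P. \<forall>G\<in>faces P. F \<subseteq> G \<longleftrightarrow> \<phi> F \<subseteq> \<phi> G"
    using assms(1) unfolding face_lattice_isomorphic_def by blast
  obtain \<psi> where \<psi>: "bij_betw \<psi> (faces Q) (faces R)" "\<forall>F\<in>faces Q. \<forall>G\<in>faces Q. F \<subseteq> G \<longleftrightarrow> \<psi> F \<subseteq> \<psi> G"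
    using assms(2) unfolding face_lattice_isomorphic_def by blast
  have "bij_betw (\<psi> \<circ> \<phi>) (faces P) (faces R)"
    using \<phi>(1) \<psi>(1) by (rule bij_betw_trans)
  moreover have "F \<subseteq> G \<longleftrightarrow> (\<psi> \<circ> \<phi>) F \<subseteq> (\<psi> \<circ> \<phi>) G" if "F \<in> faces P" "G \<in> faces P" for F G
    using that \<phi> \<psi> bij_betwE[OF \<phi>(1)] by simp
  ultimately show ?thesis unfolding face_lattice_isomorphic_def by blast
qed

lemma face_lattice_isomorphic_sym:
  assumes "face_lattice_isomorphic P Q"
  shows "face_lattice_isomorphic Q P"
proof -
  obtain \<phi> where \<phi>: "bij_betw \<phi> (faces P) (faces Q)" "\<forall>F\<in>faces P. \<forall>G\<in>faces P. F \<subseteq> G \<longleftrightarrow> \<phi> F \<subseteq> \<phi> G"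
    using assms unfolding face_lattice_isomorphic_def by blast
  let ?\<psi> = "inv_into (faces P) \<phi>"
  have "bij_betw ?\<psi> (faces Q) (faces P)"
    using \<phi>(1) by (rule bij_betw_inv_into)
  moreover have "F \<subseteq> G \<longleftrightarrow> ?\<psi> F \<subseteq> ?\<psi> G" if "F \<in> faces Q" "G \<in> faces Q" for F G
    using that \<phi>(2) bij_betwE[OF \<open>bij_betw ?\<psi> (faces Q) (faces P)\<close>] bij_betw_inv_into_right[OF \<phi>(1)]
    by metis
  ultimately show ?thesis unfolding face_lattice_isomorphic_def by blast
qed

lemma face_lattice_isomorphic_linear_image:
  assumes "linear h" "inj h"
  shows "face_lattice_isomorphic P (h ` P)"
  unfolding face_lattice_isomorphic_def
proof (intro exI conjI ballI)
  show "bij_betw ((`) h) (faces P) (faces (h ` P))"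
    unfolding faces_def faces_of_linear_image[OF assms]
    using assms(2) by (intro inj_on_imp_bij_betw inj_onI) (simp add: inj_image_eq_iff)
  show "F \<subseteq> G \<longleftrightarrow> h ` F \<subseteq> h ` G" for F G
    using assms(2) by (simp add: inj_image_subset_iff)
qed

text \<open>Nonempty faces of a product are pairs of nonempty faces, ordered componentwise; only the
  empty face can be written as a product in several ways. The given isomorphisms preserve it as the
  least element, so multiplying their values is again an order isomorphism.\<close>

lemma face_lattice_isomorphic_Times:
  assumes "face_lattice_isomorphic P P'" "face_lattice_isomorphic Q Q'"
  shows "face_lattice_isomorphic (P \<times> Q) (P' \<times> Q')"
proof -
  have empty: "{} \<in> faces S" for S :: "'x::real_vector set" by (simp add: faces_def)
  obtain \<phi> where \<phi>: "bij_betw \<phi> (faces P) (faces P')" "\<forall>F\<in>faces P. \<forall>G\<in>faces P. F \<subseteq> G \<longleftrightarrow> \<phi> F \<subseteq> \<phi> G"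
    using assms(1) unfolding face_lattice_isomorphic_def by blast
  obtain \<psi> where \<psi>: "bij_betw \<psi> (faces Q) (faces Q')" "\<forall>F\<in>faces Q. \<forall>G\<in>faces Q. F \<subseteq> G \<longleftrightarrow> \<psi> F \<subseteq> \<psi> G"
    using assms(2) unfolding face_lattice_isomorphic_def by blast
  \<comment> \<open>Some face is sent to {}. Since {} is contained in that face, its image is
    contained in {}.\<close>
  have \<phi>0: "\<phi> F = {} \<longleftrightarrow> F = {}" if "F \<in> faces P" for F
  proof -
    obtain F0 where "F0 \<in> faces P" "\<phi> F0 = {}"
      using empty bij_betw_imp_surj_on[OF \<phi>(1)] by (metis imageE)
    then have "\<phi> {} = {}" using \<phi>(2) empty by blast
    then show ?thesis using \<phi>(2) empty that by blast
  qed
  have \<psi>0: "\<psi> F = {} \<longleftrightarrow> F = {}" if "F \<in> faces Q" for F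
  proof -
    obtain F0 where "F0 \<in> faces Q" "\<psi> F0 = {}"
      using empty bij_betw_imp_surj_on[OF \<psi>(1)] by (metis imageE)
    then have "\<psi> {} = {}" using \<psi>(2) empty by blast
    then show ?thesis using \<psi>(2) empty that by blast
  qed
  define \<omega> where "\<omega> C = \<phi> (fst ` C) \<times> \<psi> (snd ` C)" for C
  have fs: "fst ` C \<in> faces P" "snd ` C \<in> faces Q" "C = fst ` C \<times> snd ` C" if "C \<in> faces (P \<times> Q)" for C
    using face_of_Times_decompose[of C P Q] that by (simp_all add: faces_def)
  have order: "C \<subseteq> D \<longleftrightarrow> \<omega> C \<subseteq> \<omega> D" if C: "C \<in> faces (P \<times> Q)" and D: "D \<in> faces (P \<times> Q)" for C D
  proof -
    have "C \<subseteq> D \<longleftrightarrow> fst ` C = {} \<or> snd ` C = {} \<or> (fst ` C \<subseteq> fst ` D \<and> snd ` C \<subseteq> snd ` D)"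
      by (subst fs(3)[OF C], subst fs(3)[OF D]) (auto simp only: times_subset_iff)
    also have "\<dots> \<longleftrightarrow> \<phi> (fst ` C) = {} \<or> \<psi> (snd ` C) = {} \<or>
        (\<phi> (fst ` C) \<subseteq> \<phi> (fst ` D) \<and> \<psi> (snd ` C) \<subseteq> \<psi> (snd ` D))"
      using \<phi>0[OF fs(1)[OF C]] \<psi>0[OF fs(2)[OF C]] \<phi>(2) \<psi>(2) fs(1,2)[OF C] fs(1,2)[OF D] by simp
    also have "\<dots> \<longleftrightarrow> \<omega> C \<subseteq> \<omega> D"
      unfolding \<omega>_def by (auto simp only: times_subset_iff)
    finally show ?thesis .
  qed
  have "inj_on \<omega> (faces (P \<times> Q))"
  proof (rule inj_onI)
    fix C D assume *: "C \<in> faces (P \<times> Q)" "D \<in> faces (P \<times> Q)" "\<omega> C = \<omega> D"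
    then have "C \<subseteq> D" "D \<subseteq> C" using order[OF *(1,2)] order[OF *(2,1)] by simp_all
    then show "C = D" by simp
  qed
  moreover have "\<omega> ` faces (P \<times> Q) = faces (P' \<times> Q')"
  proof
    show "\<omega> ` faces (P \<times> Q) \<subseteq> faces (P' \<times> Q')"
    proof (rule image_subsetI)
      fix C assume "C \<in> faces (P \<times> Q)"
      then have "\<phi> (fst ` C) \<in> faces P'" "\<psi> (snd ` C) \<in> faces Q'"
        using fs bij_betwE[OF \<phi>(1)] bij_betwE[OF \<psi>(1)] by blast+
      then show "\<omega> C \<in> faces (P' \<times> Q')"
        unfolding \<omega>_def faces_def by (simp add: face_of_Times)
    qed
    show "faces (P' \<times> Q') \<subseteq> \<omega> ` faces (P \<times> Q)"
    proof
      fix D assume D: "D \<in> faces (P' \<times> Q')"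
      then have d: "fst ` D \<in> faces P'" "snd ` D \<in> faces Q'" "D = fst ` D \<times> snd ` D"
        using face_of_Times_decompose[of D P' Q'] by (simp_all add: faces_def)
      obtain F G where FG: "F \<in> faces P" "\<phi> F = fst ` D" "G \<in> faces Q" "\<psi> G = snd ` D"
        using d(1,2) bij_betw_imp_surj_on[OF \<phi>(1)] bij_betw_imp_surj_on[OF \<psi>(1)] by (metis imageE)
      have "F \<times> G \<in> faces (P \<times> Q)" using FG by (simp add: faces_def face_of_Times)
      moreover have "\<omega> (F \<times> G) = D"
      proof (cases "D = {}")
        case True
        then have "F = {}" using FG \<phi>0 by simp
        then have "\<omega> (F \<times> G) = \<phi> {} \<times> \<psi> {}" by (simp add: \<omega>_def)
        then show ?thesis using \<phi>0[OF empty] True by simp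
      next
        case False
        then have "\<phi> F \<noteq> {}" "\<psi> G \<noteq> {}" using FG(2,4) by simp_all
        then have "F \<noteq> {}" "G \<noteq> {}" using FG(1,3) \<phi>0 \<psi>0 by blast+
        then have "\<omega> (F \<times> G) = \<phi> F \<times> \<psi> G" by (simp add: \<omega>_def)
        then show ?thesis using FG d(3) by simp
      qed
      ultimately show "D \<in> \<omega> ` faces (P \<times> Q)" by blast
    qed
  qed
  ultimately have "bij_betw \<omega> (faces (P \<times> Q)) (faces (P' \<times> Q'))" by (simp add: bij_betw_def)
  then show ?thesis using order unfolding face_lattice_isomorphic_def by blast
qed

section \<open>Affine hulls and affine dimension\<close>

lemma affineI:
  assumes "\<And>x y u v. x \<in> S \<Longrightarrow> y \<in> S \<Longrightarrow> u + v = 1 \<Longrightarrow> u *\<^sub>R x + v *\<^sub>R y \<in> S"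
  shows "affine S"
  using assms by (simp add: affine_def)

lemma affine_vimage:
  assumes "linear h" "affine S"
  shows "affine {x. h x \<in> S}"
  using assms by (auto simp: affine_def linear_add linear_scale)

lemma affine_hull_linear_image':
  fixes h :: "'a::real_vector \<Rightarrow> 'b::real_vector"
  assumes "linear h"
  shows "affine hull (h ` S) = h ` (affine hull S)"
proof
  have "affine (h ` (affine hull S))"
  proof (rule affineI)
    fix x' y' and u v :: real
    assume "x' \<in> h ` (affine hull S)" "y' \<in> h ` (affine hull S)" and uv: "u + v = 1"
    then obtain x y where xy: "x' = h x" "y' = h y" and *: "x \<in> affine hull S" "y \<in> affine hull S" by blast
    have "u *\<^sub>R h x + v *\<^sub>R h y = h (u *\<^sub>R x + v *\<^sub>R y)"
      using assms by (simp add: linear_add linear_scale)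
    then show "u *\<^sub>R x' + v *\<^sub>R y' \<in> h ` (affine hull S)"
      using mem_affine[OF affine_affine_hull * uv] xy by auto
  qed
  then show "affine hull (h ` S) \<subseteq> h ` (affine hull S)"
    by (intro hull_minimal image_mono hull_subset)
  have "affine hull S \<subseteq> {x. h x \<in> affine hull (h ` S)}"
    by (intro hull_minimal affine_vimage assms affine_affine_hull) (auto intro: hull_inc)
  then show "h ` (affine hull S) \<subseteq> affine hull (h ` S)" by blast
qed

lemma affine_dependent_linear_image_inj:
  fixes h :: "'a::real_vector \<Rightarrow> 'b::real_vector"
  assumes "linear h" "inj h" "affine_dependent (h ` B)"
  shows "affine_dependent B"
proof -
  obtain x where x: "x \<in> B" "h x \<in> affine hull (h ` B - {h x})"
    using assms(3) unfolding affine_dependent_def by blast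
  have "h ` B - {h x} = h ` (B - {x})"
    using assms(2) by (auto simp: inj_eq)
  then have "h x \<in> h ` (affine hull (B - {x}))"
    using x(2) affine_hull_linear_image'[OF assms(1)] by simp
  then show ?thesis
    using x(1) assms(2) by (auto simp: affine_dependent_def inj_image_mem_iff)
qed

lemma has_aff_dim_linear_image:
  assumes "linear h" "inj h" "has_aff_dim d S"
  shows "has_aff_dim d (h ` S)"
proof -
  obtain B where B: "affine hull B = affine hull S" "\<not> affine_dependent B" "card B = d + 1"
    using assms(3) unfolding has_aff_dim_def by blast
  have "affine hull (h ` B) = affine hull (h ` S)"
    using affine_hull_linear_image'[OF assms(1)] B(1) by metis
  moreover have "\<not> affine_dependent (h ` B)"
    using affine_dependent_linear_image_inj[OF assms(1,2)] B(2) by blast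
  moreover have "card (h ` B) = d + 1"
    using B(3) assms(2) by (simp add: card_image inj_on_subset)
  ultimately show ?thesis unfolding has_aff_dim_def by blast
qed

text \<open>On the cross through (a, b) the identity (x, y) = (x, b) + (a, y) - (a, b) already
  produces the whole product. Letting \<open>U\<close> range between the cross and the product
  serves both the affine basis and the product itself in the dimension formula.\<close>

lemma affine_hull_Times:
  fixes S :: "'a::real_vector set" and T :: "'b::real_vector set"
  assumes "a \<in> S" "b \<in> T" "S \<times> {b} \<union> {a} \<times> T \<subseteq> U" "U \<subseteq> S \<times> T"
  shows "affine hull U = (affine hull S) \<times> (affine hull T)"
proof
  have "affine ((affine hull S) \<times> (affine hull T))"
    using affine_affine_hull[of S] affine_affine_hull[of T] by (auto simp: affine_def)
  then show "affine hull U \<subseteq> (affine hull S) \<times> (affine hull T)"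
    using assms(4) hull_subset[of S affine] hull_subset[of T affine] by (intro hull_minimal) blast+
  have 1: "affine hull S \<subseteq> {x. (x, b) \<in> affine hull U}"
  proof (rule hull_minimal)
    show "S \<subseteq> {x. (x, b) \<in> affine hull U}" using assms(3) by (auto intro: hull_inc)
    show "affine {x. (x, b) \<in> affine hull U}"
    proof (rule affineI)
      fix x y and u v :: real
      assume "x \<in> {x. (x, b) \<in> affine hull U}" "y \<in> {x. (x, b) \<in> affine hull U}" "u + v = 1"
      then have *: "(x, b) \<in> affine hull U" "(y, b) \<in> affine hull U" "u + v = 1" by simp_all
      have "u *\<^sub>R (x, b) + v *\<^sub>R (y, b) = (u *\<^sub>R x + v *\<^sub>R y, b)"
        using *(3) by (simp flip: scaleR_left_distrib)
      then show "u *\<^sub>R x + v *\<^sub>R y \<in> {x. (x, b) \<in> affine hull U}"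
        using mem_affine[OF affine_affine_hull *] by simp
    qed
  qed
  have 2: "affine hull T \<subseteq> {y. (a, y) \<in> affine hull U}"
  proof (rule hull_minimal)
    show "T \<subseteq> {y. (a, y) \<in> affine hull U}" using assms(3) by (auto intro: hull_inc)
    show "affine {y. (a, y) \<in> affine hull U}"
    proof (rule affineI)
      fix x y and u v :: real
      assume "x \<in> {x. (a, x) \<in> affine hull U}" "y \<in> {x. (a, x) \<in> affine hull U}" "u + v = 1"
      then have *: "(a, x) \<in> affine hull U" "(a, y) \<in> affine hull U" "u + v = 1" by simp_all
      have "u *\<^sub>R (a, x) + v *\<^sub>R (a, y) = (a, u *\<^sub>R x + v *\<^sub>R y)"
        using *(3) by (simp flip: scaleR_left_distrib)
      then show "u *\<^sub>R x + v *\<^sub>R y \<in> {x. (a, x) \<in> affine hull U}"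
        using mem_affine[OF affine_affine_hull *] by simp
    qed
  qed
  show "(affine hull S) \<times> (affine hull T) \<subseteq> affine hull U"
  proof clarify
    fix x y assume "x \<in> affine hull S" "y \<in> affine hull T"
    then have "(x, b) \<in> affine hull U" "(a, y) \<in> affine hull U" using 1 2 by blast+
    moreover have "(a, b) \<in> affine hull U" using assms by (intro hull_inc) auto
    ultimately have "(x, b) + 1 *\<^sub>R ((a, y) - (a, b)) \<in> affine hull U"
      by (intro mem_affine_3_minus affine_affine_hull)
    then show "(x, y) \<in> affine hull U" by simp
  qed
qed

text \<open>The cross formed by A \<times> {b} and {a} \<times> B has (d + 1) + (e + 1) - 1 points
  and is an affine basis. An affine dependence on it has marginals that are affine dependences of A
  and of B, hence zero; apart from (a, b), every cell of the cross is alone in its row or in its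
  column.\<close>

lemma has_aff_dim_Times:
  fixes S :: "'a::real_vector set" and T :: "'b::real_vector set"
  assumes "has_aff_dim d S" "has_aff_dim e T" "S \<noteq> {}" "T \<noteq> {}"
  shows "has_aff_dim (d + e) (S \<times> T)"
proof -
  obtain A where A: "affine hull A = affine hull S" "\<not> affine_dependent A" "card A = d + 1"
    using assms(1) unfolding has_aff_dim_def by blast
  obtain B where B: "affine hull B = affine hull T" "\<not> affine_dependent B" "card B = e + 1"
    using assms(2) unfolding has_aff_dim_def by blast
  have fin: "finite A" "finite B" using A B by (auto intro: card_ge_0_finite)
  obtain a b where ab: "a \<in> A" "b \<in> B" using A B by fastforce
  define U where "U = A \<times> {b} \<union> {a} \<times> (B - {b})"
  have finU: "finite U" using fin by (simp add: U_def)
  have cardU: "card U = (d + e) + 1"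
    unfolding U_def using fin ab A B by (subst card_Un_disjoint) (auto simp: card_cartesian_product)
  have "affine hull U = (affine hull A) \<times> (affine hull B)"
    using ab by (intro affine_hull_Times) (auto simp: U_def)
  moreover obtain s t where "s \<in> S" "t \<in> T" using assms by blast
  then have "affine hull (S \<times> T) = (affine hull S) \<times> (affine hull T)"
    by (intro affine_hull_Times[of s _ t]) auto
  ultimately have hull: "affine hull U = affine hull (S \<times> T)" using A B by simp
  have "\<not> affine_dependent U"
  proof
    assume "affine_dependent U"
    then obtain f where f: "sum f U = 0" "\<exists>p\<in>U. f p \<noteq> 0" "(\<Sum>p\<in>U. f p *\<^sub>R p) = 0"
      unfolding affine_dependent_explicit_finite[OF finU] by blast
    \<comment> \<open>Extending by 0 to the full grid allows sums over whole rows and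
      columns.\<close>
    define g where "g p = (if p \<in> U then f p else 0)" for p
    define \<alpha> \<beta> where "\<alpha> x = (\<Sum>y\<in>B. g (x, y))" and "\<beta> y = (\<Sum>x\<in>A. g (x, y))" for x y
    have UAB: "U \<subseteq> A \<times> B" using ab by (auto simp: U_def)
    have s1: "(\<Sum>p\<in>A \<times> B. g p) = 0"
      using f(1) UAB fin by (simp add: g_def sum.inter_restrict[symmetric] Int_absorb1)
    have s2: "(\<Sum>p\<in>A \<times> B. g p *\<^sub>R p) = 0"
    proof -
      have "(\<Sum>p\<in>A \<times> B. g p *\<^sub>R p) = (\<Sum>p\<in>U. g p *\<^sub>R p)"
        using UAB fin by (intro sum.mono_neutral_right) (auto simp: g_def)
      also have "\<dots> = (\<Sum>p\<in>U. f p *\<^sub>R p)" by (simp add: g_def)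
      finally show ?thesis using f by simp
    qed
    have fst0: "(\<Sum>x\<in>A. \<alpha> x *\<^sub>R x) = 0" and snd0: "(\<Sum>y\<in>B. \<beta> y *\<^sub>R y) = 0"
    proof -
      have "fst (\<Sum>p\<in>A \<times> B. g p *\<^sub>R p) = (\<Sum>x\<in>A. \<alpha> x *\<^sub>R x)"
        unfolding \<alpha>_def scaleR_sum_left by (simp add: fst_sum sum.cartesian_product case_prod_unfold)
      then show "(\<Sum>x\<in>A. \<alpha> x *\<^sub>R x) = 0" using s2 by simp
      have "snd (\<Sum>p\<in>A \<times> B. g p *\<^sub>R p) = (\<Sum>x\<in>A. \<Sum>y\<in>B. g (x, y) *\<^sub>R y)"
        by (simp add: snd_sum sum.cartesian_product case_prod_unfold)
      also have "\<dots> = (\<Sum>y\<in>B. \<beta> y *\<^sub>R y)"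
        unfolding \<beta>_def scaleR_sum_left by (rule sum.swap)
      finally show "(\<Sum>y\<in>B. \<beta> y *\<^sub>R y) = 0" using s2 by simp
    qed
    have tot: "sum \<alpha> A = 0" "sum \<beta> B = 0"
    proof -
      show a0: "sum \<alpha> A = 0"
        unfolding \<alpha>_def using s1 by (simp add: sum.cartesian_product)
      have "sum \<beta> B = sum \<alpha> A" unfolding \<alpha>_def \<beta>_def by (rule sum.swap)
      then show "sum \<beta> B = 0" using a0 by simp
    qed
    have \<alpha>0: "\<alpha> x = 0" if "x \<in> A" for x
      using A(2) fst0 tot(1) that unfolding affine_dependent_explicit_finite[OF fin(1)] by blast
    have \<beta>0: "\<beta> y = 0" if "y \<in> B" for y
      using B(2) snd0 tot(2) that unfolding affine_dependent_explicit_finite[OF fin(2)] by blast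
    have g1: "g (x, b) = 0" if "x \<in> A" "x \<noteq> a" for x
    proof -
      have "\<alpha> x = (\<Sum>y\<in>{b}. g (x, y))"
        unfolding \<alpha>_def using fin ab that by (intro sum.mono_neutral_right) (auto simp: g_def U_def)
      then show ?thesis using \<alpha>0[OF that(1)] by simp
    qed
    have g2: "g (a, y) = 0" if "y \<in> B" "y \<noteq> b" for y
    proof -
      have "\<beta> y = (\<Sum>x\<in>{a}. g (x, y))"
        unfolding \<beta>_def using fin ab that by (intro sum.mono_neutral_right) (auto simp: g_def U_def)
      then show ?thesis using \<beta>0[OF that(1)] by simp
    qed
    have "\<alpha> a = (\<Sum>y\<in>{b}. g (a, y))"
      unfolding \<alpha>_def using fin ab g2 by (intro sum.mono_neutral_right) auto
    then have g3: "g (a, b) = 0" using \<alpha>0[OF ab(1)] by simp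
    obtain p where p: "p \<in> U" "f p \<noteq> 0" using f by blast
    have "g p = 0" using p(1) g1 g2 g3 unfolding U_def by (cases p) auto
    then show False using p by (simp add: g_def)
  qed
  then show ?thesis using hull cardU unfolding has_aff_dim_def by blast
qed

section \<open>Face lattices from facet descriptions\<close>

text \<open>Write a point x of the face as a convex combination and single out one point v of
  positive weight r. Unless r = 1, the rest rescaled by 1 / (1 - r) is a point y of the hull, and x
  lies between y and v (or y = v = x), so the face contains v.\<close>

lemma face_of_convex_hull_finite:
  fixes V :: "'a::real_vector set"
  assumes V: "finite V" and F: "F face_of convex hull V"
  shows "F = convex hull (V \<inter> F)"
proof
  have "convex F" "F \<subseteq> convex hull V" using F by (auto simp: face_of_def)
  then show "convex hull (V \<inter> F) \<subseteq> F" by (intro hull_minimal) auto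
  show "F \<subseteq> convex hull (V \<inter> F)"
  proof
    fix x assume x: "x \<in> F"
    then have "x \<in> convex hull ((\<lambda>v. v) ` V)" using \<open>F \<subseteq> convex hull V\<close> by auto
    then obtain u where u: "u \<in> weights V" "x = (\<Sum>v\<in>V. u v *\<^sub>R v)"
      unfolding convex_hull_weights[OF V] by blast
    have pos: "v \<in> F" if v: "v \<in> V" "u v \<noteq> 0" for v
    proof -
      define r where "r = u v"
      have sum_r: "sum u (V - {v}) = 1 - r"
        using weightsD(3)[OF u(1)] sum.remove[OF V v(1), of u] by (simp add: r_def)
      have "0 \<le> sum u (V - {v})" using weightsD(1)[OF u(1)] by (intro sum_nonneg)
      then have r: "0 < r" "r \<le> 1" using v weightsD(1)[OF u(1), of v] sum_r by (auto simp: r_def)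
      have split: "x = r *\<^sub>R v + (\<Sum>w\<in>V - {v}. u w *\<^sub>R w)"
        using u(2) sum.remove[OF V v(1), of "\<lambda>w. u w *\<^sub>R w"] by (simp add: r_def)
      show "v \<in> F"
      proof (cases "r = 1")
        case True
        then have "\<forall>w\<in>V - {v}. u w = 0"
          using sum_r sum_nonneg_eq_0_iff[of "V - {v}" u] V weightsD(1)[OF u(1)] by auto
        then have "x = v" using split True by simp
        then show ?thesis using x by simp
      next
        case False
        define y where "y = (\<Sum>w\<in>V - {v}. (u w / (1 - r)) *\<^sub>R w)"
        have "y \<in> convex hull (V - {v})"
          unfolding y_def using V False r sum_r weightsD(1)[OF u(1)]
          by (intro convex_sum convex_convex_hull) (auto intro: hull_inc simp flip: sum_divide_distrib)
        then have y: "y \<in> convex hull V" using hull_mono[of "V - {v}" V] by blast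
        have "(1 - r) *\<^sub>R y = (\<Sum>w\<in>V - {v}. u w *\<^sub>R w)"
          unfolding y_def scaleR_sum_right using False by simp
        then have eq: "x = r *\<^sub>R v + (1 - r) *\<^sub>R y" using split by simp
        show ?thesis
        proof (cases "y = v")
          case True
          then show ?thesis using eq x by (simp flip: scaleR_left_distrib)
        next
          case False
          then have "x \<in> open_segment y v"
            using r \<open>r \<noteq> 1\<close> eq by (auto simp: in_segment intro!: exI[of _ r])
          then show ?thesis using face_ofD[OF F _ y _ x] v(1) hull_inc[of v V convex] by blast
        qed
      qed
    qed
    then have "u v = 0" if "v \<notin> F" for v
      using that weightsD(2)[OF u(1)] by blast
    then have *: "u \<in> weights (V \<inter> F)"
      using weights_restrict[OF u(1), of F] by (simp add: Int_commute)
    have "x = (\<Sum>v\<in>V \<inter> F. u v *\<^sub>R v)"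
      using sum_weights[OF * V, of "\<lambda>v. v"] u(2) by simp
    then show "x \<in> convex hull (V \<inter> F)"
      using * convex_hull_weights[of "V \<inter> F" "\<lambda>v. v"] V by auto
  qed
qed

section \<open>Finiteness behind the two maxima\<close>

lemma finite_faces:
  fixes P :: "'a::real_vector set"
  assumes "polytope P"
  shows "finite (faces P)"
proof -
  obtain V where V: "finite V" "P = convex hull V" using assms by (auto simp: polytope_def)
  have "faces P \<subseteq> (\<lambda>W. convex hull W) ` Pow V"
  proof
    fix F assume "F \<in> faces P"
    then have "F = convex hull (V \<inter> F)"
      using face_of_convex_hull_finite V by (simp add: faces_def)
    then show "F \<in> (\<lambda>W. convex hull W) ` Pow V" by blast
  qed
  then show ?thesis using V finite_subset by blast
qed

lemma vertices_le_faces: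
  fixes P :: "'a::real_vector set"
  assumes "polytope P"
  shows "finite (vertices P)" "card (vertices P) \<le> card (faces P)"
proof -
  have sub: "(\<lambda>v. {v}) ` vertices P \<subseteq> faces P"
    by (auto simp: vertices_def faces_def face_of_singleton)
  have inj: "inj_on (\<lambda>v. {v}) (vertices P)" by (auto intro: inj_onI)
  show "finite (vertices P)" using inj_on_finite[OF inj sub finite_faces[OF assms]] .
  show "card (vertices P) \<le> card (faces P)" using card_inj_on_le[OF inj sub finite_faces[OF assms]] .
qed

lemma card_triangulation_le:
  assumes T: "triangulation d C T" and fin: "finite (vertices C)"
  shows "card T \<le> 2 ^ card (vertices C)"
proof -
  have "T \<subseteq> (\<lambda>V. convex hull V) ` Pow (vertices C)"
  proof
    fix S assume "S \<in> T"
    then have S: "d_simplex d S" "vertices S \<subseteq> vertices C" using T by (auto simp: triangulation_def)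
    then obtain V where V: "\<not> affine_dependent V" "card V = d + 1" "S = convex hull V"
      by (auto simp: d_simplex_def)
    then have "vertices S = V" using vertices_simplex[of V] by (simp add: card_ge_0_finite)
    then show "S \<in> (\<lambda>V. convex hull V) ` Pow (vertices C)" using V S by blast
  qed
  then have "card T \<le> card ((\<lambda>V. convex hull V) ` Pow (vertices C))"
    using fin by (intro card_mono) auto
  also have "\<dots> \<le> card (Pow (vertices C))" using fin by (intro card_image_le) auto
  finally show ?thesis using fin by (simp add: card_Pow)
qed

text \<open>\<open>Max\<close> is a bound only for a finite set, so the sizes must be bounded
  uniformly over all combinatorial d-cubes. A simplex is the hull of its vertices, and a cube has at
  most as many vertices as faces, a number fixed by the isomorphism with
  \<open>standard_cube d\<close>.\<close>

lemma max_cube_triangulation_ge: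
  assumes C: "combinatorial_cube d C" and T: "triangulation d C T"
  shows "card T \<le> max_cube_triangulation d"
proof -
  define B where "B = (2::nat) ^ card (faces (standard_cube d))"
  define m where "m D = Max (card ` {T. triangulation d D T})" for D :: "(nat \<Rightarrow>\<^sub>0 real) set"
  have bound: "card S \<le> B" if D: "combinatorial_cube d D" and S: "triangulation d D S" for D S
  proof -
    have poly: "polytope D" and "face_lattice_isomorphic D (standard_cube d)"
      using D by (auto simp: combinatorial_cube_def)
    then have "card (faces D) = card (faces (standard_cube d))"
      unfolding face_lattice_isomorphic_def using bij_betw_same_card by blast
    then have "(2::nat) ^ card (vertices D) \<le> B"
      unfolding B_def using vertices_le_faces[OF poly] by (intro power_increasing) auto
    then show ?thesis using card_triangulation_le[OF S vertices_le_faces(1)[OF poly]] by linarith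
  qed
  have fin: "finite (card ` {S. triangulation d D S})" if "combinatorial_cube d D" for D
    by (rule finite_subset[of _ "{..B}"]) (use bound that in auto)
  \<comment> \<open>\<open>Max {}\<close> is an unspecified but fixed number; admitting it as one
    more value covers the cubes without proving that each has a triangulation.\<close>
  have "m D \<in> {..B} \<union> {Max {}}" if D: "combinatorial_cube d D" for D
  proof (cases "{S. triangulation d D S} = {}")
    case True
    then show ?thesis by (simp add: m_def)
  next
    case False
    then have "m D \<in> card ` {S. triangulation d D S}"
      unfolding m_def using fin[OF D] by (intro Max_in) auto
    then show ?thesis using bound[OF D] by auto
  qed
  then have "m ` {D. combinatorial_cube d D} \<subseteq> {..B} \<union> {Max {}}" by blast
  then have "finite (m ` {D. combinatorial_cube d D})" using finite_subset by blast
  then have "m C \<le> Max (m ` {D. combinatorial_cube d D})" using C by (intro Max_ge) auto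
  moreover have "card T \<le> m C"
    unfolding m_def using fin[OF C] T by (intro Max_ge) auto
  ultimately show ?thesis
    unfolding max_cube_triangulation_def m_def by linarith
qed

text \<open>\<open>E i\<close> collects the labels of the vertices on the i-th facet hyperplane.\<close>

definition facet_description ::
    "'a::real_vector set \<Rightarrow> 'l set \<Rightarrow> ('l \<Rightarrow> 'a) \<Rightarrow> 'i set \<Rightarrow> ('i \<Rightarrow> 'a \<Rightarrow> real) \<Rightarrow> ('i \<Rightarrow> 'l set) \<Rightarrow> bool" where
  "facet_description P L v I f E \<longleftrightarrow> finite L \<and> finite I \<and> P = convex hull (v ` L) \<and>
     P = {x. \<forall>i\<in>I. 0 \<le> f i x} \<and>
     (\<forall>i\<in>I. \<forall>x y s t. s + t = 1 \<longrightarrow> f i (s *\<^sub>R x + t *\<^sub>R y) = s * f i x + t * f i y) \<and>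
     (\<forall>i\<in>I. \<forall>l\<in>L. f i (v l) = 0 \<longleftrightarrow> l \<in> E i)"

lemma facet_descriptionD:
  assumes "facet_description P L v I f E"
  shows "finite L" "finite I" "P = convex hull (v ` L)" "P = {x. \<forall>i\<in>I. 0 \<le> f i x}"
    "\<And>i x y s t. i \<in> I \<Longrightarrow> s + t = 1 \<Longrightarrow> f i (s *\<^sub>R x + t *\<^sub>R y) = s * f i x + t * f i y"
    "\<And>i l. i \<in> I \<Longrightarrow> l \<in> L \<Longrightarrow> f i (v l) = 0 \<longleftrightarrow> l \<in> E i"
proof -
  note D = assms[unfolded facet_description_def]
  show "P = convex hull (v ` L)" "P = {x. \<forall>i\<in>I. 0 \<le> f i x}" using D by - (elim conjE, assumption)+
qed (use assms in \<open>simp_all add: facet_description_def\<close>)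

definition face_labels :: "'l set \<Rightarrow> ('l \<Rightarrow> 'a) \<Rightarrow> 'a set \<Rightarrow> 'l set" where
  "face_labels L v F = {l \<in> L. v l \<in> F}"

lemma finite_scaling:
  fixes a b :: "'i \<Rightarrow> real"
  assumes "finite K" "\<And>i. i \<in> K \<Longrightarrow> 0 < b i" "\<And>i. i \<in> K \<Longrightarrow> 0 \<le> a i"
  shows "\<exists>\<epsilon>>0. \<forall>i\<in>K. \<epsilon> * a i \<le> b i"
  using assms
proof (induction K)
  case empty
  then show ?case by (auto intro: exI[of _ 1])
next
  case (insert k K)
  then obtain \<epsilon> where \<epsilon>: "\<epsilon> > 0" "\<forall>i\<in>K. \<epsilon> * a i \<le> b i" by auto
  \<comment> \<open>Adding 1 keeps the denominator positive when \<open>a k\<close> = 0.\<close>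
  define \<delta> where "\<delta> = min \<epsilon> (b k / (a k + 1))"
  have ak: "0 \<le> a k" "0 < b k" using insert by auto
  have "\<delta> > 0" using \<epsilon> ak by (simp add: \<delta>_def)
  moreover have "\<delta> * a i \<le> b i" if "i \<in> K" for i
  proof -
    have "\<delta> * a i \<le> \<epsilon> * a i" using that insert.prems by (intro mult_right_mono) (auto simp: \<delta>_def)
    then show ?thesis using \<epsilon> that by force
  qed
  moreover have "\<delta> * a k \<le> b k"
  proof -
    have "\<delta> * a k \<le> (b k / (a k + 1)) * a k" using ak by (intro mult_right_mono) (auto simp: \<delta>_def)
    also have "\<dots> \<le> b k" using ak by (simp add: field_simps)
    finally show ?thesis .
  qed
  ultimately show ?case by auto
qed

text \<open>Let \<open>J\<close> consist of the facets that contain F. Averaging points of F yields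
  p in F at which all other facet functions are positive. For a labelled point on every facet of
  \<open>J\<close>, the segment to p can be prolonged a little beyond p inside P; so p is interior
  to a segment ending at that point, and the face contains it.\<close>

lemma face_labels_of_face:
  assumes D: "facet_description P L v I f E" and F: "F face_of P" "F \<noteq> {}"
  shows "\<exists>J\<subseteq>I. face_labels L v F = {l \<in> L. \<forall>i\<in>J. l \<in> E i}"
proof -
  note fin = facet_descriptionD(1,2)[OF D] and P = facet_descriptionD(3,4)[OF D]
    and aff = facet_descriptionD(5)[OF D] and E = facet_descriptionD(6)[OF D]
  have FP: "F \<subseteq> P" and cv: "convex F" using F by (auto simp: face_of_def)
  have nn: "0 \<le> f i x" if "x \<in> P" "i \<in> I" for x i using P(2) that by blast
  define J where "J = {i \<in> I. \<forall>x\<in>F. f i x = 0}"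
  have "\<exists>p\<in>F. \<forall>i\<in>K. 0 < f i p" if "K \<subseteq> I - J" for K
    using finite_subset[OF that finite_Diff[OF fin(2)]] that
  proof (induction K)
    case empty
    then show ?case using F by auto
  next
    case (insert k K)
    then obtain p where p: "p \<in> F" "\<forall>i\<in>K. 0 < f i p" by auto
    from insert obtain x where x: "x \<in> F" "f k x \<noteq> 0" "k \<in> I" by (auto simp: J_def)
    \<comment> \<open>The midpoint is positive wherever one of the two points is, so positivity at k
      is gained and none is lost.\<close>
    define q where "q = (1/2) *\<^sub>R p + (1/2) *\<^sub>R x"
    have "q \<in> F" unfolding q_def using convexD[OF cv p(1) x(1), of "1/2" "1/2"] by simp
    moreover have "0 < f i q" if "i \<in> insert k K" for i
    proof -
      have i: "i \<in> I" using that insert by auto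
      have "f i q = (1/2) * f i p + (1/2) * f i x" unfolding q_def using i by (intro aff) auto
      moreover have "0 \<le> f i p" "0 \<le> f i x" using nn i p x FP by blast+
      moreover have "0 < f i p \<or> f i x \<noteq> 0" using that p x by blast
      ultimately show ?thesis by linarith
    qed
    ultimately show ?case by blast
  qed
  from this[of "I - J"] obtain p where p: "p \<in> F" "\<forall>i\<in>I - J. 0 < f i p" by blast
  have "v l \<in> F" if l: "l \<in> L" "\<forall>i\<in>J. l \<in> E i" for l
  proof (cases "v l = p")
    case True
    then show ?thesis using p by simp
  next
    case False
    have vP: "v l \<in> P" using P(1) l hull_inc[of "v l" "v ` L" convex] by blast
    obtain \<epsilon> where \<epsilon>: "\<epsilon> > 0" "\<forall>i\<in>I - J. \<epsilon> * f i (v l) \<le> f i p"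
      using finite_scaling[of "I - J" "\<lambda>i. f i p" "\<lambda>i. f i (v l)"] fin p nn[OF vP] by auto
    \<comment> \<open>A move from \<open>v l\<close> through p and beyond. The functions in
      \<open>J\<close> vanish at both points, and the choice of \<open>\<epsilon>\<close> leaves
      room for the others.\<close>
    define q where "q = (1 + \<epsilon>) *\<^sub>R p + (- \<epsilon>) *\<^sub>R v l"
    have "q \<in> P"
    proof -
      have "0 \<le> f i q" if i: "i \<in> I" for i
      proof -
        have fq: "f i q = (1 + \<epsilon>) * f i p + (- \<epsilon>) * f i (v l)"
          unfolding q_def using i by (intro aff) auto
        show ?thesis
        proof (cases "i \<in> J")
          case True
          then have "f i p = 0" "f i (v l) = 0" using p l E i by (auto simp: J_def)
          then show ?thesis using fq by simp
        next
          case False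
          then have "\<epsilon> * f i (v l) \<le> f i p" "0 < f i p" "0 \<le> \<epsilon> * f i p"
            using \<epsilon> p i by (auto intro!: mult_nonneg_nonneg less_imp_le)
          then show ?thesis using fq by (simp add: algebra_simps)
        qed
      qed
      then show ?thesis using P(2) by blast
    qed
    moreover have "p \<in> open_segment q (v l)"
    proof -
      have "q - v l = (1 + \<epsilon>) *\<^sub>R (p - v l)"
        by (simp add: q_def algebra_simps)
      then have "q \<noteq> v l" using False \<epsilon> by auto
      moreover have "p = (1 - \<epsilon> / (1 + \<epsilon>)) *\<^sub>R q + (\<epsilon> / (1 + \<epsilon>)) *\<^sub>R v l"
      proof -
        have "(1 - \<epsilon> / (1 + \<epsilon>)) * (1 + \<epsilon>) = 1" "(1 - \<epsilon> / (1 + \<epsilon>)) * \<epsilon> = \<epsilon> / (1 + \<epsilon>)"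
          using \<epsilon> by (simp_all add: field_simps)
        then show ?thesis
          unfolding q_def scaleR_right_distrib scaleR_scaleR mult_minus_right by simp
      qed
      moreover have "0 < \<epsilon> / (1 + \<epsilon>)" "\<epsilon> / (1 + \<epsilon>) < 1" using \<epsilon> by simp_all
      ultimately show ?thesis unfolding in_segment by blast
    qed
    ultimately show ?thesis using face_ofD[OF F(1) _ _ vP p(1)] by blast
  qed
  moreover have "l \<in> E i" if "l \<in> L" "v l \<in> F" "i \<in> J" for l i
    using that E by (auto simp: J_def)
  ultimately have "face_labels L v F = {l \<in> L. \<forall>i\<in>J. l \<in> E i}"
    unfolding face_labels_def by blast
  moreover have "J \<subseteq> I" by (auto simp: J_def)
  ultimately show ?thesis by blast
qed

text \<open>Facet functions are affine and nonnegative on P, so a zero inside a segment forces zeros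
  at both ends.\<close>

lemma facet_description_face:
  assumes D: "facet_description P L v I f E" and J: "J \<subseteq> I"
  shows "{x \<in> P. \<forall>i\<in>J. f i x = 0} face_of P"
    "face_labels L v {x \<in> P. \<forall>i\<in>J. f i x = 0} = {l \<in> L. \<forall>i\<in>J. l \<in> E i}"
proof -
  note P = facet_descriptionD(3,4)[OF D] and aff = facet_descriptionD(5)[OF D]
    and E = facet_descriptionD(6)[OF D]
  have cvP: "convex P" unfolding P(1) by (rule convex_convex_hull)
  have nn: "0 \<le> f i x" if "x \<in> P" "i \<in> I" for x i using P(2) that by blast
  show "{x \<in> P. \<forall>i\<in>J. f i x = 0} face_of P"
    unfolding face_of_def
  proof (intro conjI ballI impI)
    show "convex {x \<in> P. \<forall>i\<in>J. f i x = 0}"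
    proof (rule convexI)
      fix x y and s t :: real
      assume "x \<in> {x \<in> P. \<forall>i\<in>J. f i x = 0}" "y \<in> {x \<in> P. \<forall>i\<in>J. f i x = 0}" "0 \<le> s" "0 \<le> t" "s + t = 1"
      then show "s *\<^sub>R x + t *\<^sub>R y \<in> {x \<in> P. \<forall>i\<in>J. f i x = 0}"
        using aff J convexD[OF cvP] by auto
    qed
    fix a b x assume a: "a \<in> P" "b \<in> P" and x: "x \<in> {x \<in> P. \<forall>i\<in>J. f i x = 0}" "x \<in> open_segment a b"
    then obtain t where t: "0 < t" "t < 1" "x = (1 - t) *\<^sub>R a + t *\<^sub>R b" by (auto simp: in_segment)
    have "f i a = 0 \<and> f i b = 0" if i: "i \<in> J" for i
    proof -
      have iI: "i \<in> I" using i J by blast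
      have "f i x = (1 - t) * f i a + t * f i b" unfolding t(3) using iI by (intro aff) auto
      moreover have "f i x = 0" using x i by simp
      moreover have "0 \<le> (1 - t) * f i a" "0 \<le> t * f i b"
        using t nn[OF a(1) iI] nn[OF a(2) iI] by auto
      ultimately have "(1 - t) * f i a = 0" "t * f i b = 0" by linarith+
      then show ?thesis using t by simp
    qed
    then show "a \<in> {x \<in> P. \<forall>i\<in>J. f i x = 0}" "b \<in> {x \<in> P. \<forall>i\<in>J. f i x = 0}" using a by auto
  qed auto
  have "v l \<in> P" if "l \<in> L" for l using P(1) that hull_inc[of "v l" "v ` L" convex] by blast
  then show "face_labels L v {x \<in> P. \<forall>i\<in>J. f i x = 0} = {l \<in> L. \<forall>i\<in>J. l \<in> E i}"
    unfolding face_labels_def using E J by blast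
qed

text \<open>A face is the hull of its labelled points, so label sets determine the faces and their
  order. They are the intersections of the sets \<open>E i\<close>, together with the empty set for
  the empty face: a family that depends on the incidence table alone and not on the
  geometry.\<close>

lemma facet_description_faces:
  assumes D: "facet_description P L v I f E"
  shows "bij_betw (face_labels L v) (faces P) (insert {} ((\<lambda>J. {l \<in> L. \<forall>i\<in>J. l \<in> E i}) ` Pow I))"
    "\<And>F G. F \<in> faces P \<Longrightarrow> G \<in> faces P \<Longrightarrow> F \<subseteq> G \<longleftrightarrow> face_labels L v F \<subseteq> face_labels L v G"
proof -
  have fin: "finite L" and P: "P = convex hull (v ` L)"
    using facet_descriptionD(1,3)[OF D] by this+
  have hull: "F = convex hull (v ` face_labels L v F)" if "F \<in> faces P" for F
  proof -
    have "F = convex hull (v ` L \<inter> F)"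
      using that fin P by (intro face_of_convex_hull_finite) (simp_all add: faces_def)
    moreover have "v ` L \<inter> F = v ` face_labels L v F" by (auto simp: face_labels_def)
    ultimately show ?thesis by simp
  qed
  show order: "F \<subseteq> G \<longleftrightarrow> face_labels L v F \<subseteq> face_labels L v G"
    if "F \<in> faces P" "G \<in> faces P" for F G
  proof
    assume "F \<subseteq> G" then show "face_labels L v F \<subseteq> face_labels L v G" by (auto simp: face_labels_def)
  next
    assume "face_labels L v F \<subseteq> face_labels L v G"
    then have "convex hull (v ` face_labels L v F) \<subseteq> convex hull (v ` face_labels L v G)"
      by (intro hull_mono image_mono)
    then show "F \<subseteq> G" using hull[OF that(1)] hull[OF that(2)] by simp
  qed
  have "face_labels L v ` faces P = insert {} ((\<lambda>J. {l \<in> L. \<forall>i\<in>J. l \<in> E i}) ` Pow I)"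
  proof
    show "face_labels L v ` faces P \<subseteq> insert {} ((\<lambda>J. {l \<in> L. \<forall>i\<in>J. l \<in> E i}) ` Pow I)"
    proof (rule image_subsetI)
      fix F assume F: "F \<in> faces P"
      show "face_labels L v F \<in> insert {} ((\<lambda>J. {l \<in> L. \<forall>i\<in>J. l \<in> E i}) ` Pow I)"
      proof (cases "F = {}")
        case True then show ?thesis by (simp add: face_labels_def)
      next
        case False
        then show ?thesis using face_labels_of_face[OF D, of F] F by (auto simp: faces_def)
      qed
    qed
    have "{} \<in> face_labels L v ` faces P"
      by (rule image_eqI[of _ _ "{}"]) (auto simp: face_labels_def faces_def)
    moreover have "{l \<in> L. \<forall>i\<in>J. l \<in> E i} \<in> face_labels L v ` faces P" if "J \<subseteq> I" for J
      using facet_description_face[OF D that] by (intro image_eqI[OF sym]) (auto simp: faces_def)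
    ultimately show "insert {} ((\<lambda>J. {l \<in> L. \<forall>i\<in>J. l \<in> E i}) ` Pow I) \<subseteq> face_labels L v ` faces P"
      by blast
  qed
  moreover have "inj_on (face_labels L v) (faces P)"
    using order by (intro inj_onI) (metis subset_antisym subset_refl)
  ultimately show "bij_betw (face_labels L v) (faces P) (insert {} ((\<lambda>J. {l \<in> L. \<forall>i\<in>J. l \<in> E i}) ` Pow I))"
    by (simp add: bij_betw_def)
qed

text \<open>Equal incidence tables give equal families of label sets, so one labelling followed by
  the inverse of the other is an isomorphism. This carries the combinatorial type of the unit cube
  over to the tilted prism.\<close>

lemma facet_description_isomorphic:
  assumes P: "facet_description P L v I f E" and Q: "facet_description Q L w I g E"
  shows "face_lattice_isomorphic P Q"
proof -
  note p = facet_description_faces[OF P] and q = facet_description_faces[OF Q]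
  let ?\<phi> = "inv_into (faces Q) (face_labels L w) \<circ> face_labels L v"
  have "bij_betw ?\<phi> (faces P) (faces Q)"
    using p(1) bij_betw_inv_into[OF q(1)] by (rule bij_betw_trans)
  moreover have "F \<subseteq> G \<longleftrightarrow> ?\<phi> F \<subseteq> ?\<phi> G" if FG: "F \<in> faces P" "G \<in> faces P" for F G
  proof -
    have "?\<phi> F \<in> faces Q" "?\<phi> G \<in> faces Q" using bij_betwE[OF calculation] FG by blast+
    moreover have "face_labels L w (?\<phi> F) = face_labels L v F" "face_labels L w (?\<phi> G) = face_labels L v G"
      using FG bij_betwE[OF p(1)] bij_betw_inv_into_right[OF q(1)] by simp_all
    ultimately show ?thesis using p(2)[OF FG] q(2) by simp
  qed
  ultimately show ?thesis unfolding face_lattice_isomorphic_def by blast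
qed

section \<open>Products of combinatorial cubes\<close>

lemma lookup_scaleR: "Poly_Mapping.lookup (r *\<^sub>R x) i = r * Poly_Mapping.lookup x i"
  for x :: "'a \<Rightarrow>\<^sub>0 real"
proof -
  have "finite {i. r * Poly_Mapping.lookup x i \<noteq> 0}"
    by (rule finite_subset[OF _ finite_lookup[of x]]) auto
  then show ?thesis by (simp add: scaleR_poly_mapping_def Abs_poly_mapping_inverse)
qed

lemma poly_mapping_real_of_fun:
  fixes f :: "'a \<Rightarrow> real"
  assumes "finite A" "\<And>i. i \<notin> A \<Longrightarrow> f i = 0"
  obtains x where "\<And>i. Poly_Mapping.lookup x i = f i"
proof -
  have "{i. f i \<noteq> 0} \<subseteq> A" using assms(2) by blast
  then have "finite {i. f i \<noteq> 0}" using assms(1) finite_subset by blast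
  then have "Poly_Mapping.lookup (Abs_poly_mapping f) i = f i" for i
    by (simp add: Abs_poly_mapping_inverse)
  then show ?thesis using that by blast
qed

text \<open>The first d and the first e coordinates fill the first d + e places, so that standard
  cubes go to standard cubes, and the two tails alternate afterwards. The tails cannot be dropped,
  since a combinatorial d-cube need not lie in the first d coordinates.\<close>

definition coordinate_split :: "nat \<Rightarrow> nat \<Rightarrow> nat \<Rightarrow> nat + nat" where
  "coordinate_split d e n =
     (if n < d then Inl n else if n < d + e then Inr (n - d)
      else if even (n - d - e) then Inl (d + (n - d - e) div 2) else Inr (e + (n - d - e) div 2))"

lemma coordinate_split_simps:
  "n < d \<Longrightarrow> coordinate_split d e n = Inl n"
  "n < e \<Longrightarrow> coordinate_split d e (d + n) = Inr n"
  "coordinate_split d e (d + e + 2 * k) = Inl (d + k)"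
  "coordinate_split d e (d + e + (2 * k + 1)) = Inr (e + k)"
  by (simp_all add: coordinate_split_def)

lemma bij_coordinate_split: "bij (coordinate_split d e)"
proof (rule bijI)
  show "inj (coordinate_split d e)"
  proof (rule injI)
    fix m n assume eq: "coordinate_split d e m = coordinate_split d e n"
    show "m = n"
      using eq unfolding coordinate_split_def
      by (auto split: if_splits elim!: evenE oddE)
  qed
  show "surj (coordinate_split d e)"
  proof -
    have "\<exists>n. s = coordinate_split d e n" for s
    proof (cases s)
      case (Inl i)
      then show ?thesis
        using coordinate_split_simps(1)[of i d e] coordinate_split_simps(3)[of d e "i - d"]
        by (cases "i < d") (metis not_less le_add_diff_inverse)+
    next
      case (Inr i)
      then show ?thesis
        using coordinate_split_simps(2)[of i e d] coordinate_split_simps(4)[of d e "i - e"]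
        by (cases "i < e") (metis not_less le_add_diff_inverse)+
    qed
    then show ?thesis unfolding surj_def by blast
  qed
qed

definition merge :: "nat \<Rightarrow> nat \<Rightarrow> (nat \<Rightarrow>\<^sub>0 real) \<times> (nat \<Rightarrow>\<^sub>0 real) \<Rightarrow> (nat \<Rightarrow>\<^sub>0 real)" where
  "merge d e p = Abs_poly_mapping (\<lambda>n. case coordinate_split d e n of
     Inl i \<Rightarrow> Poly_Mapping.lookup (fst p) i | Inr j \<Rightarrow> Poly_Mapping.lookup (snd p) j)"

lemma lookup_merge:
  "Poly_Mapping.lookup (merge d e p) n = (case coordinate_split d e n of
     Inl i \<Rightarrow> Poly_Mapping.lookup (fst p) i | Inr j \<Rightarrow> Poly_Mapping.lookup (snd p) j)"
proof -
  let ?f = "\<lambda>n. case coordinate_split d e n of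
     Inl i \<Rightarrow> Poly_Mapping.lookup (fst p) i | Inr j \<Rightarrow> Poly_Mapping.lookup (snd p) j"
  have "{n. ?f n \<noteq> 0} \<subseteq> coordinate_split d e -` (Inl ` Poly_Mapping.keys (fst p) \<union> Inr ` Poly_Mapping.keys (snd p))"
  proof
    fix n assume "n \<in> {n. ?f n \<noteq> 0}"
    then show "n \<in> coordinate_split d e -` (Inl ` Poly_Mapping.keys (fst p) \<union> Inr ` Poly_Mapping.keys (snd p))"
      by (cases "coordinate_split d e n") (auto simp: in_keys_iff)
  qed
  moreover have "finite (coordinate_split d e -` (Inl ` Poly_Mapping.keys (fst p) \<union> Inr ` Poly_Mapping.keys (snd p)))"
    using bij_coordinate_split[of d e] by (intro finite_vimageI) (auto simp: bij_def)
  ultimately have "finite {n. ?f n \<noteq> 0}" by (rule finite_subset)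
  then show ?thesis by (simp add: merge_def Abs_poly_mapping_inverse)
qed

lemma linear_merge: "linear (merge d e)"
proof (rule linearI)
  show "merge d e (p + q) = merge d e p + merge d e q" for p q
    by (rule poly_mapping_eqI) (simp add: lookup_merge lookup_add split: sum.splits)
  show "merge d e (r *\<^sub>R p) = r *\<^sub>R merge d e p" for r p
    by (rule poly_mapping_eqI) (simp add: lookup_merge lookup_scaleR split: sum.splits)
qed

lemma inj_merge: "inj (merge d e)"
proof (rule injI)
  fix p q assume eq: "merge d e p = merge d e q"
  show "p = q"
  proof (rule prod_eqI; rule poly_mapping_eqI)
    fix i
    obtain n where n: "coordinate_split d e n = Inl i"
      using bij_coordinate_split[of d e] by (metis bij_pointE)
    show "Poly_Mapping.lookup (fst p) i = Poly_Mapping.lookup (fst q) i"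
      using arg_cong[OF eq, of "\<lambda>x. Poly_Mapping.lookup x n"] by (simp add: lookup_merge n)
  next
    fix i
    obtain n where n: "coordinate_split d e n = Inr i"
      using bij_coordinate_split[of d e] by (metis bij_pointE)
    show "Poly_Mapping.lookup (snd p) i = Poly_Mapping.lookup (snd q) i"
      using arg_cong[OF eq, of "\<lambda>x. Poly_Mapping.lookup x n"] by (simp add: lookup_merge n)
  qed
qed

lemma standard_cube_merge:
  "merge d e ` (standard_cube d \<times> standard_cube e) = standard_cube (d + e)"
proof
  show "merge d e ` (standard_cube d \<times> standard_cube e) \<subseteq> standard_cube (d + e)"
    by (auto simp: standard_cube_def lookup_merge coordinate_split_def)
  show "standard_cube (d + e) \<subseteq> merge d e ` (standard_cube d \<times> standard_cube e)"
  proof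
    fix z assume z: "z \<in> standard_cube (d + e)"
    obtain x where x: "\<And>i. Poly_Mapping.lookup x i = (if i < d then Poly_Mapping.lookup z i else 0)"
      using poly_mapping_real_of_fun[of "{..<d}" "\<lambda>i. if i < d then Poly_Mapping.lookup z i else 0"] by auto
    obtain y where y: "\<And>i. Poly_Mapping.lookup y i = (if i < e then Poly_Mapping.lookup z (d + i) else 0)"
      using poly_mapping_real_of_fun[of "{..<e}" "\<lambda>i. if i < e then Poly_Mapping.lookup z (d + i) else 0"] by auto
    have "z = merge d e (x, y)"
      using z by (intro poly_mapping_eqI) (auto simp: lookup_merge x y coordinate_split_def standard_cube_def)
    moreover have "x \<in> standard_cube d" "y \<in> standard_cube e"
      using z by (auto simp: standard_cube_def x y)
    ultimately show "z \<in> merge d e ` (standard_cube d \<times> standard_cube e)" by blast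
  qed
qed

lemma has_aff_dim_nonempty:
  assumes "has_aff_dim d S" shows "S \<noteq> {}"
proof
  assume "S = {}"
  then obtain B :: "'a set" where "affine hull B = {}" "card B = d + 1"
    using assms unfolding has_aff_dim_def by auto
  then show False by simp
qed

lemma combinatorial_cube_merge:
  assumes C: "combinatorial_cube d C" and D: "combinatorial_cube e D"
  shows "combinatorial_cube (d + e) (merge d e ` (C \<times> D))"
proof -
  note h = linear_merge[of d e] inj_merge[of d e]
  have "polytope (merge d e ` (C \<times> D))"
    using C D by (intro polytope_linear_image h polytope_Times) (auto simp: combinatorial_cube_def)
  moreover have "has_aff_dim (d + e) (merge d e ` (C \<times> D))"
    using C D by (intro has_aff_dim_linear_image h has_aff_dim_Times)
      (auto simp: combinatorial_cube_def dest: has_aff_dim_nonempty)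
  moreover have "face_lattice_isomorphic (merge d e ` (C \<times> D)) (standard_cube (d + e))"
  proof -
    have 1: "face_lattice_isomorphic (merge d e ` (C \<times> D)) (C \<times> D)"
      by (rule face_lattice_isomorphic_sym[OF face_lattice_isomorphic_linear_image[OF h]])
    have 2: "face_lattice_isomorphic (C \<times> D) (standard_cube d \<times> standard_cube e)"
      using C D by (intro face_lattice_isomorphic_Times) (auto simp: combinatorial_cube_def)
    have 3: "face_lattice_isomorphic (standard_cube d \<times> standard_cube e) (standard_cube (d + e))"
      using face_lattice_isomorphic_linear_image[OF h] standard_cube_merge by metis
    show ?thesis using face_lattice_isomorphic_trans[OF 1 face_lattice_isomorphic_trans[OF 2 3]] .
  qed
  ultimately show ?thesis by (simp add: combinatorial_cube_def)
qed

text \<open>The labels are fixed to be natural numbers, whose order the staircases use. A lower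
  bound n replaces the exact number because \<open>card_staircases\<close> is an inequality.\<close>

definition has_cube_triangulation :: "nat \<Rightarrow> nat \<Rightarrow> bool" where
  "has_cube_triangulation d n \<longleftrightarrow>
     (\<exists>C v (\<F> :: nat set set). combinatorial_cube d C \<and> simplicial d C v \<F> \<and> n \<le> card \<F>)"

lemma has_cube_triangulation_max:
  assumes "has_cube_triangulation d n"
  shows "n \<le> max_cube_triangulation d"
proof -
  obtain C v and \<F> :: "nat set set" where C: "combinatorial_cube d C" "simplicial d C v \<F>" "n \<le> card \<F>"
    using assms unfolding has_cube_triangulation_def by blast
  have "card ((\<lambda>\<sigma>. convex hull (v ` \<sigma>)) ` \<F>) \<le> max_cube_triangulation d"
    using max_cube_triangulation_ge[OF C(1) simplicial_triangulation(1)[OF C(2)]] .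
  then show ?thesis using C(3) by (simp add: card_image simplicial_triangulation(2)[OF C(2)])
qed

lemma has_cube_triangulation_product:
  assumes "has_cube_triangulation d m" "has_cube_triangulation e n"
  shows "has_cube_triangulation (d + e) (((d + e) choose d) * m * n)"
proof -
  obtain C v and \<F> :: "nat set set" where C: "combinatorial_cube d C" "simplicial d C v \<F>" "m \<le> card \<F>"
    using assms(1) unfolding has_cube_triangulation_def by blast
  obtain D w and \<G> :: "nat set set" where D: "combinatorial_cube e D" "simplicial e D w \<G>" "n \<le> card \<G>"
    using assms(2) unfolding has_cube_triangulation_def by blast
  have S: "simplicial (d + e) (merge d e ` (C \<times> D)) (merge d e \<circ> map_prod v w) (staircases d e \<F> \<G>)"
    by (intro simplicial_linear_image simplicial_product C D linear_merge inj_merge)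
  have "((d + e) choose d) * m * n \<le> ((d + e) choose d) * card \<F> * card \<G>"
    using C D by (intro mult_mono) auto
  also have "\<dots> \<le> card (staircases d e \<F> \<G>)"
    using simplicialD(1,2)[OF C(2)] simplicialD(1,2)[OF D(2)] by (intro card_staircases) blast+
  \<comment> \<open>\<open>prod_encode\<close> turns pairs of labels back into natural
    numbers.\<close>
  finally have "((d + e) choose d) * m * n \<le> card ((`) prod_encode ` staircases d e \<F> \<G>)"
    using simplicial_relabel(2)[OF S bij_prod_encode] by simp
  then show ?thesis
    using combinatorial_cube_merge[OF C(1) D(1)] simplicial_relabel(1)[OF S bij_prod_encode]
    unfolding has_cube_triangulation_def by blast
qed

section \<open>A combinatorial 3-cube with seven simplices\<close>

text \<open>If l alone lies on all facets in \<open>J\<close>, their common face is the hull of the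
  single point \<open>v l\<close>.\<close>

lemma facet_description_vertex:
  assumes D: "facet_description P L v I f E" and J: "J \<subseteq> I" and l: "{k \<in> L. \<forall>i\<in>J. k \<in> E i} = {l}"
  shows "v l \<in> vertices P"
proof -
  define F where "F = {x \<in> P. \<forall>i\<in>J. f i x = 0}"
  have F: "F face_of P" "face_labels L v F = {l}"
    using facet_description_face[OF D J] l unfolding F_def by simp_all
  have "F = convex hull (v ` L \<inter> F)"
    using F(1) facet_descriptionD(1,3)[OF D] by (intro face_of_convex_hull_finite) auto
  also have "v ` L \<inter> F = v ` face_labels L v F" by (auto simp: face_labels_def)
  finally have "F = {v l}" by (simp add: F(2))
  then show ?thesis using F(1) by (simp add: vertices_def face_of_singleton)
qed

lemma Collect_eq_singletonI:
  assumes "l \<in> L" "\<And>m. m \<in> L \<Longrightarrow> Q m \<longleftrightarrow> m = l"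
  shows "{m \<in> L. Q m} = {l}"
  using assms by blast

text \<open>The label \<open>4 a + 2 b + c\<close> stands for the vertex of the cube with binary coordinates
  \<open>(a, b, c)\<close>. For \<open>k = 0\<close> the polytope is the unit cube, for \<open>k = 1\<close> the top facet is tilted
  from \<open>z = 1\<close> to \<open>z = 2 - x\<close>.\<close>

definition prism :: "real \<Rightarrow> (real \<times> real \<times> real) set" where
  "prism k = {(x, y, z). 0 \<le> x \<and> x \<le> 1 \<and> 0 \<le> y \<and> y \<le> 1 \<and> 0 \<le> z \<and> z \<le> 1 + k - k * x}"

definition prism_vertex :: "real \<Rightarrow> nat \<Rightarrow> real \<times> real \<times> real" where
  "prism_vertex k l = [(0, 0, 0), (0, 0, 1 + k), (0, 1, 0), (0, 1, 1 + k),
     (1, 0, 0), (1, 0, 1), (1, 1, 0), (1, 1, 1)] ! l"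

definition prism_facet :: "real \<Rightarrow> nat \<Rightarrow> real \<times> real \<times> real \<Rightarrow> real" where
  "prism_facet k i = [\<lambda>(x, y, z). x, \<lambda>(x, y, z). 1 - x, \<lambda>(x, y, z). y, \<lambda>(x, y, z). 1 - y,
     \<lambda>(x, y, z). z, \<lambda>(x, y, z). 1 + k - k * x - z] ! i"

definition prism_incidence :: "nat \<Rightarrow> nat set" where
  "prism_incidence i = [{0, 1, 2, 3}, {4, 5, 6, 7}, {0, 1, 4, 5}, {2, 3, 6, 7}, {0, 2, 4, 6}, {1, 3, 5, 7}] ! i"

abbreviation "prism_labels \<equiv> {0, 1, 2, 3, 4, 5, 6, 7 :: nat}"
abbreviation "prism_facets \<equiv> {0, 1, 2, 3, 4, 5 :: nat}"

lemma convex_sum_nth: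
  fixes S :: "'a::real_vector set"
  assumes "convex S" "length xs = length as" "\<And>i. i < length as \<Longrightarrow> xs ! i \<in> S"
    "\<And>i. i < length as \<Longrightarrow> 0 \<le> as ! i" "(\<Sum>i<length as. as ! i) = 1"
  shows "(\<Sum>i<length as. as ! i *\<^sub>R xs ! i) \<in> S"
  using assms by (intro convex_sum) auto

text \<open>Each point is reached by three interpolations: along x on the four edges that join x = 0
  to x = 1, the upper ones having height affine in x, then along y, then along z.\<close>

lemma prism_hull:
  assumes "0 \<le> k"
  shows "convex hull (prism_vertex k ` prism_labels) = prism k"
proof
  have "convex (prism k)"
  proof -
    have "prism k = {0..1} \<times> {0..1} \<times> UNIV \<inter> {p. 0 \<le> snd (snd p)} \<inter> {p. snd (snd p) + k * fst p \<le> 1 + k}"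
      by (auto simp: prism_def)
    moreover have "convex ({0..1::real} \<times> {0..1::real} \<times> (UNIV :: real set))"
      by (intro convex_Times convex_UNIV) auto
    moreover have "convex {p :: real \<times> real \<times> real. 0 \<le> snd (snd p)}"
      by (intro convexI) auto
    moreover have "convex {p :: real \<times> real \<times> real. snd (snd p) + k * fst p \<le> 1 + k}"
    proof (rule convexI, unfold mem_Collect_eq)
      fix p q :: "real \<times> real \<times> real" and s t :: real
      assume *: "snd (snd p) + k * fst p \<le> 1 + k" "snd (snd q) + k * fst q \<le> 1 + k" "0 \<le> s" "0 \<le> t" "s + t = 1"
      have "s * (snd (snd p) + k * fst p) + t * (snd (snd q) + k * fst q) \<le> s * (1 + k) + t * (1 + k)"
        using add_mono[OF mult_left_mono[OF *(1,3)] mult_left_mono[OF *(2,4)]] .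
      also have "\<dots> = 1 + k" using *(5) by (simp flip: distrib_right)
      finally show "snd (snd (s *\<^sub>R p + t *\<^sub>R q)) + k * fst (s *\<^sub>R p + t *\<^sub>R q) \<le> 1 + k"
        by (simp add: algebra_simps)
    qed
    ultimately show ?thesis by (simp add: convex_Int)
  qed
  then show "convex hull (prism_vertex k ` prism_labels) \<subseteq> prism k"
    using assms by (intro hull_minimal) (auto simp: prism_def prism_vertex_def)
  show "prism k \<subseteq> convex hull (prism_vertex k ` prism_labels)"
  proof clarify
    fix x y z assume p: "(x, y, z) \<in> prism k"
    \<comment> \<open>\<open>h\<close> is the height of the top facet above x; being at least 1, it
      may serve as the denominator of the relative height \<open>t\<close>.\<close>
    define h where "h = 1 + k - k * x"
    have "k * x \<le> k * 1" using p assms by (intro mult_left_mono) (auto simp: prism_def)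
    then have h: "1 \<le> h" by (simp add: h_def)
    define t where "t = z / h"
    have xyt: "0 \<le> x" "0 \<le> 1 - x" "0 \<le> y" "0 \<le> 1 - y" "0 \<le> t" "0 \<le> 1 - t"
      using p h by (auto simp: prism_def t_def h_def field_simps)
    define H where "H = convex hull (prism_vertex k ` prism_labels)"
    have mix: "(1 - u) *\<^sub>R p + u *\<^sub>R q \<in> H" if "p \<in> H" "q \<in> H" "0 \<le> u" "0 \<le> 1 - u" for u p q
      using that unfolding H_def by (intro convexD_alt convex_convex_hull) auto
    have "prism_vertex k l \<in> H" if "l \<in> prism_labels" for l
      unfolding H_def using that by (intro hull_inc imageI)
    from this[of 0] this[of 1] this[of 2] this[of 3] this[of 4] this[of 5] this[of 6] this[of 7]
    have V: "(0, 0, 0) \<in> H" "(0, 0, 1 + k) \<in> H" "(0, 1, 0) \<in> H" "(0, 1, 1 + k) \<in> H"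
        "(1, 0, 0) \<in> H" "(1, 0, 1) \<in> H" "(1, 1, 0) \<in> H" "(1, 1, 1) \<in> H"
      by (simp_all add: prism_vertex_def)
    have "(x, 0, 0) \<in> H" "(x, 1, 0) \<in> H" "(x, 0, h) \<in> H" "(x, 1, h) \<in> H"
      using mix[OF V(1,5) xyt(1,2)] mix[OF V(3,7) xyt(1,2)] mix[OF V(2,6) xyt(1,2)] mix[OF V(4,8) xyt(1,2)]
      by (simp_all add: h_def algebra_simps)
    from mix[OF this(1,2) xyt(3,4)] mix[OF this(3,4) xyt(3,4)]
    have "(x, y, 0) \<in> H" "(x, y, h) \<in> H" by (simp_all add: algebra_simps)
    from mix[OF this xyt(5,6)] have "(x, y, z) \<in> H"
      using h by (simp add: t_def algebra_simps)
    then show "(x, y, z) \<in> convex hull (prism_vertex k ` prism_labels)" by (simp add: H_def)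
  qed
qed

lemma prism_facet_description:
  assumes "0 \<le> k"
  shows "facet_description (prism k) prism_labels (prism_vertex k) prism_facets (prism_facet k) prism_incidence"
  unfolding facet_description_def
proof (intro conjI)
  show "prism k = convex hull (prism_vertex k ` prism_labels)" using prism_hull[OF assms] by simp
  show "prism k = {x. \<forall>i\<in>prism_facets. 0 \<le> prism_facet k i x}"
    by (auto simp: prism_def prism_facet_def)
  show "\<forall>i\<in>prism_facets. \<forall>x y s t. s + t = 1 \<longrightarrow>
      prism_facet k i (s *\<^sub>R x + t *\<^sub>R y) = s * prism_facet k i x + t * prism_facet k i y"
  proof (intro ballI allI impI)
    fix i and p q :: "real \<times> real \<times> real" and s t :: real assume i: "i \<in> prism_facets" and st: "s + t = 1"
    obtain x y z x' y' z' where pq: "p = (x, y, z)" "q = (x', y', z')" by (metis prod_cases3)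
    have s: "s = 1 - t" using st by simp
    show "prism_facet k i (s *\<^sub>R p + t *\<^sub>R q) = s * prism_facet k i p + t * prism_facet k i q"
      using i unfolding pq s by (auto simp: prism_facet_def algebra_simps)
  qed
  show "\<forall>i\<in>prism_facets. \<forall>l\<in>prism_labels. prism_facet k i (prism_vertex k l) = 0 \<longleftrightarrow> l \<in> prism_incidence i"
    using assms by (simp add: prism_facet_def prism_vertex_def prism_incidence_def)
  show "finite prism_labels" "finite prism_facets" by simp_all
qed

lemma prism_vertices:
  assumes "0 \<le> k" "l \<in> prism_labels"
  shows "prism_vertex k l \<in> vertices (prism k)"
proof -
  \<comment> \<open>The three facets through vertex l, one for each coordinate: 0 or 1 for x, 2 or 3
    for y, 4 or 5 for z.\<close>
  define J where "J = [{0, 2, 4}, {0, 2, 5}, {0, 3, 4}, {0, 3, 5}, {1, 2, 4}, {1, 2, 5}, {1, 3, 4}, {1, 3, 5 :: nat}] ! l"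
  have "J \<subseteq> prism_facets" using assms(2) unfolding J_def by (elim insertE) simp_all
  have labels: "\<forall>m\<in>prism_labels. (\<forall>i\<in>J. m \<in> prism_incidence i) \<longleftrightarrow> m = l"
    using assms(2) unfolding J_def by (elim insertE) (simp_all add: prism_incidence_def)
  have "{m \<in> prism_labels. \<forall>i\<in>J. m \<in> prism_incidence i} = {l}"
  proof (rule Collect_eq_singletonI[OF assms(2)])
    show "(\<forall>i\<in>J. m \<in> prism_incidence i) \<longleftrightarrow> m = l" if "m \<in> prism_labels" for m
      by (rule bspec[OF labels that])
  qed
  then show ?thesis
    by (rule facet_description_vertex[OF prism_facet_description[OF assms(1)] \<open>J \<subseteq> prism_facets\<close>])
qed

text \<open>In units of 1/6 the tilted prism has volume 9. The tetrahedra {0, 1, 2, 5} and {1, 2, 3,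
  6}, which contain the vertical edges of length 2, have volume 2, and the other five have volume
  1.\<close>

definition seven_simplices :: "nat set set" where
  "seven_simplices = {{0, 1, 2, 5}, {0, 2, 5, 6}, {0, 4, 5, 6}, {1, 2, 3, 6}, {1, 2, 5, 6},
     {1, 3, 5, 6}, {3, 5, 6, 7}}"

lemma card_seven_simplices: "7 \<le> card seven_simplices"
proof -
  \<comment> \<open>Each set is read as a binary number; seven different numbers come from at least
    seven sets.\<close>
  have "(\<lambda>\<sigma>. \<Sum>l\<in>\<sigma>. (2::nat) ^ l) ` seven_simplices = {39, 101, 113, 78, 102, 106, 232}"
    by (simp add: seven_simplices_def)
  moreover have "finite seven_simplices" by (simp add: seven_simplices_def)
  ultimately show ?thesis
    using card_image_le[of seven_simplices "\<lambda>\<sigma>. \<Sum>l\<in>\<sigma>. (2::nat) ^ l"] by simp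
qed

lemma convex_hull_4I:
  fixes p q r s :: "'a::real_vector"
  assumes "0 \<le> a" "0 \<le> b" "0 \<le> c" "0 \<le> d" "a + b + c + d = 1"
    and "x = a *\<^sub>R p + b *\<^sub>R q + c *\<^sub>R r + d *\<^sub>R s"
  shows "x \<in> convex hull {p, q, r, s}"
proof -
  have "(\<Sum>i<length [a, b, c, d]. [a, b, c, d] ! i *\<^sub>R [p, q, r, s] ! i) \<in> convex hull {p, q, r, s}"
  proof (rule convex_sum_nth[OF convex_convex_hull])
    show "[p, q, r, s] ! i \<in> convex hull {p, q, r, s}" if "i < length [a, b, c, d]" for i
      using nth_mem[of i "[p, q, r, s]"] that by (intro hull_inc) auto
    show "0 \<le> [a, b, c, d] ! i" if "i < length [a, b, c, d]" for i
      using nth_mem[of i "[a, b, c, d]"] that assms by auto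
  qed (use assms in \<open>auto simp: lessThan_Suc numeral_eq_Suc\<close>)
  then show ?thesis using assms(6) by (simp add: lessThan_Suc numeral_eq_Suc add.assoc add.commute add.left_commute)
qed

text \<open>A tetrahedron is cut out by the signs of its four barycentric coordinates, which are the
  coefficients handed to \<open>convex_hull_4I\<close>.\<close>

lemma seven_simplices_cover:
  "prism 1 = (\<Union>\<sigma>\<in>seven_simplices. convex hull (prism_vertex 1 ` \<sigma>))"
proof
  show "(\<Union>\<sigma>\<in>seven_simplices. convex hull (prism_vertex 1 ` \<sigma>)) \<subseteq> prism 1"
  proof (rule UN_least)
    fix \<sigma> assume "\<sigma> \<in> seven_simplices"
    then have "\<sigma> \<subseteq> prism_labels" by (auto simp: seven_simplices_def)
    then have "convex hull (prism_vertex 1 ` \<sigma>) \<subseteq> convex hull (prism_vertex 1 ` prism_labels)"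
      by (intro hull_mono image_mono)
    then show "convex hull (prism_vertex 1 ` \<sigma>) \<subseteq> prism 1" using prism_hull[of 1] by simp
  qed
  show "prism 1 \<subseteq> (\<Union>\<sigma>\<in>seven_simplices. convex hull (prism_vertex 1 ` \<sigma>))"
  proof clarify
    fix x y z assume "(x, y, z) \<in> prism 1"
    then have p: "0 \<le> x" "x \<le> 1" "0 \<le> y" "y \<le> 1" "0 \<le> z" "x + z \<le> 2" by (auto simp: prism_def)
    \<comment> \<open>Each case lists the sign conditions of one tetrahedron that do not already
      follow from the inequalities of the prism; that every point satisfies one of the lists is
      linear arithmetic.\<close>
    have "\<exists>\<sigma>\<in>seven_simplices. (x, y, z) \<in> convex hull (prism_vertex 1 ` \<sigma>)"
    proof -
      consider "3 \<le> 2 * x + y + z" | "2 * x + y + z \<le> 3" "2 \<le> x + y + z" "2 \<le> 2 * x + z"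
        | "2 * x + z \<le> 2" "2 \<le> 2 * y + z" | "y + z \<le> x" | "y + z \<le> 1" "x \<le> y + z" "z \<le> x"
        | "1 \<le> y + z" "x + y + z \<le> 2" "2 * y + z \<le> 2" "2 \<le> x + 2 * y + z"
        | "x + 2 * y + z \<le> 2" "x \<le> z"
        using p by linarith
      then show ?thesis
      proof cases
        case 1
        have "(x, y, z) \<in> convex hull {(0, 1, 2), (1, 0, 1), (1, 1, 0), (1, 1, 1)}"
          by (rule convex_hull_4I[of "1 - x" "1 - y" "2 - x - z" "2 * x + y + z - 3"]) (use p 1 in simp_all)
        then have "(x, y, z) \<in> convex hull (prism_vertex 1 ` {3, 5, 6, 7})"
          by (simp add: prism_vertex_def)
        then show ?thesis by (rule bexI) (simp add: seven_simplices_def)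
      next
        case 2
        have "(x, y, z) \<in> convex hull {(0, 0, 2), (0, 1, 2), (1, 0, 1), (1, 1, 0)}"
          by (rule convex_hull_4I[of "3 - 2 * x - y - z" "x + y + z - 2" "2 * x + z - 2" "2 - x - z"]) (use p 2 in simp_all)
        then have "(x, y, z) \<in> convex hull (prism_vertex 1 ` {1, 3, 5, 6})"
          by (simp add: prism_vertex_def)
        then show ?thesis by (rule bexI) (simp add: seven_simplices_def)
      next
        case 3
        have "(x, y, z) \<in> convex hull {(0, 0, 2), (0, 1, 0), (0, 1, 2), (1, 1, 0)}"
          by (rule convex_hull_4I[of "1 - y" "1 - x - z / 2" "y + z / 2 - 1" x]) (use p 3 in simp_all)
        then have "(x, y, z) \<in> convex hull (prism_vertex 1 ` {1, 2, 3, 6})"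
          by (simp add: prism_vertex_def)
        then show ?thesis by (rule bexI) (simp add: seven_simplices_def)
      next
        case 4
        have "(x, y, z) \<in> convex hull {(0, 0, 0), (1, 0, 0), (1, 0, 1), (1, 1, 0)}"
          by (rule convex_hull_4I[of "1 - x" "x - y - z" z y]) (use p 4 in simp_all)
        then have "(x, y, z) \<in> convex hull (prism_vertex 1 ` {0, 4, 5, 6})"
          by (simp add: prism_vertex_def)
        then show ?thesis by (rule bexI) (simp add: seven_simplices_def)
      next
        case 5
        have "(x, y, z) \<in> convex hull {(0, 0, 0), (0, 1, 0), (1, 0, 1), (1, 1, 0)}"
          by (rule convex_hull_4I[of "1 - y - z" "y + z - x" z "x - z"]) (use p 5 in simp_all)
        then have "(x, y, z) \<in> convex hull (prism_vertex 1 ` {0, 2, 5, 6})"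
          by (simp add: prism_vertex_def)
        then show ?thesis by (rule bexI) (simp add: seven_simplices_def)
      next
        case 6
        have "(x, y, z) \<in> convex hull {(0, 0, 2), (0, 1, 0), (1, 0, 1), (1, 1, 0)}"
          by (rule convex_hull_4I[of "y + z - 1" "2 - x - y - z" "2 - 2 * y - z" "x + 2 * y + z - 2"]) (use p 6 in simp_all)
        then have "(x, y, z) \<in> convex hull (prism_vertex 1 ` {1, 2, 5, 6})"
          by (simp add: prism_vertex_def)
        then show ?thesis by (rule bexI) (simp add: seven_simplices_def)
      next
        case 7
        have "(x, y, z) \<in> convex hull {(0, 0, 0), (0, 0, 2), (0, 1, 0), (1, 0, 1)}"
          by (rule convex_hull_4I[of "1 - x / 2 - y - z / 2" "z / 2 - x / 2" y x]) (use p 7 in simp_all)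
        then have "(x, y, z) \<in> convex hull (prism_vertex 1 ` {0, 1, 2, 5})"
          by (simp add: prism_vertex_def)
        then show ?thesis by (rule bexI) (simp add: seven_simplices_def)
      qed
    qed
    then show "(x, y, z) \<in> (\<Union>\<sigma>\<in>seven_simplices. convex hull (prism_vertex 1 ` \<sigma>))"
      by (simp only: UN_iff)
  qed
qed

text \<open>The triangulation is the lower hull of the lifting of the vertices to these heights, found by
  computer search: among the weights with a given barycenter, those supported on one of the seven
  simplices are the unique minimizers of the lifted height.\<close>

definition lifted_height :: "(nat \<Rightarrow> real) \<Rightarrow> real" where
  "lifted_height u = 5 * u 0 + 4 * u 1 + u 2 + 5 * u 3 + 6 * u 4 + 3 * u 5 + u 6 + 5 * u 7"

text \<open>The equations come from the coordinates x, y, z of the barycenter and from the total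
  mass, in this order.\<close>

lemma prism_barycenter_eq:
  assumes "u \<in> weights prism_labels" "u' \<in> weights prism_labels"
    and "(\<Sum>l\<in>prism_labels. u l *\<^sub>R prism_vertex 1 l) = (\<Sum>l\<in>prism_labels. u' l *\<^sub>R prism_vertex 1 l)"
  shows "u 4 + u 5 + u 6 + u 7 = u' 4 + u' 5 + u' 6 + u' 7"
    "u 2 + u 3 + u 6 + u 7 = u' 2 + u' 3 + u' 6 + u' 7"
    "2 * u 1 + 2 * u 3 + u 5 + u 7 = 2 * u' 1 + 2 * u' 3 + u' 5 + u' 7"
    "u 0 + u 1 + u 2 + u 3 + u 4 + u 5 + u 6 + u 7 = u' 0 + u' 1 + u' 2 + u' 3 + u' 4 + u' 5 + u' 6 + u' 7"
proof -
  show "u 4 + u 5 + u 6 + u 7 = u' 4 + u' 5 + u' 6 + u' 7"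
    "u 2 + u 3 + u 6 + u 7 = u' 2 + u' 3 + u' 6 + u' 7"
    "2 * u 1 + 2 * u 3 + u 5 + u 7 = 2 * u' 1 + 2 * u' 3 + u' 5 + u' 7"
    using assms(3) by (simp_all add: prism_vertex_def algebra_simps)
  show "u 0 + u 1 + u 2 + u 3 + u 4 + u 5 + u 6 + u 7 = u' 0 + u' 1 + u' 2 + u' 3 + u' 4 + u' 5 + u' 6 + u' 7"
    using weightsD(3)[OF assms(1)] weightsD(3)[OF assms(2)] by (simp add: algebra_simps)
qed

text \<open>For each of the seven simplices the affine function interpolating the heights at its
  four vertices lies strictly below the heights at the other four. Hence the height of u' minus that
  of u is a combination, with positive coefficients, of the weights of u' off
  \<open>\<sigma>\<close>. Equal heights put u' on \<open>\<sigma>\<close>, where the four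
  barycenter equations determine the weights.\<close>

lemma seven_simplices_lower_hull:
  assumes \<sigma>: "\<sigma> \<in> seven_simplices" "u \<in> weights \<sigma>" and u': "u' \<in> weights prism_labels"
    and eq: "(\<Sum>l\<in>prism_labels. u l *\<^sub>R prism_vertex 1 l) = (\<Sum>l\<in>prism_labels. u' l *\<^sub>R prism_vertex 1 l)"
  shows "lifted_height u \<le> lifted_height u'" "lifted_height u = lifted_height u' \<Longrightarrow> u = u'"
proof -
  have sub: "\<sigma> \<subseteq> prism_labels" using \<sigma>(1) by (auto simp: seven_simplices_def)
  have u: "u \<in> weights prism_labels" using weights_mono[OF \<sigma>(2) _ sub] by simp
  note eqs = prism_barycenter_eq[OF u u' eq]
  have nonneg: "0 \<le> u' 0" "0 \<le> u' 1" "0 \<le> u' 2" "0 \<le> u' 3" "0 \<le> u' 4" "0 \<le> u' 5" "0 \<le> u' 6" "0 \<le> u' 7"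
    using weightsD(1)[OF u'] by simp_all
  have "u l = 0" if "l \<notin> \<sigma>" for l using weightsD(2)[OF \<sigma>(2) that] .
  \<comment> \<open>One case for each simplex, listing the four labels missing from it.\<close>
  then consider "u 3 = 0" "u 4 = 0" "u 6 = 0" "u 7 = 0" | "u 1 = 0" "u 3 = 0" "u 4 = 0" "u 7 = 0"
    | "u 1 = 0" "u 2 = 0" "u 3 = 0" "u 7 = 0" | "u 0 = 0" "u 4 = 0" "u 5 = 0" "u 7 = 0"
    | "u 0 = 0" "u 3 = 0" "u 4 = 0" "u 7 = 0" | "u 0 = 0" "u 2 = 0" "u 4 = 0" "u 7 = 0"
    | "u 0 = 0" "u 1 = 0" "u 2 = 0" "u 4 = 0"
    using \<sigma>(1) unfolding seven_simplices_def by (elim insertE) simp_all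
  then have main: "lifted_height u \<le> lifted_height u' \<and> (lifted_height u = lifted_height u' \<longrightarrow>
      u 0 = u' 0 \<and> u 1 = u' 1 \<and> u 2 = u' 2 \<and> u 3 = u' 3 \<and> u 4 = u' 4 \<and> u 5 = u' 5 \<and> u 6 = u' 6 \<and> u 7 = u' 7)"
  proof cases
    case 1
    \<comment> \<open>The coefficient of a label is its height minus the value, at that vertex, of
      the affine function through the lifted vertices of the simplex. The same recipe gives the
      slack in the other cases.\<close>
    have slack: "lifted_height u' - lifted_height u = 5 * u' 3 + 5 / 2 * u' 4 + 3 / 2 * u' 6 + 6 * u' 7"
      using eqs 1 unfolding lifted_height_def by linarith
    have le: "lifted_height u \<le> lifted_height u'"
      using slack nonneg by linarith
    have "u' 3 = 0" "u' 4 = 0" "u' 6 = 0" "u' 7 = 0" if "lifted_height u = lifted_height u'"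
      using that slack nonneg by linarith+
    then have "u 0 = u' 0 \<and> u 1 = u' 1 \<and> u 2 = u' 2 \<and> u 3 = u' 3 \<and> u 4 = u' 4 \<and> u 5 = u' 5 \<and> u 6 = u' 6 \<and> u 7 = u' 7"
      if "lifted_height u = lifted_height u'"
      using that eqs 1 by (intro conjI; linarith)
    with le show ?thesis by blast
  next
    case 2
    have slack: "lifted_height u' - lifted_height u = 3 * u' 1 + 8 * u' 3 + u' 4 + 6 * u' 7"
      using eqs 2 unfolding lifted_height_def by linarith
    have le: "lifted_height u \<le> lifted_height u'"
      using slack nonneg by linarith
    have "u' 1 = 0" "u' 3 = 0" "u' 4 = 0" "u' 7 = 0" if "lifted_height u = lifted_height u'"
      using that slack nonneg by linarith+
    then have "u 0 = u' 0 \<and> u 1 = u' 1 \<and> u 2 = u' 2 \<and> u 3 = u' 3 \<and> u 4 = u' 4 \<and> u 5 = u' 5 \<and> u 6 = u' 6 \<and> u 7 = u' 7"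
      if "lifted_height u = lifted_height u'"
      using that eqs 2 by (intro conjI; linarith)
    with le show ?thesis by blast
  next
    case 3
    have slack: "lifted_height u' - lifted_height u = 5 * u' 1 + u' 2 + 11 * u' 3 + 7 * u' 7"
      using eqs 3 unfolding lifted_height_def by linarith
    have le: "lifted_height u \<le> lifted_height u'"
      using slack nonneg by linarith
    have "u' 1 = 0" "u' 2 = 0" "u' 3 = 0" "u' 7 = 0" if "lifted_height u = lifted_height u'"
      using that slack nonneg by linarith+
    then have "u 0 = u' 0 \<and> u 1 = u' 1 \<and> u 2 = u' 2 \<and> u 3 = u' 3 \<and> u 4 = u' 4 \<and> u 5 = u' 5 \<and> u 6 = u' 6 \<and> u 7 = u' 7"
      if "lifted_height u = lifted_height u'"
      using that eqs 3 by (intro conjI; linarith)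
    with le show ?thesis by blast
  next
    case 4
    have slack: "lifted_height u' - lifted_height u = 5 * u' 0 + 6 * u' 4 + u' 5 + 2 * u' 7"
      using eqs 4 unfolding lifted_height_def by linarith
    have le: "lifted_height u \<le> lifted_height u'"
      using slack nonneg by linarith
    have "u' 0 = 0" "u' 4 = 0" "u' 5 = 0" "u' 7 = 0" if "lifted_height u = lifted_height u'"
      using that slack nonneg by linarith+
    then have "u 0 = u' 0 \<and> u 1 = u' 1 \<and> u 2 = u' 2 \<and> u 3 = u' 3 \<and> u 4 = u' 4 \<and> u 5 = u' 5 \<and> u 6 = u' 6 \<and> u 7 = u' 7"
      if "lifted_height u = lifted_height u'"
      using that eqs 4 by (intro conjI; linarith)
    with le show ?thesis by blast
  next
    case 5
    have slack: "lifted_height u' - lifted_height u = 3 * u' 0 + 2 * u' 3 + 4 * u' 4 + 3 * u' 7"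
      using eqs 5 unfolding lifted_height_def by linarith
    have le: "lifted_height u \<le> lifted_height u'"
      using slack nonneg by linarith
    have "u' 0 = 0" "u' 3 = 0" "u' 4 = 0" "u' 7 = 0" if "lifted_height u = lifted_height u'"
      using that slack nonneg by linarith+
    then have "u 0 = u' 0 \<and> u 1 = u' 1 \<and> u 2 = u' 2 \<and> u 3 = u' 3 \<and> u 4 = u' 4 \<and> u 5 = u' 5 \<and> u 6 = u' 6 \<and> u 7 = u' 7"
      if "lifted_height u = lifted_height u'"
      using that eqs 5 by (intro conjI; linarith)
    with le show ?thesis by blast
  next
    case 6
    have slack: "lifted_height u' - lifted_height u = 7 * u' 0 + 2 * u' 2 + 6 * u' 4 + u' 7"
      using eqs 6 unfolding lifted_height_def by linarith
    have le: "lifted_height u \<le> lifted_height u'"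
      using slack nonneg by linarith
    have "u' 0 = 0" "u' 2 = 0" "u' 4 = 0" "u' 7 = 0" if "lifted_height u = lifted_height u'"
      using that slack nonneg by linarith+
    then have "u 0 = u' 0 \<and> u 1 = u' 1 \<and> u 2 = u' 2 \<and> u 3 = u' 3 \<and> u 4 = u' 4 \<and> u 5 = u' 5 \<and> u 6 = u' 6 \<and> u 7 = u' 7"
      if "lifted_height u = lifted_height u'"
      using that eqs 6 by (intro conjI; linarith)
    with le show ?thesis by blast
  next
    case 7
    have slack: "lifted_height u' - lifted_height u = 10 * u' 0 + u' 1 + 4 * u' 2 + 7 * u' 4"
      using eqs 7 unfolding lifted_height_def by linarith
    have le: "lifted_height u \<le> lifted_height u'"
      using slack nonneg by linarith
    have "u' 0 = 0" "u' 1 = 0" "u' 2 = 0" "u' 4 = 0" if "lifted_height u = lifted_height u'"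
      using that slack nonneg by linarith+
    then have "u 0 = u' 0 \<and> u 1 = u' 1 \<and> u 2 = u' 2 \<and> u 3 = u' 3 \<and> u 4 = u' 4 \<and> u 5 = u' 5 \<and> u 6 = u' 6 \<and> u 7 = u' 7"
      if "lifted_height u = lifted_height u'"
      using that eqs 7 by (intro conjI; linarith)
    with le show ?thesis by blast
  qed
  show "lifted_height u \<le> lifted_height u'" using main by blast
  assume "lifted_height u = lifted_height u'"
  with main have "u l = u' l" if "l \<in> prism_labels" for l
    using that by auto
  moreover have "u l = u' l" if "l \<notin> prism_labels" for l
    using weightsD(2)[OF u that] weightsD(2)[OF u' that] by simp
  ultimately show "u = u'" by blast
qed

text \<open>Both weight functions minimize the lifted height over the same barycenter, so their
  heights agree and the equality case applies.\<close>

lemma seven_simplices_unique: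
  assumes \<sigma>: "\<sigma> \<in> seven_simplices" "u \<in> weights \<sigma>" and \<tau>: "\<tau> \<in> seven_simplices" "u' \<in> weights \<tau>"
    and eq: "(\<Sum>l\<in>\<sigma>. u l *\<^sub>R prism_vertex 1 l) = (\<Sum>l\<in>\<tau>. u' l *\<^sub>R prism_vertex 1 l)"
  shows "u = u'"
proof -
  have sub: "\<sigma> \<subseteq> prism_labels" "\<tau> \<subseteq> prism_labels"
    using \<sigma>(1) \<tau>(1) by (auto simp: seven_simplices_def)
  have w: "u \<in> weights prism_labels" "u' \<in> weights prism_labels"
    using weights_mono[OF \<sigma>(2) _ sub(1)] weights_mono[OF \<tau>(2) _ sub(2)] by simp_all
  have eq': "(\<Sum>l\<in>prism_labels. u l *\<^sub>R prism_vertex 1 l) = (\<Sum>l\<in>prism_labels. u' l *\<^sub>R prism_vertex 1 l)"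
    using eq sum_weights[OF \<sigma>(2) _ sub(1), of "prism_vertex 1"]
      sum_weights[OF \<tau>(2) _ sub(2), of "prism_vertex 1"]
    by (metis (no_types, lifting) finite.emptyI finite_insert)
  show ?thesis
    using seven_simplices_lower_hull[OF \<sigma> w(2) eq'] seven_simplices_lower_hull(1)[OF \<tau> w(1) eq'[symmetric]]
    by linarith
qed

lemma simplicial_seven: "simplicial 3 (prism 1) (prism_vertex 1) seven_simplices"
  unfolding simplicial_def
proof (intro conjI ballI impI)
  show "finite seven_simplices" by (simp add: seven_simplices_def)
  show "prism 1 = (\<Union>\<sigma>\<in>seven_simplices. convex hull (prism_vertex 1 ` \<sigma>))" by (rule seven_simplices_cover)
  fix \<sigma> assume \<sigma>: "\<sigma> \<in> seven_simplices"
  then show "finite \<sigma>" "card \<sigma> = 3 + 1" unfolding seven_simplices_def by (elim insertE; simp)+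
  have "\<sigma> \<subseteq> prism_labels" using \<sigma> unfolding seven_simplices_def by (elim insertE) simp_all
  then show "prism_vertex 1 ` \<sigma> \<subseteq> vertices (prism 1)"
    using prism_vertices[of 1] by (intro image_subsetI) (meson subsetD zero_le_one)
  fix \<tau> u u' assume \<tau>: "\<tau> \<in> seven_simplices" and u: "u \<in> weights \<sigma>" "u' \<in> weights \<tau>"
    "(\<Sum>l\<in>\<sigma>. u l *\<^sub>R prism_vertex 1 l) = (\<Sum>l\<in>\<tau>. u' l *\<^sub>R prism_vertex 1 l)"
  show "u = u'" by (rule seven_simplices_unique[OF \<sigma> u(1) \<tau> u(2,3)])
qed

section \<open>The lower bound\<close>

definition axis :: "nat \<Rightarrow> real \<Rightarrow> (nat \<Rightarrow>\<^sub>0 real)" where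
  "axis n x = Poly_Mapping.single n x"

lemma lookup_axis: "Poly_Mapping.lookup (axis n x) i = (if i = n then x else 0)"
  by (simp add: axis_def lookup_single when_def)

definition embed3 :: "real \<times> real \<times> real \<Rightarrow> (nat \<Rightarrow>\<^sub>0 real)" where
  "embed3 p = axis 0 (fst p) + axis 1 (fst (snd p)) + axis 2 (snd (snd p))"

lemma lookup_embed3:
  "Poly_Mapping.lookup (embed3 (x, y, z)) i = (if i = 0 then x else if i = 1 then y else if i = 2 then z else 0)"
  by (simp add: embed3_def lookup_add lookup_axis)

lemma linear_axis: "linear (axis n)"
  by (rule linearI; rule poly_mapping_eqI) (simp_all add: lookup_axis lookup_add lookup_scaleR)

lemma inj_axis: "inj (axis n)"
  by (rule injI) (metis lookup_axis)

lemma linear_embed3: "linear embed3"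
proof (rule linearI; rule poly_mapping_eqI)
  show "Poly_Mapping.lookup (embed3 (p + q)) i = Poly_Mapping.lookup (embed3 p + embed3 q) i" for p q i
    by (cases p; cases q) (simp add: lookup_embed3 lookup_add)
  show "Poly_Mapping.lookup (embed3 (r *\<^sub>R p)) i = Poly_Mapping.lookup (r *\<^sub>R embed3 p) i" for r p i
    by (cases p) (simp add: lookup_embed3 lookup_scaleR)
qed

lemma inj_embed3: "inj embed3"
proof (rule injI)
  fix p q assume eq: "embed3 p = embed3 q"
  obtain x y z x' y' z' where pq: "p = (x, y, z)" "q = (x', y', z')" by (metis prod_cases3)
  have "Poly_Mapping.lookup (embed3 p) i = Poly_Mapping.lookup (embed3 q) i" for i using eq by simp
  from this[of 0] this[of 1] this[of 2] show "p = q" by (simp add: pq lookup_embed3)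
qed

lemma standard_cube_1: "standard_cube 1 = axis 0 ` {0..1}"
proof
  show "axis 0 ` {0..1} \<subseteq> standard_cube 1" by (auto simp: standard_cube_def lookup_axis)
  show "standard_cube 1 \<subseteq> axis 0 ` {0..1}"
  proof
    fix z assume "z \<in> standard_cube 1"
    then have "z = axis 0 (Poly_Mapping.lookup z 0)" "Poly_Mapping.lookup z 0 \<in> {0..1}"
      by (auto simp: standard_cube_def lookup_axis intro!: poly_mapping_eqI)
    then show "z \<in> axis 0 ` {0..1}" by blast
  qed
qed

lemma standard_cube_3: "standard_cube 3 = embed3 ` prism 0"
proof
  show "embed3 ` prism 0 \<subseteq> standard_cube 3"
    by (auto simp: standard_cube_def prism_def lookup_embed3)
  show "standard_cube 3 \<subseteq> embed3 ` prism 0"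
  proof
    fix w assume w: "w \<in> standard_cube 3"
    let ?p = "(Poly_Mapping.lookup w 0, Poly_Mapping.lookup w 1, Poly_Mapping.lookup w 2)"
    have "w = embed3 ?p"
      using w by (intro poly_mapping_eqI) (auto simp: standard_cube_def lookup_embed3)
    moreover have "?p \<in> prism 0"
      using w by (auto simp: standard_cube_def prism_def)
    ultimately show "w \<in> embed3 ` prism 0" by blast
  qed
qed

lemma has_aff_dim_interval: "has_aff_dim 1 {0..1::real}"
proof -
  have UNIV: "affine hull S = UNIV" if "0 \<in> S" "1 \<in> S" for S :: "real set"
  proof -
    have "x \<in> affine hull S" for x
      using mem_affine_3_minus[OF affine_affine_hull hull_inc[OF that(1)] hull_inc[OF that(2)] hull_inc[OF that(1)], of x]
      by simp
    then show ?thesis by blast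
  qed
  have "affine hull {0, 1::real} = affine hull {0..1}" by (simp add: UNIV)
  moreover have "\<not> affine_dependent {0, 1::real}" by (rule affine_independent_2)
  moreover have "card {0, 1::real} = 1 + 1" by simp
  ultimately show ?thesis unfolding has_aff_dim_def by blast
qed

text \<open>\<open>has_aff_dim\<close> sees only the affine hull, and the prism and the product of
  three intervals both span the whole space.\<close>

lemma has_aff_dim_prism:
  assumes "0 \<le> k"
  shows "has_aff_dim 3 (prism k)"
proof -
  have UNIV: "affine hull S = UNIV" if "{(0, 0, 0), (1, 0, 0), (0, 1, 0), (0, 0, 1)} \<subseteq> S"
    for S :: "(real \<times> real \<times> real) set"
  proof -
    have H: "(0, 0, 0) \<in> affine hull S" "(1, 0, 0) \<in> affine hull S" "(0, 1, 0) \<in> affine hull S" "(0, 0, 1) \<in> affine hull S"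
      using that by (auto intro: hull_inc)
    have step: "p + r *\<^sub>R (q - (0, 0, 0)) \<in> affine hull S" if "p \<in> affine hull S" "q \<in> affine hull S" for p q r
      using mem_affine_3_minus[OF affine_affine_hull that H(1)] .
    have "(x, y, z) \<in> affine hull S" for x y z
      using step[OF step[OF step[OF H(1,2), of x] H(3), of y] H(4), of z] by simp
    then show ?thesis by auto
  qed
  have "has_aff_dim (1 + (1 + 1)) ({0..1::real} \<times> {0..1::real} \<times> {0..1::real})"
    by (intro has_aff_dim_Times has_aff_dim_interval) auto
  moreover have "affine hull ({0..1::real} \<times> {0..1::real} \<times> {0..1::real}) = UNIV" by (rule UNIV) auto
  moreover have "affine hull (prism k) = UNIV" using assms by (intro UNIV) (auto simp: prism_def)
  ultimately show ?thesis unfolding has_aff_dim_def by (simp add: eval_nat_numeral)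
qed

text \<open>A segment triangulates itself and has ratio 1; it is the factor that fills up the
  dimensions not divisible by 3.\<close>

lemma has_cube_triangulation_1: "has_cube_triangulation 1 1"
proof -
  have interval: "{0..1::real} = convex hull {0, 1}"
    using convex_hull_eq_real_cbox[of 0 1] by (simp add: closed_segment_eq_real_ivl flip: segment_convex_hull)
  have "combinatorial_cube 1 (standard_cube 1)"
    unfolding combinatorial_cube_def standard_cube_1
    by (intro conjI polytope_linear_image linear_axis has_aff_dim_linear_image inj_axis has_aff_dim_interval
        face_lattice_isomorphic_refl) (simp add: interval polytope_convex_hull)
  moreover have "simplicial 1 {0..1::real} real {{0, 1}}"
    unfolding simplicial_def
  proof (intro conjI ballI impI)
    have "\<not> affine_dependent {0, 1::real}" by (rule affine_independent_2)
    then have "vertices {0..1::real} = {0, 1}" unfolding interval by (rule vertices_simplex) simp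
    then show "real ` \<sigma> \<subseteq> vertices {0..1}" if "\<sigma> \<in> {{0, 1}}" for \<sigma> using that by auto
    show "{0..1::real} = (\<Union>\<sigma>\<in>{{0, 1}}. convex hull (real ` \<sigma>))" by (simp add: interval)
    fix \<sigma> \<tau> u u' assume *: "\<sigma> \<in> {{0, 1::nat}}" "\<tau> \<in> {{0, 1::nat}}" "u \<in> weights \<sigma>" "u' \<in> weights \<tau>"
      "(\<Sum>i\<in>\<sigma>. u i *\<^sub>R real i) = (\<Sum>i\<in>\<tau>. u' i *\<^sub>R real i)"
    then have "u 1 = u' 1" by simp
    moreover have "u 0 = u' 0" using * weightsD(3)[of u \<sigma>] weightsD(3)[of u' \<tau>] by simp
    moreover have "u i = u' i" if "i \<notin> {0, 1}" for i
      using * that weightsD(2)[of u \<sigma> i] weightsD(2)[of u' \<tau> i] by simp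
    ultimately show "u = u'" by (metis ext insert_iff singleton_iff)
  qed auto
  then have "simplicial 1 (standard_cube 1) (axis 0 \<circ> real) {{0, 1}}"
    unfolding standard_cube_1 by (intro simplicial_linear_image linear_axis inj_axis)
  ultimately show ?thesis
    unfolding has_cube_triangulation_def by (intro exI conjI) auto
qed

lemma has_cube_triangulation_3: "has_cube_triangulation 3 7"
proof -
  note h = linear_embed3 inj_embed3
  have "polytope (prism 1)"
    using prism_hull[of 1] polytope_convex_hull[of "prism_vertex 1 ` prism_labels"] by simp
  then have "polytope (embed3 ` prism 1)" by (intro polytope_linear_image h)
  moreover have "has_aff_dim 3 (embed3 ` prism 1)"
    by (intro has_aff_dim_linear_image h has_aff_dim_prism) simp
  moreover have "face_lattice_isomorphic (embed3 ` prism 1) (standard_cube 3)"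
  proof -
    have "face_lattice_isomorphic (embed3 ` prism 1) (prism 1)"
      by (rule face_lattice_isomorphic_sym[OF face_lattice_isomorphic_linear_image[OF h]])
    moreover have "face_lattice_isomorphic (prism 1) (prism 0)"
      by (rule facet_description_isomorphic[OF prism_facet_description prism_facet_description]) auto
    moreover have "face_lattice_isomorphic (prism 0) (standard_cube 3)"
      unfolding standard_cube_3 by (rule face_lattice_isomorphic_linear_image[OF h])
    ultimately show ?thesis by (blast intro: face_lattice_isomorphic_trans)
  qed
  ultimately have "combinatorial_cube 3 (embed3 ` prism 1)" by (simp add: combinatorial_cube_def)
  then show ?thesis
    using simplicial_linear_image[OF simplicial_seven h] card_seven_simplices
    unfolding has_cube_triangulation_def by blast
qed

text \<open>(d + e)! is the binomial coefficient times d! e!, so the binomial factor of the product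
  cancels and the ratios to the factorials multiply.\<close>

lemma has_cube_triangulation_ratio:
  assumes "has_cube_triangulation d m" "a * fact d \<le> real m" "0 \<le> a"
    and "has_cube_triangulation e n" "b * fact e \<le> real n" "0 \<le> b"
  shows "\<exists>k. has_cube_triangulation (d + e) k \<and> a * b * fact (d + e) \<le> real k"
proof (intro exI conjI)
  show "has_cube_triangulation (d + e) (((d + e) choose d) * m * n)"
    by (rule has_cube_triangulation_product[OF assms(1,4)])
  have "a * b * fact (d + e) = real ((d + e) choose d) * (a * fact d) * (b * fact e)"
    by (simp add: binomial_fact)
  also have "\<dots> \<le> real ((d + e) choose d) * real m * real n"
    using assms by (intro mult_mono) auto
  finally show "a * b * fact (d + e) \<le> real (((d + e) choose d) * m * n)" by simp
qed

lemma cube_triangulations_3: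
  "\<exists>n. has_cube_triangulation (3 * Suc k) n \<and> (7 / 6) ^ Suc k * fact (3 * Suc k) \<le> real n"
proof (induction k)
  case 0
  \<comment> \<open>Since 3! = 6, the seven simplices are the source of the ratio 7/6.\<close>
  show ?case using has_cube_triangulation_3 by (intro exI[of _ 7]) (simp add: fact_numeral)
next
  case (Suc k)
  then obtain n where "has_cube_triangulation (3 * Suc k) n" "(7 / 6) ^ Suc k * fact (3 * Suc k) \<le> real n" by blast
  then have "\<exists>m. has_cube_triangulation (3 + 3 * Suc k) m \<and> (7 / 6) * (7 / 6) ^ Suc k * fact (3 + 3 * Suc k) \<le> real m"
    by (intro has_cube_triangulation_ratio[OF has_cube_triangulation_3]) (auto simp: fact_numeral)
  then show ?case by simp
qed

text \<open>Each product with a segment multiplies the ratio by 1, so the bound a survives in higher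
  dimensions.\<close>

lemma cube_triangulations_add:
  assumes "\<exists>n. has_cube_triangulation d n \<and> a * fact d \<le> real n" "0 \<le> a"
  shows "\<exists>n. has_cube_triangulation (d + r) n \<and> a * fact (d + r) \<le> real n"
proof (induction r)
  case 0
  then show ?case using assms by simp
next
  case (Suc r)
  then obtain n where "has_cube_triangulation (d + r) n" "a * fact (d + r) \<le> real n" by blast
  then have "\<exists>m. has_cube_triangulation (d + r + 1) m \<and> a * 1 * fact (d + r + 1) \<le> real m"
    using assms(2) by (intro has_cube_triangulation_ratio[OF _ _ _ has_cube_triangulation_1]) auto
  then show ?case by simp
qed

theorem proposition4p1:
  shows "\<exists>c::real. c \<ge> 1.031 \<and>
           (\<forall>d::nat. d > 2 \<longrightarrow> real (max_cube_triangulation d) \<ge> c ^ d * fact d)"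
proof (intro exI[of _ "1.031 :: real"] conjI allI impI)
  fix d :: nat assume "2 < d"
  \<comment> \<open>The condition d > 2 provides at least one prism factor, so their number is
    \<open>Suc k\<close> and the subtraction is exact.\<close>
  define k r where "k = d div 3 - 1" and "r = d mod 3"
  have d: "d = 3 * Suc k + r" and r: "r \<le> 2"
    using \<open>2 < d\<close> by (auto simp: k_def r_def)
  \<comment> \<open>The remainder is at most 2 \<le> 2 * \<open>Suc k\<close>, with equality only
    for d = 5.\<close>
  have "d \<le> 5 * Suc k" using d r by simp
  then have "(1.031 :: real) ^ d \<le> 1.031 ^ (5 * Suc k)"
    by (intro power_increasing) auto
  also have "\<dots> = (1.031 ^ 5) ^ Suc k" by (rule power_mult)
  \<comment> \<open>Numerically, 1.031 ^ 5 is about 1.1649 and 7/6 about 1.1667.\<close>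
  also have "\<dots> \<le> (7 / 6) ^ Suc k"
    by (intro power_mono) (simp_all add: power_numeral_reduce)
  finally have "(1.031 :: real) ^ d * fact d \<le> (7 / 6) ^ Suc k * fact d"
    by (intro mult_right_mono) auto
  moreover obtain n where "has_cube_triangulation d n" "(7 / 6) ^ Suc k * fact d \<le> real n"
    using cube_triangulations_add[OF cube_triangulations_3, of k r] d by auto
  moreover from this have "n \<le> max_cube_triangulation d" by (intro has_cube_triangulation_max)
  ultimately show "1.031 ^ d * fact d \<le> real (max_cube_triangulation d)" by linarith
qed simp

end
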